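(* Let $d\ge1$ be an integer, let $\alpha\in[0,1)$ be irrational, and let $(\overline{X_{\mathcal V_d}},\sigma)$ be the subshift obtained by coding the affine nilsystem $(\mathbb T^d,T_d)$ with respect to the partition $\mathcal V_d$ (as defined in the context). Then the group $\mathrm{Aut}(\overline{X_{\mathcal V_d}},\sigma)$ is virtually $\mathbb Z$, i.e., it has a finite index subgroup isomorphic to $\mathbb Z$.
   Context: $\mathbb T=\mathbb R/\mathbb Z$. Let $A_d=\big(\binom{j}{i}\big)_{0\le i,j\le d-1}$ (upper triangular with ones on the diagonal). The map $T_d:\mathbb T^d\to\mathbb T^d$ sends $(x_0,\dots,x_{d-1})$ to the first $d$ coordinates of $A_{d+1}(x_0,\dots,x_{d-1},\alpha)^t$ modulo one; e.g. $T_2(x_0,x_1)=(x_0+x_1+\alpha,\,x_1+2\alpha)$. For $i,n\in\mathbb Z$ let $H_{i,n}=\{x\in\mathbb R^d:\sum_{k=0}^{d-1}i^kx_k+i^d\alpha=n\}$ (with $0^0=1$), and let $\widehat H_i\subset\mathbb T^d$ be the common projection of the hyperplanes $H_{i,n}$, $n\in\mathbb Z$, to $\mathbb T^d$. The finite partition $\mathcal V_d$ of $\mathbb T^d$ is the one induced by $\widehat H_0,\dots,\widehat H_d$: its atoms are the cells (connected components) of $\mathbb T^d\setminus(\widehat H_0\cup\dots\cup\widehat H_d)$, where the ambiguities in assigning the boundary points (the points of $\widehat H_0\cup\dots\cup\widehat H_d$) to adjacent cells are resolved arbitrarily. Write $\mathcal V_d=\{U_1,\dots,U_m\}$. Then $X_{\mathcal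 V_d}=\{(w_i)_{i\in\mathbb Z}\in\{1,\dots,m\}^{\mathbb Z}:\bigcap_{i\in\mathbb Z}T_d^{-i}U_{w_i}\ne\emptyset\}$, $\overline{X_{\mathcal V_d}}$ is its closure in $\{1,\dots,m\}^{\mathbb Z}$ (product topology), and $\sigma$ is the shift $\sigma((w_i)_i)=(w_{i+1})_i$. $\mathrm{Aut}(X,\sigma)$ denotes the group of homeomorphisms of $X$ commuting with $\sigma$.
   Formalization: Boundary points are assigned to adjacent cells face by face (each face of the arrangement goes wholly to one arbitrarily chosen adjacent cell), not point by point; for d ≥ 2 an arbitrary pointwise assignment can give an automorphism group that is not virtually ℤ. *)

theory Defs
  imports "HOL-Analysis.Analysis" "HOL-Algebra.Elementary_Groups"
begin

section \<open>The circle\<close>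

quotient_type circle = real / "\<lambda>x y :: real. x - y \<in> \<int>"
  morphisms circle_rep to_circle
proof (rule equivpI)
  show "reflp (\<lambda>x y :: real. x - y \<in> \<int>)" by (simp add: reflp_def)
  show "symp (\<lambda>x y :: real. x - y \<in> \<int>)"
    by (metis (no_types, lifting) Ints_minus minus_diff_eq sympI)
  show "transp (\<lambda>x y :: real. x - y \<in> \<int>)"
    by (rule transpI) (metis Ints_add diff_add_cancel add_diff_eq)
qed

instantiation circle :: ab_group_add
begin

lift_definition zero_circle :: circle is "0 :: real" .

lift_definition plus_circle :: "circle \<Rightarrow> circle \<Rightarrow> circle" is "(+) :: real \<Rightarrow> real \<Rightarrow> real"
  by (metis Ints_add add_diff_add)

lift_definition uminus_circle :: "circle \<Rightarrow> circle" is "uminus :: real \<Rightarrow> real"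
  by (metis Ints_minus minus_diff_minus)

lift_definition minus_circle :: "circle \<Rightarrow> circle \<Rightarrow> circle" is "(-) :: real \<Rightarrow> real \<Rightarrow> real"
  by (metis Ints_diff diff_diff_eq diff_diff_eq2 add.commute add_diff_eq diff_add_eq)

instance
  by standard (transfer; simp)+

end

lift_definition circle_mult :: "nat \<Rightarrow> circle \<Rightarrow> circle" is "\<lambda>n x. real n * x"
  by (metis Ints_mult Ints_of_nat right_diff_distrib)

lemma surj_to_circle: "surj to_circle"
  by (metis Quotient_abs_rep Quotient_circle surjI)

text \<open>The quotient topology of \<open>\<real>/\<int>\<close>.\<close>

instantiation circle :: topological_space
begin

definition open_circle :: "circle set \<Rightarrow> bool"
  where "open_circle U \<longleftrightarrow> open (to_circle -` U)"

instance
  by standard (auto simp: open_circle_def vimage_Union)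

end

section \<open>The affine nilsystem\<close>

text \<open>Points of \<open>\<real>\<^sup>d\<close> and of the torus are extensional functions on the indices \<open>0, \<dots>, d - 1\<close>.\<close>

definition torus :: "nat \<Rightarrow> (nat \<Rightarrow> circle) topology"
  where "torus d = product_topology (\<lambda>_. euclidean) {..<d}"

definition torus_proj :: "nat \<Rightarrow> (nat \<Rightarrow> real) \<Rightarrow> nat \<Rightarrow> circle"
  where "torus_proj d x = (\<lambda>k\<in>{..<d}. to_circle (x k))"

definition pascal :: "nat \<Rightarrow> nat \<Rightarrow> nat"
  where "pascal i j = j choose i"

definition nil_map :: "nat \<Rightarrow> real \<Rightarrow> (nat \<Rightarrow> circle) \<Rightarrow> nat \<Rightarrow> circle"
  where "nil_map d \<alpha> x =
    (\<lambda>i\<in>{..<d}. \<Sum>j\<le>d. circle_mult (pascal i j) (if j < d then x j else to_circle \<alpha>))"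

text \<open>\<open>T\<^sup>-\<^sup>i U\<close> for an integer \<open>i\<close>. As \<open>T\<close> is a bijection of the torus, for negative \<open>i\<close> this is
  the forward image.\<close>

definition nil_preimage :: "nat \<Rightarrow> real \<Rightarrow> int \<Rightarrow> (nat \<Rightarrow> circle) set \<Rightarrow> (nat \<Rightarrow> circle) set"
  where "nil_preimage d \<alpha> i U =
    (if 0 \<le> i then {x \<in> topspace (torus d). (nil_map d \<alpha> ^^ nat i) x \<in> U}
     else (nil_map d \<alpha> ^^ nat (- i)) ` U)"

section \<open>The partition\<close>

definition hyperplane :: "nat \<Rightarrow> real \<Rightarrow> int \<Rightarrow> int \<Rightarrow> (nat \<Rightarrow> real) set"
  where "hyperplane d \<alpha> i n =
    {x \<in> {..<d} \<rightarrow>\<^sub>E UNIV. (\<Sum>k<d. of_int i ^ k * x k) + of_int i ^ d * \<alpha> = of_int n}"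

definition hat_hyperplane :: "nat \<Rightarrow> real \<Rightarrow> int \<Rightarrow> (nat \<Rightarrow> circle) set"
  where "hat_hyperplane d \<alpha> i = (\<Union>n. torus_proj d ` hyperplane d \<alpha> i n)"

definition cells :: "nat \<Rightarrow> real \<Rightarrow> (nat \<Rightarrow> circle) set set"
  where "cells d \<alpha> = connected_components_of
    (subtopology (torus d) (topspace (torus d) - (\<Union>i\<in>{0..int d}. hat_hyperplane d \<alpha> i)))"

text \<open>The faces of all dimensions of the arrangement: the components of the strata formed by the
  points that lie on the hyperplanes with index in \<open>J\<close> and on no others. The cells are
  the faces with \<open>J = {}\<close>.\<close>

definition faces :: "nat \<Rightarrow> real \<Rightarrow> (nat \<Rightarrow> circle) set set"
  where "faces d \<alpha> = (\<Union>J\<in>Pow {0..int d}. connected_components_of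
    (subtopology (torus d)
      {x \<in> topspace (torus d). \<forall>i\<in>{0..int d}. x \<in> hat_hyperplane d \<alpha> i \<longleftrightarrow> i \<in> J}))"

text \<open>\<open>U 1, \<dots>, U m\<close> enumerates a partition of the torus whose atoms are the cells, every face in the
  boundary having been given to an arbitrary one of the cells adjacent to it. The
  choice is made per face and not per point, and choices for different faces are independent.
  With an arbitrary choice for every single boundary point the automorphism group can fail to be
  virtually \<open>\<int>\<close> when \<open>d \<ge> 2\<close>: two assignments along the \<open>T\<close>-orbits of the points of a face, each
  used on a dense set of points and neither produced by a limit of interior points, can
  be swapped on any one of infinitely many clopen pieces of the face.\<close>

definition cell_partition :: "nat \<Rightarrow> real \<Rightarrow> nat \<Rightarrow> (nat \<Rightarrow> (nat \<Rightarrow> circle) set) \<Rightarrow> bool"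
  where "cell_partition d \<alpha> m U \<longleftrightarrow>
    (\<exists>C. bij_betw C {1..m} (cells d \<alpha>) \<and>
         (\<forall>k\<in>{1..m}. C k \<subseteq> U k \<and> U k \<subseteq> torus d closure_of C k)) \<and>
    disjoint_family_on U {1..m} \<and>
    (\<Union>k\<in>{1..m}. U k) = topspace (torus d) \<and>
    (\<forall>F\<in>faces d \<alpha>. \<exists>k\<in>{1..m}. F \<subseteq> U k)"

section \<open>Subshifts and their automorphism groups\<close>

definition full_shift :: "nat \<Rightarrow> (int \<Rightarrow> nat) topology"
  where "full_shift m = product_topology (\<lambda>_. discrete_topology {1..m}) UNIV"

definition shift :: "(int \<Rightarrow> nat) \<Rightarrow> int \<Rightarrow> nat"
  where "shift w = (\<lambda>i. w (i + 1))"

definition coding :: "nat \<Rightarrow> real \<Rightarrow> nat \<Rightarrow> (nat \<Rightarrow> (nat \<Rightarrow> circle) set) \<Rightarrow> (int \<Rightarrow> nat) set"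
  where "coding d \<alpha> m U =
    {w \<in> topspace (full_shift m). (\<Inter>i. nil_preimage d \<alpha> i (U (w i))) \<noteq> {}}"

text \<open>Automorphisms are represented by extensional functions on \<open>X\<close>, so that equality
  of group elements is equality on \<open>X\<close>.\<close>

definition aut_shift :: "nat \<Rightarrow> (int \<Rightarrow> nat) set \<Rightarrow> ((int \<Rightarrow> nat) \<Rightarrow> int \<Rightarrow> nat) monoid"
  where "aut_shift m X =
    \<lparr>carrier = {\<phi> \<in> extensional X.
        homeomorphic_map (subtopology (full_shift m) X) (subtopology (full_shift m) X) \<phi> \<and>
        (\<forall>w\<in>X. \<phi> (shift w) = shift (\<phi> w))},
      monoid.mult = compose X,
      one = (\<lambda>w\<in>X. w)\<rparr>"

definition virtually_int :: "('a, 'b) monoid_scheme \<Rightarrow> bool"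
  where "virtually_int G \<longleftrightarrow> group G \<and>
    (\<exists>H. subgroup H G \<and> finite (rcosets\<^bsub>G\<^esub> H) \<and> G\<lparr>carrier := H\<rparr> \<cong> integer_group)"

section \<open>Basic properties\<close>

lemma to_circle_eq_iff: "to_circle x = to_circle y \<longleftrightarrow> x - y \<in> \<int>"
  by (rule circle.abs_eq_iff)

lemma to_circle_sum: "to_circle (sum f A) = (\<Sum>i\<in>A. to_circle (f i))"
  by (induction A rule: infinite_finite_induct)
     (auto simp: zero_circle.abs_eq plus_circle.abs_eq [symmetric])

text \<open>The hyperplanes with the same index \<open>i\<close> have a common projection.\<close>

lemma hat_hyperplane_eq:
  assumes "d \<ge> 1"
  shows "hat_hyperplane d \<alpha> i = torus_proj d ` hyperplane d \<alpha> i n"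
proof -
  have "torus_proj d ` hyperplane d \<alpha> i p \<subseteq> torus_proj d ` hyperplane d \<alpha> i q" for p q
  proof
    fix y assume "y \<in> torus_proj d ` hyperplane d \<alpha> i p"
    then obtain x where x: "x \<in> hyperplane d \<alpha> i p" "y = torus_proj d x" by blast
    let ?z = "x(0 := x 0 + of_int (q - p))"
    have "(\<Sum>k<d. of_int i ^ k * ?z k) =
        (\<Sum>k<d. of_int i ^ k * x k + (if k = 0 then of_int (q - p) else 0))"
      by (rule sum.cong) auto
    also have "\<dots> = (\<Sum>k<d. of_int i ^ k * x k) + of_int (q - p)"
      using assms by (simp add: sum.distrib)
    finally have "?z \<in> hyperplane d \<alpha> i q"
      using x(1) assms by (auto simp: hyperplane_def PiE_def extensional_def)
    moreover have "torus_proj d ?z = y"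
      by (auto simp: x(2) torus_proj_def to_circle_eq_iff fun_eq_iff restrict_def)
    ultimately show "y \<in> torus_proj d ` hyperplane d \<alpha> i q" by blast
  qed
  then show ?thesis unfolding hat_hyperplane_def by blast
qed

lemma nil_map_torus_proj:
  "nil_map d \<alpha> (torus_proj d x) =
     torus_proj d (\<lambda>i. (\<Sum>j<d. real (j choose i) * x j) + real (d choose i) * \<alpha>)"
proof
  fix i
  have "{..d} = insert d {..<d}" by auto
  then show "nil_map d \<alpha> (torus_proj d x) i =
     torus_proj d (\<lambda>i. (\<Sum>j<d. real (j choose i) * x j) + real (d choose i) * \<alpha>) i"
    by (auto simp: nil_map_def torus_proj_def pascal_def circle_mult.abs_eq to_circle_sum
        plus_circle.abs_eq [symmetric] add.commute)
qed

lemma group_aut_shift: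
  assumes X: "X \<subseteq> topspace (full_shift m)" and inv: "shift ` X \<subseteq> X"
  shows "group (aut_shift m X)"
proof -
  let ?Y = "subtopology (full_shift m) X"
  have top: "topspace ?Y = X" using X by auto
  have cong: "homeomorphic_map ?Y ?Y f \<longleftrightarrow> homeomorphic_map ?Y ?Y g" if "\<And>x. x \<in> X \<Longrightarrow> f x = g x" for f g
    using that top homeomorphic_map_eq by metis
  have im: "f ` X = X" if "homeomorphic_map ?Y ?Y f" for f
    using that homeomorphic_imp_surjective_map top by metis
  show ?thesis
  proof (rule groupI)
    fix f g assume f: "f \<in> carrier (aut_shift m X)" and g: "g \<in> carrier (aut_shift m X)"
    have hf: "homeomorphic_map ?Y ?Y f" and hg: "homeomorphic_map ?Y ?Y g"
      using f g by (auto simp: aut_shift_def)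
    have "homeomorphic_map ?Y ?Y (compose X f g)"
      using homeomorphic_map_compose [OF hg hf] cong [of "f \<circ> g" "compose X f g"]
      by (simp add: compose_def)
    then show "f \<otimes>\<^bsub>aut_shift m X\<^esub> g \<in> carrier (aut_shift m X)"
      using f g inv im [OF hg] by (auto simp: aut_shift_def compose_def image_subset_iff)
  next
    have "homeomorphic_map ?Y ?Y (\<lambda>w\<in>X. w)"
      using cong [of id "\<lambda>w\<in>X. w"] homeomorphic_map_id by auto
    then show "\<one>\<^bsub>aut_shift m X\<^esub> \<in> carrier (aut_shift m X)"
      using inv by (auto simp: aut_shift_def)
  next
    fix f g h
    assume "f \<in> carrier (aut_shift m X)" and "g \<in> carrier (aut_shift m X)"
      and h: "h \<in> carrier (aut_shift m X)"
    then show "f \<otimes>\<^bsub>aut_shift m X\<^esub> g \<otimes>\<^bsub>aut_shift m X\<^esub> h =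
        f \<otimes>\<^bsub>aut_shift m X\<^esub> (g \<otimes>\<^bsub>aut_shift m X\<^esub> h)"
      using im [of h] by (auto simp: aut_shift_def compose_def fun_eq_iff)
  next
    fix f assume f: "f \<in> carrier (aut_shift m X)"
    then have hf: "homeomorphic_map ?Y ?Y f" by (auto simp: aut_shift_def)
    show "\<one>\<^bsub>aut_shift m X\<^esub> \<otimes>\<^bsub>aut_shift m X\<^esub> f = f"
      using f im [OF hf] by (auto simp: aut_shift_def compose_def fun_eq_iff extensional_def)
    obtain g where g: "homeomorphic_maps ?Y ?Y f g" using hf homeomorphic_map_maps by blast
    then have hg: "homeomorphic_map ?Y ?Y g"
      using homeomorphic_maps_map by blast
    have gf: "\<And>x. x \<in> X \<Longrightarrow> g (f x) = x" and fg: "\<And>x. x \<in> X \<Longrightarrow> f (g x) = x"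
      using g top by (auto simp: homeomorphic_maps_def)
    have gX: "\<And>x. x \<in> X \<Longrightarrow> g x \<in> X" using im [OF hg] by blast
    let ?g = "restrict g X"
    have "homeomorphic_map ?Y ?Y ?g" using hg cong [of g ?g] by simp
    moreover have "g (shift w) = shift (g w)" if "w \<in> X" for w
    proof -
      have "f (shift (g w)) = shift (f (g w))"
        using f gX [OF that] by (auto simp: aut_shift_def)
      then show ?thesis using gf fg gX inv that by (metis image_subset_iff)
    qed
    ultimately have "?g \<in> carrier (aut_shift m X)"
      using inv by (auto simp: aut_shift_def)
    moreover have "?g \<otimes>\<^bsub>aut_shift m X\<^esub> f = \<one>\<^bsub>aut_shift m X\<^esub>"
      using gf im [OF hf] by (auto simp: aut_shift_def compose_def fun_eq_iff)
    ultimately show "\<exists>g\<in>carrier (aut_shift m X). g \<otimes>\<^bsub>aut_shift m X\<^esub> f = \<one>\<^bsub>aut_shift m X\<^esub>"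
      by blast
  qed
qed

end

theory Submission
  imports Defs
begin

text \<open>A point \<open>x\<close> of the torus is the polynomial \<open>p(n) = x\<^sub>0 + x\<^sub>1 n + \<dots> + x\<^sub>d\<^sub>-\<^sub>1 n\<^sup>d\<^sup>-\<^sup>1 + \<alpha> n\<^sup>d\<close> modulo
  integral polynomials of degree less than \<open>d\<close>; \<open>T\<close> is the translation \<open>p(n) \<mapsto> p(n + 1)\<close>, and \<open>x\<close> lies on the
  hyperplane of index \<open>i\<close> iff \<open>p(i)\<close> is an integer. Since \<open>\<alpha>\<close> is irrational, this happens for at most \<open>d\<close>
  integers \<open>i\<close>, so that two words of the subshift have the same base point iff they are eventually
  equal. Hence an automorphism induces a continuous map of the torus that commutes with \<open>T\<close>. This map sends
  vertical circles to vertical circles by a fixed homomorphism, and some open piece of the hyperplane of index 0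
  into a hyperplane of some index; by minimality it is an iterate of \<open>T\<close> followed by a translation by one of
  the finitely many \<open>c\<close> whose polynomial takes integer values on the integers. Finally, an automorphism over the
  identity is trivial, because each fibre contains only one word that is not a limit of words from larger
  strata of the arrangement. The powers of the shift therefore have finite index.\<close>

section \<open>Polynomials modulo integral polynomials\<close>

text \<open>The letters at boundary points are arbitrary up to constancy on faces. So base points
  are read off closed cells only, and the induced map is a relation between lifts, single-valued
  modulo integral polynomials. Equal letters fix the difference of the integer parts of two lifts on
  windows of d + 1 integers. Overlapping windows glue to one integral polynomial, and what remains
  is bounded, hence constant; density of fractional parts makes it 0. A point on the hyperplane 0
  and on none of 1, ..., d has two words differing at place 0, one from each side. Their images
  differ inside the window of the inverse block code, so the image point lies on a hyperplane of
  bounded index, and a finite closed cover yields an open piece with one index n0. On vertical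
  circles through that piece, an image Q of P satisfies Q(n0) = a P(0) modulo integers, with a the
  degree on vertical circles. Returns to the piece make Q(n + n0) - a P(n) integral for infinitely
  many n. As \<alpha> is irrational, a = 1 and the difference has rational coefficients;
  connectedness of the torus makes it the same for all P.\<close>

definition lifts :: "nat \<Rightarrow> real \<Rightarrow> real poly set"
  where "lifts d \<alpha> = {P. coeff P d = \<alpha> \<and> (\<forall>k>d. coeff P k = 0)}"

definition low :: "nat \<Rightarrow> real poly set"
  where "low d = {P. \<forall>k\<ge>d. coeff P k = 0}"

definition integral_polys :: "nat \<Rightarrow> real poly set"
  where "integral_polys d = {P \<in> low d. \<forall>k. coeff P k \<in> \<int>}"

definition translate :: "int \<Rightarrow> real poly \<Rightarrow> real poly"
  where "translate c P = P \<circ>\<^sub>p [:of_int c, 1:]"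

lemma poly_translate [simp]: "poly (translate c P) x = poly P (x + of_int c)"
  by (simp add: translate_def poly_pcompose add.commute)

lemma translate_translate [simp]: "translate a (translate b P) = translate (a + b) P"
  by (simp add: translate_def flip: pcompose_assoc) (simp add: pcompose_pCons add.commute)

lemma translate_0 [simp]: "translate 0 P = P"
  by (simp add: translate_def)

lemma translate_add: "translate c (P + Q) = translate c P + translate c Q"
  by (simp add: translate_def pcompose_add)

lemma translate_diff: "translate c (P - Q) = translate c P - translate c Q"
  by (simp add: translate_def pcompose_diff)

lemma translate_smult: "translate c (smult a P) = smult a (translate c P)"
  by (simp add: translate_def pcompose_smult)

lemma translate_const [simp]: "translate c [:a:] = [:a:]"
  by (simp add: translate_def)

lemma coeff_translate_monom:
  "coeff (translate c (monom s j)) k = (if k \<le> j then real (j choose k) * of_int c ^ (j - k) * s else 0)"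
proof -
  have "translate c (monom s j) = smult s ([:of_int c, 1:] ^ j)"
    by (induction j) (auto simp: translate_def monom_0 monom_Suc pcompose_pCons)
  then show ?thesis
    by (auto simp: coeff_linear_poly_power intro!: coeff_eq_0)
       (simp add: degree_linear_power coeff_eq_0)
qed

text \<open>For c = 1 this is multiplication by the Pascal matrix, which makes translation by 1 a
  lift of \<open>nil_map\<close>. Only indices j \<ge> k occur, and this triangular form drives the
  inductions over coordinates below.\<close>

lemma coeff_translate:
  assumes "\<And>k. k > d \<Longrightarrow> coeff P k = 0"
  shows "coeff (translate c P) k = (\<Sum>j=k..d. real (j choose k) * of_int c ^ (j - k) * coeff P j)"
proof -
  have "degree P \<le> d" using assms by (simp add: degree_le)
  then have "P = (\<Sum>j\<le>d. monom (coeff P j) j)" by (simp add: poly_as_sum_of_monoms')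
  then have "translate c P = translate c (\<Sum>j\<le>d. monom (coeff P j) j)" by (rule arg_cong)
  then have "coeff (translate c P) k = (\<Sum>j\<le>d. coeff (translate c (monom (coeff P j) j)) k)"
    by (simp add: translate_def pcompose_sum coeff_sum)
  also have "\<dots> = (\<Sum>j\<le>d. if k \<le> j then real (j choose k) * of_int c ^ (j - k) * coeff P j else 0)"
    by (simp add: coeff_translate_monom)
  also have "\<dots> = (\<Sum>j=k..d. real (j choose k) * of_int c ^ (j - k) * coeff P j)"
    by (rule sum.mono_neutral_cong_right) auto
  finally show ?thesis .
qed

lemma poly_eq_sum:
  fixes x :: real
  assumes "\<And>k. k > d \<Longrightarrow> coeff P k = 0"
  shows "poly P x = (\<Sum>k\<le>d. coeff P k * x ^ k)"
proof -
  have "degree P \<le> d" using assms by (simp add: degree_le)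
  then show ?thesis unfolding poly_altdef
    by (intro sum.mono_neutral_left) (auto simp: coeff_eq_0)
qed

lemma lifts_translate [simp]: "P \<in> lifts d \<alpha> \<Longrightarrow> translate c P \<in> lifts d \<alpha>"
  by (auto simp: lifts_def coeff_translate [of d])

lemma low_translate [simp]: "P \<in> low d \<Longrightarrow> translate c P \<in> low d"
  by (auto simp: low_def coeff_translate [of "d"])

lemma integral_polys_translate [simp]: "P \<in> integral_polys d \<Longrightarrow> translate c P \<in> integral_polys d"
  using low_translate [of P d c]
  by (auto simp: integral_polys_def translate_def intro!: coeff_pcompose_semiring_closed Ints_sum Ints_mult)
     (auto simp: coeff_pCons split: nat.splits)

lemma low_add [simp]: "P \<in> low d \<Longrightarrow> Q \<in> low d \<Longrightarrow> P + Q \<in> low d"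
  and low_diff [simp]: "P \<in> low d \<Longrightarrow> Q \<in> low d \<Longrightarrow> P - Q \<in> low d"
  and low_smult [simp]: "P \<in> low d \<Longrightarrow> smult a P \<in> low d"
  and low_0 [simp]: "0 \<in> low d"
  by (auto simp: low_def)

lemma integral_polys_add [simp]:
    "P \<in> integral_polys d \<Longrightarrow> Q \<in> integral_polys d \<Longrightarrow> P + Q \<in> integral_polys d"
  and integral_polys_diff [simp]:
    "P \<in> integral_polys d \<Longrightarrow> Q \<in> integral_polys d \<Longrightarrow> P - Q \<in> integral_polys d"
  and integral_polys_uminus [simp]: "P \<in> integral_polys d \<Longrightarrow> - P \<in> integral_polys d"
  and integral_polys_0 [simp]: "0 \<in> integral_polys d"
  and integral_polys_low: "P \<in> integral_polys d \<Longrightarrow> P \<in> low d"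
  by (auto simp: integral_polys_def low_def)

lemma integral_polys_minus_iff: "A - B \<in> integral_polys d \<longleftrightarrow> B - A \<in> integral_polys d"
  using integral_polys_uminus [of "A - B" d] integral_polys_uminus [of "B - A" d] by auto

lemma integral_polys_trans:
  "A - B \<in> integral_polys d \<Longrightarrow> B - C \<in> integral_polys d \<Longrightarrow> A - C \<in> integral_polys d"
  using integral_polys_add [of "A - B" d "B - C"] by simp

lemma lifts_add_low [simp]: "P \<in> lifts d \<alpha> \<Longrightarrow> Q \<in> low d \<Longrightarrow> P + Q \<in> lifts d \<alpha>"
  by (auto simp: lifts_def low_def)

lemma lifts_diff_low [simp]: "P \<in> lifts d \<alpha> \<Longrightarrow> Q \<in> low d \<Longrightarrow> P - Q \<in> lifts d \<alpha>"
  by (auto simp: lifts_def low_def)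

lemma lifts_diff: "P \<in> lifts d \<alpha> \<Longrightarrow> Q \<in> lifts d \<alpha> \<Longrightarrow> P - Q \<in> low d"
  by (auto simp: lifts_def low_def le_less)

lemma low_const: "d \<ge> 1 \<Longrightarrow> [:a:] \<in> low d"
  by (auto simp: low_def coeff_pCons split: nat.splits)

lemma integral_polys_const: "d \<ge> 1 \<Longrightarrow> a \<in> \<int> \<Longrightarrow> [:a:] \<in> integral_polys d"
  by (auto simp: integral_polys_def low_const coeff_pCons split: nat.splits)

lemma poly_integral_polys: 
  assumes "u \<in> integral_polys d" "x \<in> \<int>" shows "poly u x \<in> \<int>"
proof -
  have "\<And>k. coeff u k \<in> \<int>" using assms by (auto simp: integral_polys_def)
  then show ?thesis unfolding poly_altdef using assms by (auto intro!: Ints_sum)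
qed

definition low_of :: "nat \<Rightarrow> (nat \<Rightarrow> real) \<Rightarrow> real poly"
  where "low_of d x = (\<Sum>k<d. monom (x k) k)"

lemma coeff_low_of [simp]: "coeff (low_of d x) k = (if k < d then x k else 0)"
proof -
  have "coeff (low_of d x) k = (\<Sum>j<d. if j = k then x j else 0)"
    by (auto simp: low_of_def coeff_sum intro!: sum.cong)
  then show ?thesis by auto
qed

lemma low_of_low [simp]: "low_of d x \<in> low d"
  by (auto simp: low_def)

lemma monom_lifts [simp]: "monom \<alpha> d \<in> lifts d \<alpha>"
  by (auto simp: lifts_def)

definition lift_of :: "nat \<Rightarrow> real \<Rightarrow> (nat \<Rightarrow> real) \<Rightarrow> real poly"
  where "lift_of d \<alpha> x = low_of d x + monom \<alpha> d"

lemma coeff_lift_of [simp]: "coeff (lift_of d \<alpha> x) k = (if k < d then x k else if k = d then \<alpha> else 0)"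
  by (auto simp: lift_of_def)

lemma lift_of_lifts [simp]: "lift_of d \<alpha> x \<in> lifts d \<alpha>"
  by (auto simp: lifts_def)

lemma lift_of_coeff: "P \<in> lifts d \<alpha> \<Longrightarrow> lift_of d \<alpha> (coeff P) = P"
  by (rule poly_eqI) (auto simp: lifts_def)

lemma degree_low: "P \<in> low d \<Longrightarrow> d \<ge> 1 \<Longrightarrow> degree P < d"
  by (auto simp: low_def intro!: degree_lessI)

lemma degree_lifts: "P \<in> lifts d \<alpha> \<Longrightarrow> degree P \<le> d"
  by (auto simp: lifts_def intro!: degree_le)

section \<open>Interpolation and rationality of coefficients\<close>

lemma low_eqI:
  assumes "P \<in> low d" "Q \<in> low d" "finite A" "card A \<ge> d" "\<And>x. x \<in> A \<Longrightarrow> poly P x = poly Q x"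
  shows "P = Q"
proof (cases "d \<ge> 1")
  case True
  then show ?thesis using assms poly_eqI_degree [of A P Q] degree_low [of P d] degree_low [of Q d]
    by auto
next
  case False
  then show ?thesis using assms by (auto simp: low_def poly_eq_iff)
qed

text \<open>Division with remainder by x - a, for a in S: the quotient has smaller degree and is
  again rational at the other points of S.\<close>

lemma rational_coeffs:
  fixes P :: "real poly"
  assumes "finite S" "card S > degree P" "S \<subseteq> \<rat>" "\<And>x. x \<in> S \<Longrightarrow> poly P x \<in> \<rat>"
  shows "coeff P k \<in> \<rat>"
  using assms
proof (induction "degree P" arbitrary: P S k)
  case 0
  then obtain x where "x \<in> S" by fastforce
  moreover from 0 obtain a where "P = [:a:]" by (metis degree_eq_zeroE)
  ultimately show ?case using 0 by (auto simp: coeff_pCons split: nat.splits)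
next
  case (Suc n)
  then have "S \<noteq> {}" by auto
  then obtain a where a: "a \<in> S" by blast
  define Q where "Q = synthetic_div P a"
  have P: "P = [:-a, 1:] * Q + [:poly P a:]"
    using synthetic_div_correct' [of a P] by (simp add: Q_def)
  have Q: "degree Q = n" unfolding Q_def degree_synthetic_div using Suc.hyps(2) by simp
  have "coeff Q j \<in> \<rat>" for j
  proof (rule Suc.hyps(1) [of Q "S - {a}"])
    show "n = degree Q" using Q by simp
    show "finite (S - {a})" "S - {a} \<subseteq> \<rat>" using Suc.prems by auto
    show "card (S - {a}) > degree Q" using Suc.prems a Q Suc.hyps(2) by simp
    fix x assume x: "x \<in> S - {a}"
    have "poly P x = poly ([:-a, 1:] * Q + [:poly P a:]) x" using P by (rule arg_cong)
    then have "poly P x = (x - a) * poly Q x + poly P a" by (simp add: left_diff_distrib)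
    moreover have "x - a \<noteq> 0" using x by auto
    ultimately have "poly Q x = (poly P x - poly P a) / (x - a)" by (simp add: left_diff_distrib [symmetric])
    then show "poly Q x \<in> \<rat>" using x a Suc.prems by (auto intro!: Rats_divide Rats_diff)
  qed
  moreover have "coeff P k = coeff (pCons 0 Q) k - a * coeff Q k + coeff [:poly P a:] k"
    by (subst P) simp
  ultimately show ?case using a Suc.prems
    by (auto simp: coeff_pCons split: nat.splits intro!: Rats_add Rats_diff Rats_mult)
qed

text \<open>More than d integral values would make the coefficient \<alpha> of index d rational.
  Finite subsets are bounded first; finiteness of the whole set follows from this uniform
  bound.\<close>

lemma integral_points:
  assumes "P \<in> lifts d \<alpha>" "\<alpha> \<notin> \<rat>"
  shows "finite {n::int. poly P (of_int n) \<in> \<int>}" "card {n::int. poly P (of_int n) \<in> \<int>} \<le> d"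
proof -
  have *: "card S \<le> d" if S: "finite S" "S \<subseteq> {n::int. poly P (of_int n) \<in> \<int>}" for S
  proof (rule ccontr)
    assume "\<not> card S \<le> d"
    then have "card (real_of_int ` S) > degree P"
      using degree_lifts [OF assms(1)] by (subst card_image) (auto intro: inj_onI)
    then have "coeff P d \<in> \<rat>" 
      using S by (intro rational_coeffs [of "real_of_int ` S"]) (auto, use Ints_subset_Rats in blast)
    then show False using assms by (auto simp: lifts_def)
  qed
  then show fin: "finite {n::int. poly P (of_int n) \<in> \<int>}"
    by (metis (no_types, lifting) infinite_arbitrarily_large not_less_eq_eq order_refl)
  show "card {n::int. poly P (of_int n) \<in> \<int>} \<le> d" using * [OF fin] by simp
qed

text \<open>Sup distance below \<epsilon> between points of the torus, written for lifts. Lifts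
  share their coefficients from d on, so those below d are compared, after an integral
  correction.\<close>

definition near :: "nat \<Rightarrow> real \<Rightarrow> real poly \<Rightarrow> real poly \<Rightarrow> bool"
  where "near d \<epsilon> A B \<longleftrightarrow> (\<exists>u\<in>integral_polys d. \<forall>k<d. \<bar>coeff (A - B - u) k\<bar> < \<epsilon>)"

lemma near_all_imp_integral:
  assumes "A - B \<in> low d" "\<And>\<epsilon>. \<epsilon> > 0 \<Longrightarrow> near d \<epsilon> A B"
  shows "A - B \<in> integral_polys d"
proof -
  have "coeff (A - B) k \<in> \<int>" for k
  proof (cases "k < d")
    case True
    let ?x = "coeff (A - B) k"
    have "\<exists>n::int. \<bar>?x - of_int n\<bar> < \<epsilon>" if "\<epsilon> > 0" for \<epsilon>
    proof -
      obtain u where "u \<in> integral_polys d" "\<bar>coeff (A - B - u) k\<bar> < \<epsilon>"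
        using assms(2) [OF \<open>\<epsilon> > 0\<close>] True unfolding near_def by blast
      moreover then obtain n :: int where "coeff u k = of_int n" by (auto simp: integral_polys_def Ints_def)
      ultimately show ?thesis by (intro exI [of _ n]) auto
    qed
    then have "?x \<in> closure \<int>" unfolding closure_approachable dist_real_def
      by (metis Ints_of_int abs_minus_commute)
    then show ?thesis by (simp add: closed_Ints closure_closed)
  next
    case False then show ?thesis using assms(1) by (auto simp: low_def)
  qed
  then show ?thesis using assms(1) by (auto simp: integral_polys_def)
qed

lemma near_mono: "near d \<epsilon> A B \<Longrightarrow> \<epsilon> \<le> \<delta> \<Longrightarrow> near d \<delta> A B"
  unfolding near_def by (meson order_less_le_trans)

lemma near_cong:
  assumes "A - A' \<in> integral_polys d" "B - B' \<in> integral_polys d"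
  shows "near d \<epsilon> A B \<longleftrightarrow> near d \<epsilon> A' B'"
proof -
  have "near d \<epsilon> A' B'" if *: "A - A' \<in> integral_polys d" "B - B' \<in> integral_polys d" "near d \<epsilon> A B"
    for A B A' B'
  proof -
    obtain u where "u \<in> integral_polys d" "\<forall>k<d. \<bar>coeff (A - B - u) k\<bar> < \<epsilon>"
      using * unfolding near_def by blast
    moreover have "A' - B' - (u - (A - A') + (B - B')) = A - B - u" by simp
    moreover have "u - (A - A') + (B - B') \<in> integral_polys d"
      using *(1,2) \<open>u \<in> integral_polys d\<close> integral_polys_add integral_polys_diff by blast
    ultimately show ?thesis unfolding near_def by metis
  qed
  then show ?thesis using assms by (metis integral_polys_minus_iff)
qed

lemma near_triangle:
  assumes "near d \<epsilon> A B" "near d \<delta> B C" shows "near d (\<epsilon> + \<delta>) A C"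
proof -
  obtain u v where "u \<in> integral_polys d" "\<forall>k<d. \<bar>coeff (A - B - u) k\<bar> < \<epsilon>"
     and "v \<in> integral_polys d" "\<forall>k<d. \<bar>coeff (B - C - v) k\<bar> < \<delta>"
    using assms unfolding near_def by blast
  moreover have "\<bar>coeff (A - C - (u + v)) k\<bar> < \<epsilon> + \<delta>"
    if "\<bar>coeff (A - B - u) k\<bar> < \<epsilon>" "\<bar>coeff (B - C - v) k\<bar> < \<delta>" for k
    using that by simp
  ultimately show ?thesis unfolding near_def
    by (intro bexI [of _ "u + v"] allI impI) (simp_all del: coeff_diff coeff_add)
qed

lemma near_sym: assumes "near d \<epsilon> A B" shows "near d \<epsilon> B A"
proof -
  obtain u where "u \<in> integral_polys d" "\<forall>k<d. \<bar>coeff (A - B - u) k\<bar> < \<epsilon>"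
    using assms unfolding near_def by blast
  moreover have "B - A - - u = - (A - B - u)" by simp
  then have "\<bar>coeff (B - A - - u) k\<bar> = \<bar>coeff (A - B - u) k\<bar>" for k
    by (metis abs_minus_cancel coeff_minus)
  ultimately show ?thesis unfolding near_def by (intro bexI [of _ "-u"] allI impI) (simp_all del: coeff_diff coeff_minus)
qed

section \<open>Minimality\<close>

lemma tendsto_fun_iff:
  fixes f :: "'c \<Rightarrow> 'a \<Rightarrow> 'b::topological_space"
  shows "(f \<longlongrightarrow> l) F \<longleftrightarrow> (\<forall>i. ((\<lambda>n. f n i) \<longlongrightarrow> l i) F)"
  using limitin_componentwise [of "\<lambda>_. euclidean" UNIV f l F]
  by (simp add: euclidean_product_topology)

text \<open>Closeness in the factor formed by the coordinates from k on. Translation maps these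
  coordinates among themselves, so T is a tower of circle extensions indexed by k, and minimality is
  lifted along this tower.\<close>

definition near_from :: "nat \<Rightarrow> nat \<Rightarrow> real \<Rightarrow> real poly \<Rightarrow> real poly \<Rightarrow> bool"
  where "near_from d k \<epsilon> A B \<longleftrightarrow> (\<forall>j. k \<le> j \<and> j < d \<longrightarrow> (\<exists>z::int. \<bar>coeff (A - B) j - of_int z\<bar> < \<epsilon>))"

lemma near_from_0: "near_from d 0 \<epsilon> A B \<longleftrightarrow> near d \<epsilon> A B"
proof
  assume "near_from d 0 \<epsilon> A B"
  then obtain z :: "nat \<Rightarrow> int" where z: "\<And>j. j < d \<Longrightarrow> \<bar>coeff (A - B) j - of_int (z j)\<bar> < \<epsilon>"
    unfolding near_from_def by (metis zero_le)
  show "near d \<epsilon> A B" unfolding near_def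
    by (rule bexI [of _ "low_of d (\<lambda>j. of_int (z j))"]) (use z in \<open>auto simp: integral_polys_def\<close>)
next
  assume "near d \<epsilon> A B"
  then obtain u where u: "u \<in> integral_polys d" "\<forall>k<d. \<bar>coeff (A - B - u) k\<bar> < \<epsilon>"
    unfolding near_def by blast
  have "\<exists>z::int. \<bar>coeff (A - B) j - of_int z\<bar> < \<epsilon>" if "j < d" for j
  proof -
    obtain z :: int where "coeff u j = of_int z"
      using u(1) unfolding integral_polys_def Ints_def by blast
    then show ?thesis using u(2) that by (intro exI [of _ z]) auto
  qed
  then show "near_from d 0 \<epsilon> A B" by (auto simp: near_from_def)
qed

text \<open>Coefficient j of a translate involves only coefficients of index at least j, so
  smallness from k on is enough. The constant M in the proof exceeds every row sum
  \<open>S j\<close> of the triangular matrix.\<close>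

lemma translate_small:
  fixes \<epsilon> :: real
  assumes "\<epsilon> > 0"
  obtains \<eta> where "\<eta> > 0" "\<And>e k j. e \<in> low d \<Longrightarrow> (\<And>j. k \<le> j \<Longrightarrow> j < d \<Longrightarrow> \<bar>coeff e j\<bar> < \<eta>) \<Longrightarrow> k \<le> j \<Longrightarrow> j < d \<Longrightarrow>
    \<bar>coeff (translate s e) j\<bar> < \<epsilon>"
proof -
  define S where "S j = (\<Sum>l=j..d. real (l choose j) * \<bar>of_int s\<bar> ^ (l - j))" for j :: nat
  define M where "M = (\<Sum>j\<le>d. S j) + 1"
  have S0: "S j \<ge> 0" for j unfolding S_def by (intro sum_nonneg) auto
  have M0: "M > 0" unfolding M_def using sum_nonneg [of "{..d}" S] S0 by force
  define \<eta> where "\<eta> = \<epsilon> / M"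
  have "\<bar>coeff (translate s e) j\<bar> < \<epsilon>"
    if e: "e \<in> low d" "\<And>j. k \<le> j \<Longrightarrow> j < d \<Longrightarrow> \<bar>coeff e j\<bar> < \<eta>" and j: "k \<le> j" "j < d" for e k j
  proof -
    have "\<bar>coeff e l\<bar> \<le> \<eta>" if "j \<le> l" for l
    proof (cases "l < d")
      case True then show ?thesis using e(2) [of l] j that by auto
    next
      case False then show ?thesis using e(1) assms M0 by (auto simp: low_def \<eta>_def)
    qed
    then have "\<bar>coeff (translate s e) j\<bar> \<le> (\<Sum>l=j..d. real (l choose j) * \<bar>of_int s\<bar> ^ (l - j) * \<eta>)"
      using e(1) by (subst coeff_translate [of d])
        (auto simp: low_def abs_mult power_abs intro!: order_trans [OF sum_abs] sum_mono mult_left_mono)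
    also have "\<dots> = S j * \<eta>" by (simp add: S_def sum_distrib_right)
    also have "\<dots> < M * \<eta>"
    proof -
      have "S j \<le> (\<Sum>j\<le>d. S j)" using S0 j by (intro member_le_sum) auto
      then have "S j < M" by (simp add: M_def)
      then show ?thesis using assms M0 by (intro mult_strict_right_mono) (auto simp: \<eta>_def)
    qed
    also have "\<dots> = \<epsilon>" using M0 by (simp add: \<eta>_def)
    finally show ?thesis .
  qed
  then show ?thesis using assms M0 by (intro that [of \<eta>]) (auto simp: \<eta>_def)
qed

lemma near_translate:
  fixes \<epsilon> :: real
  assumes "\<epsilon> > 0"
  obtains \<eta> where "\<eta> > 0" "\<And>A B. A - B \<in> low d \<Longrightarrow> near d \<eta> A B \<Longrightarrow> near d \<epsilon> (translate s A) (translate s B)"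
proof -
  obtain \<eta> where \<eta>: "\<eta> > 0" "\<And>e k j. e \<in> low d \<Longrightarrow> (\<And>j. k \<le> j \<Longrightarrow> j < d \<Longrightarrow> \<bar>coeff e j\<bar> < \<eta>) \<Longrightarrow> k \<le> j \<Longrightarrow> j < d \<Longrightarrow>
    \<bar>coeff (translate s e) j\<bar> < \<epsilon>" using translate_small [OF assms] by metis
  have "near d \<epsilon> (translate s A) (translate s B)" if AB: "A - B \<in> low d" "near d \<eta> A B" for A B
  proof -
    obtain u where u: "u \<in> integral_polys d" "\<forall>k<d. \<bar>coeff (A - B - u) k\<bar> < \<eta>"
      using AB(2) unfolding near_def by blast
    have "\<bar>coeff (translate s (A - B - u)) j\<bar> < \<epsilon>" if "j < d" for j
    proof (rule \<eta>(2) [of _ 0])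
      show "A - B - u \<in> low d" using u(1) \<open>A - B \<in> low d\<close> integral_polys_low by simp
      show "\<bar>coeff (A - B - u) j\<bar> < \<eta>" if "j < d" for j using u(2) that by blast
    qed (use that in auto)
    then show ?thesis unfolding near_def using u(1)
      by (intro bexI [of _ "translate s u"]) (auto simp: translate_diff)
  qed
  then show ?thesis using \<eta>(1) that by blast
qed

lemma irrational_rotation_dense:
  fixes \<theta> c \<epsilon> :: real
  assumes "\<theta> \<notin> \<rat>" "\<epsilon> > 0"
  shows "\<exists>n\<ge>n0::nat. \<exists>z::int. \<bar>real n * \<theta> - c - of_int z\<bar> < \<epsilon>"
proof -
  \<comment> \<open>The first n0 steps are absorbed in the target, so that the time n0 + k obtained
    below is at least n0.\<close>
  define b where "b = c - real n0 * \<theta>"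
  obtain k where k: "k > 0" "\<bar>frac (real k * \<theta>) - frac b\<bar> < \<epsilon>"
    using Kronecker_approx_1_explicit [OF assms(1) frac_ge_0 less_imp_le [OF frac_lt_1] assms(2)] by blast
  have "real (n0 + k) * \<theta> - c - of_int (\<lfloor>real k * \<theta>\<rfloor> - \<lfloor>b\<rfloor>) = frac (real k * \<theta>) - frac b"
    by (simp add: frac_def b_def algebra_simps)
  then show ?thesis using k by (intro exI [of _ "n0 + k"]) (metis le_add1)
qed

text \<open>Near a given point there are points that a large power of the map carries near a given target: a
  change of the coefficient of index \<open>l\<close> by at most \<open>1/n\<close> moves the one of index \<open>l - 1\<close> after
  \<open>n\<close> steps around the whole circle.\<close>

lemma transitive:
  assumes "d \<ge> 1" "\<alpha> \<notin> \<rat>" "A \<in> lifts d \<alpha>" "B \<in> lifts d \<alpha>" "\<epsilon> > 0"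
  shows "\<exists>n\<ge>n0. \<exists>P\<in>lifts d \<alpha>. (\<forall>k<d. \<bar>coeff (P - A) k\<bar> < \<epsilon>) \<and> near d \<epsilon> (translate (int n) P) B"
proof -
  define c where "c = coeff B (d - 1) - coeff A (d - 1)"
  have irr: "real d * \<alpha> \<notin> \<rat>"
  proof
    assume "real d * \<alpha> \<in> \<rat>"
    then have "real d * \<alpha> / real d \<in> \<rat>" by (intro Rats_divide) auto
    then show False using assms by simp
  qed
  obtain n z0 where n: "n \<ge> max (max n0 1) (nat \<lceil>4 / \<epsilon>\<rceil>)" and z0: "\<bar>real n * (real d * \<alpha>) - c - of_int (z0::int)\<bar> < \<epsilon> / 2"
    using irrational_rotation_dense [OF irr, of "\<epsilon> / 2"] assms(5) by (metis half_gt_zero)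
  have n1: "n \<ge> n0" "n \<ge> 1" "4 / \<epsilon> \<le> real n" using n by (auto simp: nat_ceiling_le_eq)
  then have "1 / real n < \<epsilon> / 2" using assms(5) by (simp add: field_simps)
  define cl where "cl k \<delta> P \<longleftrightarrow> (\<exists>z::int. \<bar>coeff (translate (int n) P - B) k - of_int z\<bar> < \<delta>)" for k \<delta> P
  \<comment> \<open>Downward induction on l: the coefficients of index at least l have been
    adjusted, and after n steps the coordinates from l - 1 on are near their targets. Coordinate l -
    1 has error below \<epsilon>/2; the higher ones acquired a further 1/n when their own
    coefficient was changed after they had arrived.\<close>
  have "\<exists>P\<in>lifts d \<alpha>. (\<forall>k<l. coeff P k = coeff A k) \<and> (\<forall>k. l \<le> k \<and> k < d \<longrightarrow> \<bar>coeff (P - A) k\<bar> \<le> 1 / n) \<and>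
      (\<forall>k. l \<le> k \<and> k < d \<longrightarrow> cl k (\<epsilon> / 2 + 1 / n) P) \<and> cl (l - 1) (\<epsilon> / 2) P" if "1 \<le> l" "l \<le> d" for l
    using that(2,1)
  proof (induction rule: inc_induct)
    case base
    have ds: "{d-1..d} = {d-1, d}" using assms(1) by auto
    have dc: "d choose (d - 1) = d" using binomial_symmetric [of "d - 1" d] assms(1) by simp
    have "coeff (translate (int n) A) (d - 1) = (\<Sum>j\<in>{d-1, d}. real (j choose (d-1)) * of_int (int n) ^ (j - (d-1)) * coeff A j)"
      using assms(3) unfolding ds [symmetric] by (intro coeff_translate) (auto simp: lifts_def)
    also have "\<dots> = coeff A (d - 1) + real d * real n * \<alpha>"
      using assms(1,3) dc by (auto simp: lifts_def)
    finally have "coeff (translate (int n) A - B) (d - 1) - of_int z0 = real n * (real d * \<alpha>) - c - of_int z0"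
      by (simp add: c_def algebra_simps)
    then show ?case using assms(3) z0 unfolding cl_def
      by (intro bexI [of _ A] conjI exI [of _ z0]) auto
  next
    case (step l)
    then have l: "1 \<le> l" "l < d" by auto
    obtain P where P: "P \<in> lifts d \<alpha>" "\<forall>k<Suc l. coeff P k = coeff A k" 
      "\<forall>k. Suc l \<le> k \<and> k < d \<longrightarrow> \<bar>coeff (P - A) k\<bar> \<le> 1 / n" "\<forall>k. Suc l \<le> k \<and> k < d \<longrightarrow> cl k (\<epsilon> / 2 + 1 / n) P"
      "cl l (\<epsilon> / 2) P" using step.IH l by auto
    define b where "b = coeff B (l - 1) - coeff (translate (int n) P) (l - 1)"
    \<comment> \<open>Raising coefficient l by s raises coordinate l - 1 after n steps by l * n * s
      = frac b, which leaves an integer as the distance to the target. Coordinates above l do not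
      move.\<close>
    define s where "s = frac b / (real l * real n)"
    have ln: "real l * real n \<ge> real n" "real n > 0" using l n1 by auto
    have s: "0 \<le> s" "s \<le> 1 / real n"
    proof -
      show "0 \<le> s" by (simp add: s_def)
      have "s \<le> 1 / (real l * real n)" unfolding s_def using less_imp_le [OF frac_lt_1, of b] by (intro divide_right_mono) auto
      also have "\<dots> \<le> 1 / real n" using ln by (intro divide_left_mono) auto
      finally show "s \<le> 1 / real n" .
    qed
    define P' where "P' = P + monom s l"
    have tr: "coeff (translate (int n) P') k = coeff (translate (int n) P) k +
        (if k \<le> l then real (l choose k) * real n ^ (l - k) * s else 0)" for k
      by (simp add: P'_def translate_add coeff_translate_monom)
    have "P' \<in> lifts d \<alpha>" using P(1) l by (auto simp: P'_def lifts_def)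
    moreover have "\<forall>k<l. coeff P' k = coeff A k" using P(2) by (auto simp: P'_def)
    moreover have "\<bar>coeff (P' - A) k\<bar> \<le> 1 / n" if "l \<le> k \<and> k < d" for k
      using P(2,3) s that by (cases "k = l") (auto simp: P'_def)
    moreover have "cl k (\<epsilon> / 2 + 1 / n) P'" if "l \<le> k \<and> k < d" for k
    proof (cases "k = l")
      case True
      then obtain z :: int where "\<bar>coeff (translate (int n) P - B) k - of_int z\<bar> < \<epsilon> / 2"
        using P(5) unfolding cl_def by blast
      moreover have "coeff (translate (int n) P' - B) k - of_int z = (coeff (translate (int n) P - B) k - of_int z) + s"
        using True by (simp add: tr)
      ultimately have "\<bar>coeff (translate (int n) P' - B) k - of_int z\<bar> < \<epsilon> / 2 + 1 / n" using s by linarith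
      then show ?thesis unfolding cl_def by blast
    next
      case False
      then show ?thesis using P(4) that by (auto simp: cl_def tr)
    qed
    moreover have "cl (l - 1) (\<epsilon> / 2) P'"
    proof -
      have "l choose (l - 1) = l" using binomial_symmetric [of "l - 1" l] l by simp
      then have "coeff (translate (int n) P' - B) (l - 1) = - b + real l * real n * s"
        using l by (simp add: tr b_def)
      also have "\<dots> = - of_int \<lfloor>b\<rfloor>" using ln by (simp add: s_def frac_def)
      finally show ?thesis unfolding cl_def using assms(5) by (intro exI [of _ "- \<lfloor>b\<rfloor>"]) auto
    qed
    ultimately show ?case by blast
  qed
  from this [of 1] obtain P where P: "P \<in> lifts d \<alpha>" "\<forall>k<1. coeff P k = coeff A k" 
      "\<forall>k. 1 \<le> k \<and> k < d \<longrightarrow> \<bar>coeff (P - A) k\<bar> \<le> 1 / n" "\<forall>k. 1 \<le> k \<and> k < d \<longrightarrow> cl k (\<epsilon> / 2 + 1 / n) P"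
      "cl 0 (\<epsilon> / 2) P" using assms(1) by auto
  have "\<bar>coeff (P - A) k\<bar> < \<epsilon>" if "k < d" for k
  proof (cases "k = 0")
    case False
    then have "\<bar>coeff (P - A) k\<bar> \<le> 1 / n" using P(3) that by (simp add: Suc_le_eq)
    then show ?thesis using \<open>1 / real n < \<epsilon> / 2\<close> assms(5) by linarith
  qed (use P(2) assms(5) in simp)
  moreover have "cl k \<epsilon> P" if k: "k < d" for k
  proof (cases "k = 0")
    case True
    then obtain z :: int where "\<bar>coeff (translate (int n) P - B) k - of_int z\<bar> < \<epsilon> / 2"
      using P(5) unfolding cl_def by blast
    then have "\<bar>coeff (translate (int n) P - B) k - of_int z\<bar> < \<epsilon>" using assms(5) by linarith
    then show ?thesis unfolding cl_def by blast
  next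
    case False 
    then obtain z :: int where "\<bar>coeff (translate (int n) P - B) k - of_int z\<bar> < \<epsilon> / 2 + 1 / n" 
      using P(4) k unfolding cl_def by (metis One_nat_def Suc_leI neq0_conv)
    then have "\<bar>coeff (translate (int n) P - B) k - of_int z\<bar> < \<epsilon>" using \<open>1 / real n < \<epsilon> / 2\<close> by linarith
    then show ?thesis unfolding cl_def by blast
  qed
  ultimately show ?thesis using P(1) n1(1) unfolding near_from_0 [symmetric] near_from_def cl_def by blast
qed

lemma continuous_coeff_translate:
  "continuous_on UNIV (\<lambda>x. coeff (translate c (lift_of d \<alpha> x)) k)"
proof -
  have "(\<lambda>x. coeff (translate c (lift_of d \<alpha> x)) k) =
    (\<lambda>x. \<Sum>j=k..d. real (j choose k) * of_int c ^ (j - k) * (if j < d then x j else if j = d then \<alpha> else 0))"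
    by (rule ext, subst coeff_translate [of d]) auto
  moreover have "continuous_on UNIV (\<lambda>x::nat \<Rightarrow> real. if j < d then x j else if j = d then \<alpha> else 0)" for j
    by (cases "j < d") auto
  ultimately show ?thesis by (simp only:) (intro continuous_on_sum continuous_on_mult continuous_on_const)
qed

text \<open>Baire category in the space of all real sequences, whose first d entries are the
  coefficients of a lift. For a rational target q, the points that come within 1/(r + 1) of q at
  some time at least r form an open set, dense by \<open>transitive\<close>; there are countably
  many pairs (q, r).\<close>

lemma dense_orbit_exists:
  assumes "d \<ge> 1" "\<alpha> \<notin> \<rat>"
  shows "\<exists>P\<in>lifts d \<alpha>. \<forall>B\<in>lifts d \<alpha>. \<forall>\<epsilon>>0. \<forall>n0. \<exists>n\<ge>n0. near d \<epsilon> (translate (int n) P) B"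
proof -
  define tgt where "tgt q = lift_of d \<alpha> (\<lambda>k. of_rat (q ! k))" for q :: "rat list"
  define G where "G q r = {x. \<exists>n\<ge>r. near d (1 / real (Suc r)) (translate (int n) (lift_of d \<alpha> x)) (tgt q)}" for q r
  have "open (G q r)" for q r
  proof -
    have "G q r = (\<Union>n\<in>{r..}. \<Inter>k\<in>{..<d}. \<Union>z::int. {x. \<bar>coeff (translate (int n) (lift_of d \<alpha> x)) k - coeff (tgt q) k - of_int z\<bar> < 1 / real (Suc r)})"
      unfolding G_def near_from_0 [symmetric] near_from_def by auto
    moreover have "open {x. \<bar>coeff (translate (int n) (lift_of d \<alpha> x)) k - coeff (tgt q) k - of_int z\<bar> < 1 / real (Suc r)}" for n k z
      by (intro open_Collect_less continuous_intros continuous_coeff_translate)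
    ultimately show ?thesis by (auto intro!: open_UN open_INT)
  qed
  moreover have "closure (G q r) = UNIV" for q r
  proof -
    have "a \<in> closure (G q r)" for a
    proof -
      \<comment> \<open>The first bound gives convergence to a, the second membership in
        \<open>G q r\<close>.\<close>
      define \<delta> where "\<delta> i = min (1 / real (Suc i)) (1 / real (Suc r))" for i
      have "\<exists>n\<ge>r. \<exists>P\<in>lifts d \<alpha>. (\<forall>k<d. \<bar>coeff (P - lift_of d \<alpha> a) k\<bar> < \<delta> i) \<and> near d (\<delta> i) (translate (int n) P) (tgt q)" for i
        by (rule transitive [OF assms]) (auto simp: tgt_def \<delta>_def)
      then obtain n P where P: "\<And>i. n i \<ge> r" "\<And>i. P i \<in> lifts d \<alpha>" "\<And>i k. k < d \<Longrightarrow> \<bar>coeff (P i - lift_of d \<alpha> a) k\<bar> < \<delta> i"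
         "\<And>i. near d (\<delta> i) (translate (int (n i)) (P i)) (tgt q)"
        by metis
      have \<delta>: "\<delta> i \<le> 1 / real (Suc i)" "\<delta> i \<le> 1 / real (Suc r)" for i by (auto simp: \<delta>_def)
      \<comment> \<open>Entries from d on are copied from a, so that convergence holds in the whole
        sequence space.\<close>
      define x where "x i k = (if k < d then coeff (P i) k else a k)" for i k
      have "lift_of d \<alpha> (x i) = lift_of d \<alpha> (coeff (P i))" for i by (rule poly_eqI) (simp add: x_def)
      then have xP: "lift_of d \<alpha> (x i) = P i" for i using P(2) by (simp add: lift_of_coeff)
      have "x i \<in> G q r" for i unfolding G_def mem_Collect_eq xP
        using P(1,4) \<delta>(2) near_mono by blast
      moreover have "x \<longlonglongrightarrow> a"
        unfolding tendsto_fun_iff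
      proof
        fix k
        show "(\<lambda>n. x n k) \<longlonglongrightarrow> a k"
        proof (cases "k < d")
          case True
          have "\<bar>x i k - a k\<bar> \<le> inverse (real (Suc i))" for i
            using P(3) [OF True, of i] \<delta>(1) [of i] True by (simp add: x_def inverse_eq_divide)
          then have "(\<lambda>n. \<bar>x n k - a k\<bar>) \<longlonglongrightarrow> 0"
            by (intro tendsto_sandwich [OF _ _ tendsto_const LIMSEQ_inverse_real_of_nat]) auto
          then show ?thesis by (simp add: LIM_zero_iff tendsto_rabs_zero_iff)
        qed (simp add: x_def)
      qed
      ultimately show ?thesis unfolding closure_sequential by blast
    qed
    then show ?thesis by auto
  qed
  ultimately have "closure (\<Inter>(range (\<lambda>(q, r). G q r))) = UNIV"
    using Baire_category [of "euclidean :: (nat \<Rightarrow> real) topology" "range (\<lambda>(q, r). G q r)"]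
      completely_metrizable_space_euclidean [where 'a = "nat \<Rightarrow> real"]
    by (fastforce simp: split_beta)
  then have "\<Inter>(range (\<lambda>(q, r). G q r)) \<noteq> {}" by force
  then obtain x where x: "\<And>q r. x \<in> G q r" by auto
  have "\<exists>n\<ge>n0. near d \<epsilon> (translate (int n) (lift_of d \<alpha> x)) B" if "B \<in> lifts d \<alpha>" "\<epsilon> > 0" for B \<epsilon> n0
  proof -
    define r where "r = max n0 (nat \<lceil>2 / \<epsilon>\<rceil>)"
    have "2 / \<epsilon> < real (Suc r)" by (auto simp: r_def) linarith
    then have r: "1 / real (Suc r) < \<epsilon> / 2" "n0 \<le> r" using that(2) by (auto simp: field_simps r_def)
    have "\<exists>q. \<bar>of_rat q - coeff B k\<bar> < \<epsilon> / 2" for k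
    proof -
      obtain x where "x \<in> \<rat>" "coeff B k - \<epsilon> / 2 < x" "x < coeff B k + \<epsilon> / 2"
        using Rats_dense_in_real [of "coeff B k - \<epsilon> / 2" "coeff B k + \<epsilon> / 2"] \<open>0 < \<epsilon>\<close> by auto
      then show ?thesis by (metis Rats_cases abs_less_iff diff_less_eq less_diff_eq minus_diff_eq add.commute)
    qed
    then obtain f where f: "\<And>k. \<bar>of_rat (f k) - coeff B k\<bar> < \<epsilon> / 2" by metis
    define q where "q = map f [0..<d]"
    have "near_from d 0 (\<epsilon> / 2) (tgt q) B" unfolding near_from_def
      by (intro allI impI exI [of _ 0]) (use f in \<open>auto simp: tgt_def q_def\<close>)
    moreover obtain n where "n \<ge> r" "near d (1 / real (Suc r)) (translate (int n) (lift_of d \<alpha> x)) (tgt q)"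
      using x [of q r] by (auto simp: G_def)
    moreover then have "near d (\<epsilon> / 2) (translate (int n) (lift_of d \<alpha> x)) (tgt q)"
      using r near_mono less_imp_le by blast
    ultimately show ?thesis using near_triangle [of d "\<epsilon> / 2" _ "tgt q" "\<epsilon> / 2" B] r(2)
      by (auto simp: near_from_0 intro!: exI [of _ n])
  qed
  then show ?thesis by (intro bexI [of _ "lift_of d \<alpha> x"]) auto
qed

text \<open>Minimality follows from the existence of one dense orbit by adding one coordinate at a time, since the orbit
  closures of the extension by a circle are translates of one another.\<close>

lemma minimal_aux:
  assumes "d \<ge> 1" "\<alpha> \<notin> \<rat>" "k \<le> d"
  shows "\<forall>P\<in>lifts d \<alpha>. \<forall>B\<in>lifts d \<alpha>. \<forall>\<epsilon>>0. \<forall>n0. \<exists>n\<ge>n0. near_from d k \<epsilon> (translate (int n) P) B"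
  using assms(3)
proof (induction rule: inc_induct)
  case base
  show ?case by (auto simp: near_from_def)
next
  case (step k)
  obtain z where z: "z \<in> lifts d \<alpha>" "\<And>B \<epsilon> n0. B \<in> lifts d \<alpha> \<Longrightarrow> \<epsilon> > 0 \<Longrightarrow> \<exists>n\<ge>n0. near d \<epsilon> (translate (int n) z) B"
    using dense_orbit_exists [OF assms(1,2)] by blast
  show ?case
  proof (intro ballI allI impI)
    fix P B \<epsilon> n0
    assume P: "P \<in> lifts d \<alpha>" and B: "B \<in> lifts d \<alpha>" and "(0::real) < \<epsilon>"
    have "\<exists>n\<ge>i. near_from d (Suc k) (1 / real (Suc i)) (translate (int n) P) z" for i
      using step.IH P z(1) by simp
    then obtain n where n: "\<And>i. n i \<ge> i" "\<And>i. near_from d (Suc k) (1 / real (Suc i)) (translate (int (n i)) P) z"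
      by metis
    define t where "t i = frac (coeff (translate (int (n i)) P - z) k)" for i
    have "t i \<in> {0..1}" for i by (auto simp: t_def less_imp_le [OF frac_lt_1])
    then obtain t0 r where r: "strict_mono r" "(t \<circ> r) \<longlonglongrightarrow> t0"
      using compact_Icc [of "0::real" 1] unfolding compact_def by metis
    \<comment> \<open>In the factor from k on, z' is a limit point of the orbit of P, and it is z
      rotated in the circle of coordinate k. This rotation commutes with translation in that factor,
      so the dense orbit of z is aimed at B rotated back.\<close>
    define z' where "z' = z + monom t0 k"
    obtain s where s: "near d (\<epsilon> / 2) (translate (int s) z) (B - monom t0 k)"
      using z(2) [of "B - monom t0 k" "\<epsilon> / 2" 0] B \<open>0 < \<epsilon>\<close> step.hyps by (auto simp: lifts_def)
    obtain \<eta> where \<eta>: "\<eta> > 0" "\<And>e k j. e \<in> low d \<Longrightarrow> (\<And>j. k \<le> j \<Longrightarrow> j < d \<Longrightarrow> \<bar>coeff e j\<bar> < \<eta>) \<Longrightarrow> k \<le> j \<Longrightarrow> j < d \<Longrightarrow>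
      \<bar>coeff (translate (int s) e) j\<bar> < \<epsilon> / 2" using translate_small [of "\<epsilon> / 2"] \<open>0 < \<epsilon>\<close> by (metis half_gt_zero)
    have "\<forall>\<^sub>F i in sequentially. \<bar>(t \<circ> r) i - t0\<bar> < \<eta>"
      using r(2) \<eta>(1) by (simp add: tendsto_iff dist_real_def)
    moreover have "\<forall>\<^sub>F i in sequentially. 1 / real (Suc i) < \<eta>"
      using order_tendstoD(2) [OF LIMSEQ_inverse_real_of_nat \<eta>(1)] by (simp add: inverse_eq_divide)
    moreover have "\<forall>\<^sub>F i in sequentially. n0 \<le> i" by (rule eventually_ge_at_top)
    ultimately have "\<forall>\<^sub>F i in sequentially. \<bar>(t \<circ> r) i - t0\<bar> < \<eta> \<and> 1 / real (Suc i) < \<eta> \<and> n0 \<le> i"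
      by (intro eventually_conj)
    then obtain i where i: "\<bar>t (r i) - t0\<bar> < \<eta>" "1 / real (Suc i) < \<eta>" "n0 \<le> i"
      unfolding eventually_sequentially by (metis comp_apply order_refl)
    define N where "N = n (r i)"
    have ri: "r i \<ge> i" using r(1) by (simp add: seq_suble)
    then have N: "n0 \<le> N" unfolding N_def using n(1) [of "r i"] i(3) by linarith
    have "\<exists>y::int. \<bar>coeff (translate (int N) P - z') j - of_int y\<bar> < \<eta>" if j: "k \<le> j \<and> j < d" for j
    proof (cases "j = k")
      case True
      have "coeff (translate (int N) P - z') k - of_int \<lfloor>coeff (translate (int N) P - z) k\<rfloor> = t (r i) - t0"
        by (simp add: z'_def t_def N_def frac_def)
      then show ?thesis using i(1) True by metis
    next
      case False
      then obtain y :: int where "\<bar>coeff (translate (int N) P - z) j - of_int y\<bar> < 1 / real (Suc (r i))"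
        using n(2) [of "r i"] j unfolding near_from_def N_def
        by (metis Suc_leI le_neq_implies_less)
      moreover have "1 / real (Suc (r i)) \<le> 1 / real (Suc i)" using ri by (intro divide_left_mono) auto
      ultimately have "\<bar>coeff (translate (int N) P - z') j - of_int y\<bar> < \<eta>"
        using i(2) False by (simp add: z'_def)
      then show ?thesis by blast
    qed
    then obtain y :: "nat \<Rightarrow> int" where y: "\<And>j. k \<le> j \<Longrightarrow> j < d \<Longrightarrow> \<bar>coeff (translate (int N) P - z') j - of_int (y j)\<bar> < \<eta>"
      by metis
    define u where "u = low_of d (\<lambda>j. of_int (y j))"
    have u: "u \<in> integral_polys d" by (auto simp: u_def integral_polys_def)
    define e where "e = translate (int N) P - z' - u"
    have "z' \<in> lifts d \<alpha>" using z(1) step.hyps by (auto simp: z'_def lifts_def)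
    then have e: "e \<in> low d" unfolding e_def
      using P u by (intro low_diff lifts_diff [of _ d \<alpha>] integral_polys_low) auto
    have small: "\<bar>coeff (translate (int s) e) j\<bar> < \<epsilon> / 2" if "k \<le> j" "j < d" for j
      by (rule \<eta>(2) [OF e _ that]) (use y in \<open>auto simp: e_def u_def\<close>)
    obtain v where v: "v \<in> integral_polys d" "\<forall>j<d. \<bar>coeff (translate (int s) z - (B - monom t0 k) - v) j\<bar> < \<epsilon> / 2"
      using s unfolding near_def by blast
    have "\<exists>y::int. \<bar>coeff (translate (int (s + N)) P - B) j - of_int y\<bar> < \<epsilon>" if j: "k \<le> j \<and> j < d" for j
    proof -
      have "coeff (translate (int s) u + v) j \<in> \<int>"
        using u v integral_polys_add integral_polys_translate unfolding integral_polys_def by blast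
      then obtain y :: int where y: "coeff (translate (int s) u + v) j = of_int y" unfolding Ints_def by blast
      have "coeff (translate (int s) (monom t0 k)) j = coeff (monom t0 k) j"
        using j by (auto simp: coeff_translate_monom)
      moreover have "translate (int (s + N)) P = translate (int s) e + translate (int s) z + translate (int s) (monom t0 k) + translate (int s) u"
        by (simp add: e_def z'_def translate_diff translate_add)
      ultimately have "coeff (translate (int (s + N)) P - B) j - of_int y =
         coeff (translate (int s) e) j + coeff (translate (int s) z - (B - monom t0 k) - v) j"
        by (simp flip: y)
      moreover have "\<bar>coeff (translate (int s) z - (B - monom t0 k) - v) j\<bar> < \<epsilon> / 2" using v j by blast
      moreover have "\<bar>coeff (translate (int s) e) j\<bar> < \<epsilon> / 2" using small j by blast
      ultimately show ?thesis by (intro exI [of _ y]) linarith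
    qed
    then show "\<exists>n\<ge>n0. near_from d k \<epsilon> (translate (int n) P) B"
      using N by (intro exI [of _ "s + N"]) (auto simp: near_from_def)
  qed
qed

lemma minimal:
  assumes "d \<ge> 1" "\<alpha> \<notin> \<rat>" "P \<in> lifts d \<alpha>" "B \<in> lifts d \<alpha>" "\<epsilon> > 0"
  shows "\<exists>n\<ge>n0. near d \<epsilon> (translate (int n) P) B"
  using minimal_aux [OF assms(1,2), of 0] assms(3-) by (simp add: near_from_0)

section \<open>Words and their base points\<close>

lemma near_0_coeff: "near d \<epsilon> A B \<Longrightarrow> d \<ge> 1 \<Longrightarrow> \<exists>z::int. \<bar>poly A 0 - poly B 0 - of_int z\<bar> < \<epsilon>"
  unfolding near_from_0 [symmetric] near_from_def by (auto simp: poly_0_coeff_0)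

text \<open>P(n) is the coefficient of index 0 of \<open>translate n P\<close>, so this is
  minimality seen in one coordinate.\<close>

lemma values_dense:
  assumes "d \<ge> 1" "\<alpha> \<notin> \<rat>" "P \<in> lifts d \<alpha>" "\<epsilon> > 0"
  shows "\<exists>n\<ge>n0. \<exists>z::int. \<bar>poly P (real n) - x - of_int z\<bar> < \<epsilon>"
proof -
  define B where "B = lift_of d \<alpha> (\<lambda>_. x)"
  have B0: "poly B 0 = x" using assms(1) by (simp add: B_def poly_0_coeff_0)
  obtain n where n: "n \<ge> n0" "near d \<epsilon> (translate (int n) P) B"
    using minimal [OF assms(1-3) _ assms(4), of B n0] by (auto simp: B_def)
  from near_0_coeff [OF this(2) assms(1)] show ?thesis using n(1) B0 by auto
qed

lemma bounded_poly_const: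
  fixes D :: "real poly"
  assumes "\<And>n::int. n \<ge> i \<Longrightarrow> \<bar>poly D (of_int n)\<bar> \<le> 1"
  shows "\<exists>c. D = [:c:]"
proof (rule ccontr)
  assume "\<not> ?thesis"
  then have deg: "degree D > 0" by (metis degree_eq_zeroE neq0_conv)
  \<comment> \<open>Squaring makes the leading coefficient positive, and the constant -2 makes p
    negative wherever D has absolute value at most 1.\<close>
  define p where "p = [:- 2:] + D * D"
  have dd: "degree [:-2::real:] < degree (D * D)" using deg by (subst degree_mult_eq) auto
  then have "lead_coeff p = lead_coeff (D * D)" unfolding p_def by (rule lead_coeff_add_le)
  also have "\<dots> = lead_coeff D * lead_coeff D" by (rule lead_coeff_mult)
  finally have lc: "lead_coeff p > 0" using deg by (metis degree_0 leading_coeff_0_iff less_irrefl zero_less_mult_iff linorder_neqE_linordered_idom)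
  obtain b where b: "\<forall>x\<ge>b. poly p x \<ge> lead_coeff p" using poly_pinfty_gt_lc [OF lc] by blast
  define n where "n = max i \<lceil>b\<rceil>"
  have "poly p (of_int n) > 0" using b lc by (metis n_def ceiling_le_iff less_le_trans max.cobounded2)
  moreover have "\<bar>poly D (of_int n)\<bar> * \<bar>poly D (of_int n)\<bar> \<le> 1 * 1"
    using assms [of n] by (intro mult_mono) (auto simp: n_def)
  ultimately show False by (simp add: p_def)
qed

text \<open>Interpolation at 0, ..., d - 1. It serves twice: to keep integral corrections constant
  along a subsequence, and at the end to bound the number of translations commuting with T.\<close>

lemma finite_bounded_integer_valued:
  "finite {u \<in> low d. \<forall>j<d. poly u (real j) \<in> \<int> \<and> \<bar>poly u (real j)\<bar> \<le> B}" (is "finite ?F")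
proof -
  let ?f = "\<lambda>u. \<lambda>j\<in>{..<d}. poly u (real j)"
  have inj: "inj_on ?f ?F"
  proof (rule inj_onI)
    fix u v assume u: "u \<in> ?F" and v: "v \<in> ?F" and eq: "?f u = ?f v"
    have "poly u (real j) = poly v (real j)" if "j < d" for j
      using fun_cong [OF eq, of j] that by simp
    then show "u = v" using u v
      by (intro low_eqI [of _ d _ "real ` {..<d}"]) (auto simp: card_image)
  qed
  have sub: "?f ` ?F \<subseteq> (\<Pi>\<^sub>E j\<in>{..<d}. of_int ` {\<lfloor>-B\<rfloor>..\<lceil>B\<rceil>})"
  proof (intro subsetI PiE_I)
    fix f j assume f: "f \<in> ?f ` ?F" and j: "j \<in> {..<d}"
    then obtain u where u: "u \<in> ?F" "f = ?f u" by blast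
    then have "poly u (real j) \<in> \<int>" using j by auto
    then obtain z :: int where z: "poly u (real j) = of_int z" unfolding Ints_def by blast
    have "\<bar>poly u (real j)\<bar> \<le> B" using u(1) j by auto
    then have "z \<in> {\<lfloor>-B\<rfloor>..\<lceil>B\<rceil>}" unfolding z by (auto simp: le_ceiling_iff floor_le_iff)
    then show "f j \<in> of_int ` {\<lfloor>-B\<rfloor>..\<lceil>B\<rceil>}" using u(2) j z by simp
  qed auto
  have "finite (?f ` ?F)" by (rule finite_subset [OF sub]) (intro finite_PiE; simp)
  then show ?thesis using inj by (rule finite_imageD)
qed

lemma tendsto_poly_coeffs:
  assumes "\<And>k. (\<lambda>n. coeff (P n) k) \<longlonglongrightarrow> coeff Q k" "\<And>n. P n \<in> lifts d \<alpha>" "Q \<in> lifts d \<alpha>"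
  shows "(\<lambda>n. poly (P n) x) \<longlonglongrightarrow> poly Q x"
proof -
  have "poly R x = (\<Sum>k\<le>d. coeff R k * x ^ k)" if "R \<in> lifts d \<alpha>" for R
    using that by (intro poly_eq_sum) (auto simp: lifts_def)
  then show ?thesis using assms by (auto intro!: tendsto_intros)
qed

lemma tendsto_coeff_translate:
  assumes "\<And>k. (\<lambda>n. coeff (P n) k) \<longlonglongrightarrow> coeff Q k" "\<And>n. P n \<in> lifts d \<alpha>" "Q \<in> lifts d \<alpha>"
  shows "(\<lambda>n. coeff (translate c (P n)) k) \<longlonglongrightarrow> coeff (translate c Q) k"
proof -
  have "coeff (translate c R) k = (\<Sum>j=k..d. real (j choose k) * of_int c ^ (j - k) * coeff R j)" if "R \<in> lifts d \<alpha>" for R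
    using that by (intro coeff_translate) (auto simp: lifts_def)
  then show ?thesis using assms by (auto intro!: tendsto_intros)
qed

lemma eventually_near:
  assumes "\<And>k. (\<lambda>n. coeff (P n) k) \<longlonglongrightarrow> coeff Q k" "\<epsilon> > 0"
  shows "\<forall>\<^sub>F n in sequentially. near d \<epsilon> (P n) Q"
proof -
  have "\<forall>\<^sub>F n in sequentially. \<forall>k\<in>{..<d}. \<bar>coeff (P n) k - coeff Q k\<bar> < \<epsilon>"
    using assms by (intro eventually_ball_finite) (auto simp: tendsto_iff dist_real_def)
  then show ?thesis
    by eventually_elim (auto simp: near_def intro!: bexI [of _ 0])
qed

text \<open>Closed cells of the torus are closed although the integral correction u depends on n.
  The values of P n at 0, ..., d converge, so the corrections are bounded there and lie in a finite
  set; one of them recurs infinitely often and works in the limit.\<close>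

lemma cell_closed:
  fixes c :: "nat \<Rightarrow> int"
  assumes lim: "\<And>k. (\<lambda>n. coeff (P n) k) \<longlonglongrightarrow> coeff Q k" and P: "\<And>n. P n \<in> lifts d \<alpha>" and Q: "Q \<in> lifts d \<alpha>"
    and cell: "\<And>n. \<exists>u\<in>integral_polys d. \<forall>j\<le>d.
      of_int (c j) \<le> poly (P n + u) (real j) \<and> poly (P n + u) (real j) \<le> of_int (c j) + 1"
  shows "\<exists>u\<in>integral_polys d. \<forall>j\<le>d.
      of_int (c j) \<le> poly (Q + u) (real j) \<and> poly (Q + u) (real j) \<le> of_int (c j) + 1"
proof -
  obtain u where u: "\<And>n. u n \<in> integral_polys d" "\<And>n j. j \<le> d \<Longrightarrow>
      of_int (c j) \<le> poly (P n + u n) (real j) \<and> poly (P n + u n) (real j) \<le> of_int (c j) + 1"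
    using cell by metis
  have lim': "(\<lambda>n. poly (P n) x) \<longlonglongrightarrow> poly Q x" for x by (rule tendsto_poly_coeffs [OF lim P Q])
  have "\<exists>B. \<forall>n. \<bar>poly (P n) x\<bar> \<le> B" for x
    using convergent_imp_Bseq [OF convergentI [OF lim' [of x]]] by (auto simp: Bseq_def)
  then obtain B where B: "\<And>n x. \<bar>poly (P n) x\<bar> \<le> B x" by metis
  define C where "C = (\<Sum>j\<le>d. B (real j) + \<bar>of_int (c j)\<bar> + 1)"
  have "u n \<in> {u \<in> low d. \<forall>j<d. poly u (real j) \<in> \<int> \<and> \<bar>poly u (real j)\<bar> \<le> C}" for n
  proof -
    have "\<bar>poly (u n) (real j)\<bar> \<le> C" if j: "j < d" for j
    proof -
      have "B x \<ge> 0" for x using B [of 0 x] by simp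
      then have "B (real j) + \<bar>of_int (c j)\<bar> + 1 \<le> C" unfolding C_def using j
        by (intro member_le_sum [of j "{..d}" "\<lambda>j. B (real j) + \<bar>of_int (c j)\<bar> + 1"]) auto
      moreover have "of_int (c j) \<le> poly (P n) (real j) + poly (u n) (real j)"
         "poly (P n) (real j) + poly (u n) (real j) \<le> of_int (c j) + 1" using u(2) [of j n] j by auto
      ultimately show ?thesis using B [of n "real j"] by linarith
    qed
    then show ?thesis using poly_integral_polys [OF u(1)] integral_polys_low [OF u(1)] by simp
  qed
  then have "range u \<subseteq> {u \<in> low d. \<forall>j<d. poly u (real j) \<in> \<int> \<and> \<bar>poly u (real j)\<bar> \<le> C}" by blast
  then have "finite (range u)" using finite_bounded_integer_valued finite_subset by blast
  then obtain v where v: "infinite {n. u n = u v}"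
    using pigeonhole_infinite [of UNIV u] by auto
  then have freq: "\<exists>\<^sub>F n in sequentially. u n = u v"
    by (simp add: frequently_cofinite flip: cofinite_eq_sequentially)
  have "of_int (c j) \<le> poly (Q + u v) (real j) \<and> poly (Q + u v) (real j) \<le> of_int (c j) + 1" if j: "j \<le> d" for j
  proof -
    have l: "(\<lambda>n. poly (P n) (real j) + poly (u v) (real j)) \<longlonglongrightarrow> poly Q (real j) + poly (u v) (real j)"
      by (intro tendsto_intros lim')
    have *: "of_int (c j) \<le> poly (P n) (real j) + poly (u v) (real j) \<and> poly (P n) (real j) + poly (u v) (real j) \<le> of_int (c j) + 1"
      if "u n = u v" for n using u(2) [OF j, of n] that by simp
    have "\<not> poly Q (real j) + poly (u v) (real j) < of_int (c j)"
    proof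
      assume "poly Q (real j) + poly (u v) (real j) < of_int (c j)"
      from frequently_eventually_frequently [OF freq order_tendstoD(2) [OF l this]]
      have "\<exists>\<^sub>F n in sequentially. u n = u v \<and> poly (P n) (real j) + poly (u v) (real j) < of_int (c j)" .
      then obtain n where "u n = u v \<and> poly (P n) (real j) + poly (u v) (real j) < of_int (c j)"
        by (rule frequentlyE)
      then show False using * [of n] by linarith
    qed
    moreover have "\<not> poly Q (real j) + poly (u v) (real j) > of_int (c j) + 1"
    proof
      assume "poly Q (real j) + poly (u v) (real j) > of_int (c j) + 1"
      from frequently_eventually_frequently [OF freq order_tendstoD(1) [OF l this]]
      have "\<exists>\<^sub>F n in sequentially. u n = u v \<and> poly (P n) (real j) + poly (u v) (real j) > of_int (c j) + 1" .
      then obtain n where "u n = u v \<and> poly (P n) (real j) + poly (u v) (real j) > of_int (c j) + 1"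
        by (rule frequentlyE)
      then show False using * [of n] by linarith
    qed
    ultimately show ?thesis by simp
  qed
  then show ?thesis using u(1) by blast
qed

section \<open>Compactness of product spaces and finite exceptional sets\<close>

lemma compact_PiE_UNIV:
  fixes S :: "'a \<Rightarrow> 'b::topological_space set"
  assumes "\<And>i. compact (S i)"
  shows "compact (\<Pi>\<^sub>E i\<in>UNIV. S i)"
  using assms compactin_PiE [of "\<lambda>_. euclidean" UNIV S]
  by (simp add: euclidean_product_topology)

lemma compact_convergent_subsequence:
  fixes f :: "nat \<Rightarrow> 'a::first_countable_topology"
  assumes "\<And>n. f n \<in> S" "compact S"
  obtains r l where "strict_mono r" "(f \<circ> r) \<longlonglongrightarrow> l"
  using compact_imp_seq_compact [OF assms(2)] assms(1) unfolding seq_compact_def by metis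

lemma finite_exceptions_bound:
  fixes S :: "int set"
  assumes "finite S"
  obtains i1 where "i1 \<ge> i0" "\<And>n. n \<ge> i1 \<Longrightarrow> n \<notin> S"
proof -
  have "\<forall>n. n \<ge> max i0 (Max (insert i0 S) + 1) \<longrightarrow> n \<notin> S" 
    using Max_ge [of "insert i0 S"] assms by fastforce
  then show ?thesis using that max.cobounded1 by blast
qed

text \<open>The locale retains from a partition only a coding of lifts to \<open>\<real>\<^sup>d\<close>. The cell with index \<open>k\<close> is the one
  containing the projection of the polytope of all \<open>P\<close> with \<open>N k j < P(j) < N k j + 1\<close> for \<open>j \<le> d\<close>.\<close>

locale coded_nilsystem =
  fixes d :: nat and \<alpha> :: real and m :: nat and code :: "real poly \<Rightarrow> nat" and N :: "nat \<Rightarrow> nat \<Rightarrow> int"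
  assumes d_pos: "d \<ge> 1" and irr: "\<alpha> \<notin> \<rat>"
    and code_range: "P \<in> lifts d \<alpha> \<Longrightarrow> code P \<in> {1..m}"
    and code_cong: "P \<in> lifts d \<alpha> \<Longrightarrow> u \<in> integral_polys d \<Longrightarrow> code (P + u) = code P"
    and code_stratum: "P \<in> lifts d \<alpha> \<Longrightarrow> Q \<in> lifts d \<alpha> \<Longrightarrow>
      (\<And>j. j \<le> d \<Longrightarrow> \<lfloor>poly P (real j)\<rfloor> = \<lfloor>poly Q (real j)\<rfloor> \<and> (poly P (real j) \<in> \<int> \<longleftrightarrow> poly Q (real j) \<in> \<int>)) \<Longrightarrow>
      code P = code Q"
    and code_cell: "P \<in> lifts d \<alpha> \<Longrightarrow> \<exists>u\<in>integral_polys d. \<forall>j\<le>d.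
      of_int (N (code P) j) \<le> poly (P + u) (real j) \<and> poly (P + u) (real j) \<le> of_int (N (code P) j) + 1"
    and cell_code: "k \<in> {1..m} \<Longrightarrow> P \<in> lifts d \<alpha> \<Longrightarrow>
      (\<And>j. j \<le> d \<Longrightarrow> of_int (N k j) < poly P (real j) \<and> poly P (real j) < of_int (N k j) + 1) \<Longrightarrow> code P = k"
begin

definition word :: "real poly \<Rightarrow> int \<Rightarrow> nat"
  where "word P i = code (translate i P)"

text \<open>The closure of the set of words of points, described by central windows;
  \<open>closure_words\<close> identifies it with the topological closure.\<close>

definition words :: "(int \<Rightarrow> nat) set"
  where "words = {w. \<forall>L. \<exists>P\<in>lifts d \<alpha>. \<forall>i. \<bar>i\<bar> \<le> L \<longrightarrow> w i = word P i}"

text \<open>The inequalities are closed so that they survive limits. A point on a hyperplane may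
  satisfy them for several k.\<close>

definition in_cell :: "nat \<Rightarrow> real poly \<Rightarrow> bool"
  where "in_cell k P \<longleftrightarrow> (\<exists>u\<in>integral_polys d. \<forall>j\<le>d.
      of_int (N k j) \<le> poly (P + u) (real j) \<and> poly (P + u) (real j) \<le> of_int (N k j) + 1)"

text \<open>P is a base point of w. The relation applies to every word of the closure, including
  those that are not the word of a point.\<close>

definition over :: "(int \<Rightarrow> nat) \<Rightarrow> real poly \<Rightarrow> bool"
  where "over w P \<longleftrightarrow> P \<in> lifts d \<alpha> \<and> (\<forall>i. in_cell (w i) (translate i P))"

lemma word_words: "P \<in> lifts d \<alpha> \<Longrightarrow> word P \<in> words"
  by (auto simp: words_def)

lemma over_word: "P \<in> lifts d \<alpha> \<Longrightarrow> over (word P) P"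
  unfolding over_def in_cell_def word_def using code_cell [OF lifts_translate] by blast

lemma words_range: assumes "w \<in> words" shows "w i \<in> {1..m}"
proof -
  obtain P where "P \<in> lifts d \<alpha>" "\<forall>j. \<bar>j\<bar> \<le> \<bar>i\<bar> \<longrightarrow> w j = word P j" using assms unfolding words_def by blast
  then show ?thesis using code_range by (simp add: word_def)
qed

lemma word_translate: "word (translate n P) i = word P (i + n)"
  by (simp add: word_def)

lemma words_shift: assumes "w \<in> words" shows "(\<lambda>i. w (i + n)) \<in> words"
  unfolding words_def
proof (intro CollectI allI)
  fix L
  obtain P where P: "P \<in> lifts d \<alpha>" "\<forall>i. \<bar>i\<bar> \<le> L + \<bar>n\<bar> \<longrightarrow> w i = word P i" using assms unfolding words_def by blast
  show "\<exists>P\<in>lifts d \<alpha>. \<forall>i. \<bar>i\<bar> \<le> L \<longrightarrow> w (i + n) = word P i"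
    by (rule bexI [of _ "translate n P"]) (use P in \<open>auto simp: word_translate\<close>)
qed

lemma in_cell_cong:
  assumes "P - Q \<in> integral_polys d" shows "in_cell k P \<longleftrightarrow> in_cell k Q"
proof -
  have "in_cell k Q" if PQ: "P - Q \<in> integral_polys d" "in_cell k P" for P Q
  proof -
    obtain u where u: "u \<in> integral_polys d" "\<forall>j\<le>d.
      of_int (N k j) \<le> poly (P + u) (real j) \<and> poly (P + u) (real j) \<le> of_int (N k j) + 1"
      using PQ(2) unfolding in_cell_def by blast
    have "Q + (u + (P - Q)) = P + u" by simp
    then show ?thesis unfolding in_cell_def using u PQ(1) by (intro bexI [of _ "u + (P - Q)"]) auto
  qed
  then show ?thesis using assms integral_polys_minus_iff by blast
qed

lemma over_cong:
  assumes "over w P" "P - Q \<in> integral_polys d" shows "over w Q"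
proof -
  have "Q = P - (P - Q)" by simp
  then have "Q \<in> lifts d \<alpha>" using assms lifts_diff_low integral_polys_low over_def by metis
  moreover have "in_cell (w i) (translate i Q)" for i
  proof -
    have "translate i P - translate i Q \<in> integral_polys d"
      using assms(2) by (metis integral_polys_translate translate_diff)
    then show ?thesis using assms(1) in_cell_cong unfolding over_def by blast
  qed
  ultimately show ?thesis by (simp add: over_def)
qed

lemma over_shift: "over w P \<Longrightarrow> over (\<lambda>i. w (i + n)) (translate n P)"
  by (auto simp: over_def)

text \<open>An integral u changes the values at 0, ..., d by integers, so off the hyperplanes the
  closed inequalities are strict and \<open>cell_code\<close> determines the letter.\<close>

lemma in_cell_code:
  assumes "k \<in> {1..m}" "P \<in> lifts d \<alpha>" "in_cell k P" "\<And>j. j \<le> d \<Longrightarrow> poly P (real j) \<notin> \<int>"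
  shows "code P = k"
proof -
  obtain u where u: "u \<in> integral_polys d" "\<forall>j\<le>d.
      of_int (N k j) \<le> poly (P + u) (real j) \<and> poly (P + u) (real j) \<le> of_int (N k j) + 1"
    using assms(3) unfolding in_cell_def by blast
  have "code (P + u) = k"
  proof (rule cell_code)
    fix j assume j: "j \<le> d"
    have "poly u (real j) \<in> \<int>" using u(1) by (auto intro: poly_integral_polys)
    then have "poly (P + u) (real j) \<notin> \<int>" using assms(4) [OF j] by (metis Ints_diff add_diff_cancel_right' poly_add)
    then have "poly (P + u) (real j) \<noteq> of_int (N k j)" "poly (P + u) (real j) \<noteq> of_int (N k j) + 1"
      by (metis Ints_of_int) (metis Ints_of_int \<open>poly (P + u) (real j) \<notin> \<int>\<close> of_int_1 of_int_add)
    then show "of_int (N k j) < poly (P + u) (real j) \<and> poly (P + u) (real j) < of_int (N k j) + 1"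
      using u(2) j by force
  qed (use assms u in \<open>auto intro: lifts_add_low integral_polys_low\<close>)
  then show ?thesis using code_cong assms(2) u(1) by metis
qed

lemma over_eq_word:
  assumes "w \<in> words" "over w P" "\<And>j. j \<le> d \<Longrightarrow> poly P (of_int (i + int j)) \<notin> \<int>"
  shows "w i = word P i"
  unfolding word_def
  by (rule in_cell_code [symmetric])
     (use assms words_range in \<open>auto simp: over_def add.commute\<close>)

lemma in_cell_closed:
  assumes "\<And>k. (\<lambda>n. coeff (P n) k) \<longlonglongrightarrow> coeff Q k" "\<And>n. P n \<in> lifts d \<alpha>" "Q \<in> lifts d \<alpha>"
    and "\<And>n. in_cell k (P n)"
  shows "in_cell k Q"
  unfolding in_cell_def by (rule cell_closed [OF assms(1-3)]) (use assms(4) in \<open>simp only: in_cell_def\<close>)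

text \<open>Sequential compactness of the set of pairs of a word and a base point. Representatives
  with coefficients in [0, 1] make the base points converge, a second subsequence makes the words
  converge, and closed cells pass to the limit.\<close>

lemma over_compact:
  fixes w :: "nat \<Rightarrow> int \<Rightarrow> nat" and P :: "nat \<Rightarrow> real poly"
  assumes w: "\<And>n. w n \<in> words" and P: "\<And>n. over (w n) (P n)"
  obtains r v Q where "strict_mono r" "v \<in> words" "over v Q"
    "\<And>\<epsilon>. \<epsilon> > 0 \<Longrightarrow> \<forall>\<^sub>F n in sequentially. near d \<epsilon> (P (r n)) Q"
    "\<And>L. \<forall>\<^sub>F n in sequentially. \<forall>i. \<bar>i\<bar> \<le> L \<longrightarrow> w (r n) i = v i"
proof -
  define x where "x n = (\<lambda>k. frac (coeff (P n) k))" for n :: nat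
  have P': "P n \<in> lifts d \<alpha>" for n using P by (simp add: over_def)
  have "x n \<in> (\<Pi>\<^sub>E k\<in>UNIV. {0..1})" for n by (auto simp: x_def PiE_def less_imp_le [OF frac_lt_1])
  moreover have "compact (\<Pi>\<^sub>E k\<in>(UNIV::nat set). {0..1::real})" by (rule compact_PiE_UNIV) auto
  ultimately obtain y r1 where r1: "strict_mono r1" "(x \<circ> r1) \<longlonglongrightarrow> y"
    using compact_convergent_subsequence [of x] by blast
  have w1: "(w \<circ> r1) n \<in> (\<Pi>\<^sub>E k\<in>UNIV. {1..m})" for n using words_range [OF w] by (auto simp: PiE_def)
  have w2: "compact (\<Pi>\<^sub>E k\<in>(UNIV::int set). {1..m})" by (rule compact_PiE_UNIV) (simp add: finite_imp_compact)
  obtain v r2 where r2: "strict_mono r2" "((w \<circ> r1) \<circ> r2) \<longlonglongrightarrow> v"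
    using compact_convergent_subsequence [OF w1 w2] .
  define r where "r = r1 \<circ> r2"
  have r: "strict_mono r" using r1 r2 by (simp add: r_def strict_mono_o)
  have xy: "(\<lambda>n. x (r n) k) \<longlonglongrightarrow> y k" for k
    using LIMSEQ_subseq_LIMSEQ [OF r1(2) r2(1)] unfolding tendsto_fun_iff by (simp add: r_def o_def)
  have wr: "(\<lambda>n. w (r n) i) \<longlonglongrightarrow> v i" for i
    using r2(2) unfolding tendsto_fun_iff r_def o_def by blast
  have "\<forall>\<^sub>F n in sequentially. w (r n) i = v i" for i
    using topological_tendstoD [OF wr [of i], of "{v i}"] by (simp add: open_discrete)
  then have ev: "\<forall>\<^sub>F n in sequentially. \<forall>i. \<bar>i\<bar> \<le> L \<longrightarrow> w (r n) i = v i" for L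
    using eventually_ball_finite [of "{-L..L}" "\<lambda>n i. w (r n) i = v i" sequentially]
    by (auto simp: abs_le_iff elim!: eventually_mono)
  define R where "R n = lift_of d \<alpha> (x n)" for n
  define Q where "Q = lift_of d \<alpha> y"
  have RP: "R n - P n \<in> integral_polys d" for n
    using P' [of n] by (auto simp: R_def x_def integral_polys_def low_def lifts_def frac_def)
  have lim: "(\<lambda>n. coeff (R (r n)) k) \<longlonglongrightarrow> coeff Q k" for k by (auto simp: R_def Q_def xy)
  have v: "v \<in> words" unfolding words_def
  proof (intro CollectI allI)
    fix L
    obtain n where "\<forall>i. \<bar>i\<bar> \<le> L \<longrightarrow> w (r n) i = v i" using eventually_happens [OF ev [of L]] by auto
    moreover obtain P where "P \<in> lifts d \<alpha>" "\<forall>i. \<bar>i\<bar> \<le> L \<longrightarrow> w (r n) i = word P i" using w [of "r n"] unfolding words_def by blast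
    ultimately show "\<exists>P\<in>lifts d \<alpha>. \<forall>i. \<bar>i\<bar> \<le> L \<longrightarrow> v i = word P i" by metis
  qed
  have "over v Q" unfolding over_def
  proof (intro conjI allI)
    fix i
    obtain n0 where n0: "\<And>n. n \<ge> n0 \<Longrightarrow> w (r n) i = v i" using ev [of "\<bar>i\<bar>"] unfolding eventually_sequentially by auto
    have cell: "in_cell (v i) (translate i (R (r (n + n0))))" for n
    proof -
      have "over (w (r (n + n0))) (R (r (n + n0)))" 
        using over_cong [OF P] RP integral_polys_minus_iff by blast
      then have "in_cell (w (r (n + n0)) i) (translate i (R (r (n + n0))))" unfolding over_def by blast
      then show ?thesis using n0 [of "n + n0"] by simp
    qed
    have "(\<lambda>n. coeff (translate i (R (r n))) k) \<longlonglongrightarrow> coeff (translate i Q) k" for k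
      by (rule tendsto_coeff_translate [OF lim, of d \<alpha>]) (auto simp: R_def Q_def)
    then have lim_i: "(\<lambda>n. coeff (translate i (R (r (n + n0)))) k) \<longlonglongrightarrow> coeff (translate i Q) k" for k
      by (rule LIMSEQ_ignore_initial_segment)
    show "in_cell (v i) (translate i Q)"
      by (rule in_cell_closed [OF lim_i _ _ cell]) (auto simp: R_def Q_def)
  qed (simp add: Q_def)
  moreover have "\<forall>\<^sub>F n in sequentially. near d \<epsilon> (P (r n)) Q" if "\<epsilon> > 0" for \<epsilon>
    using eventually_near [OF lim that, of d]
    by (rule eventually_mono) (metis RP near_cong integral_polys_0 diff_self)
  ultimately show ?thesis using r v ev by (intro that [of r v Q]) auto
qed

text \<open>Points whose words agree with w on growing windows have a limit point, which is a base
  point of w because \<open>over\<close> is closed.\<close>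

lemma over_exists: assumes "w \<in> words" obtains P where "over w P"
proof -
  have "\<forall>n::nat. \<exists>P\<in>lifts d \<alpha>. \<forall>i. \<bar>i\<bar> \<le> int n \<longrightarrow> w i = word P i" using assms unfolding words_def by blast
  then obtain P where P: "\<And>n. P n \<in> lifts d \<alpha>" "\<And>n i. \<bar>i\<bar> \<le> int n \<Longrightarrow> w i = word (P n) i" by metis
  obtain r v Q where r: "strict_mono r" "v \<in> words" "over v Q"
    "\<And>L. \<forall>\<^sub>F n in sequentially. \<forall>i. \<bar>i\<bar> \<le> L \<longrightarrow> word (P (r n)) i = v i"
    by (rule over_compact [of "\<lambda>n. word (P n)" P, OF word_words [OF P(1)] over_word [OF P(1)]]) blast
  have "v i = w i" for i
  proof -
    have "\<forall>\<^sub>F n in sequentially. nat \<bar>i\<bar> \<le> n" by (rule eventually_ge_at_top)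
    with r(4) [of "\<bar>i\<bar>"] have "\<forall>\<^sub>F n in sequentially. v i = w i"
    proof eventually_elim
      case (elim n)
      then have "\<bar>i\<bar> \<le> int (r n)" using seq_suble [OF r(1), of n] by linarith
      then show ?case using P(2) elim(1) by simp
    qed
    then show ?thesis by simp
  qed
  then have "v = w" by blast
  then show ?thesis using r(3) that by blast
qed

lemma integral_points_finite: "P \<in> lifts d \<alpha> \<Longrightarrow> finite {n::int. poly P (of_int n) \<in> \<int>}"
  using integral_points(1) irr by blast

lemma nonintegral_eventually:
  assumes "P \<in> lifts d \<alpha>"
  obtains i1 where "i1 \<ge> i0" "\<And>n::int. n \<ge> i1 \<Longrightarrow> poly P (of_int n) \<notin> \<int>"
  using finite_exceptions_bound [OF integral_points_finite [OF assms]] by (metis (no_types, lifting) mem_Collect_eq)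

end

section \<open>The map induced on the torus\<close>

lemma floor_eq_of_not_Ints:
  fixes x :: real
  assumes "x \<notin> \<int>" "of_int n \<le> x + of_int a" "x + of_int a \<le> of_int n + 1"
  shows "\<lfloor>x\<rfloor> = n - a"
proof -
  have "x \<noteq> of_int (n - a + 1)" using assms(1) by (metis Ints_of_int)
  then show ?thesis using assms(2,3) by (simp add: floor_eq_iff)
qed

lemma int_near_0:
  fixes z :: int assumes "\<bar>of_int z :: real\<bar> < 1" shows "z = 0"
  using assms by linarith

lemma near_diff: "near d \<epsilon> A B \<longleftrightarrow> near d \<epsilon> (A - B) 0"
  by (simp add: near_def)

lemma near_const_iff:
  assumes "d \<ge> 1" "\<epsilon> > 0" shows "near d \<epsilon> [:c:] 0 \<longleftrightarrow> (\<exists>z::int. \<bar>c - of_int z\<bar> < \<epsilon>)"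
  using assms unfolding near_from_0 [symmetric] near_from_def
  by (auto simp: coeff_pCons split: nat.splits) (metis abs_0 diff_0_right of_int_0)

lemma near_refl: "\<epsilon> > 0 \<Longrightarrow> near d \<epsilon> A A"
  unfolding near_def by (intro bexI [of _ 0]) auto

lemma integral_const_iff: "d \<ge> 1 \<Longrightarrow> [:c:] \<in> integral_polys d \<longleftrightarrow> c \<in> \<int>"
  using integral_polys_const by (auto simp: integral_polys_def dest!: spec [of _ 0])

text \<open>A small element of the group of the torus that stays small under all iterates of the unipotent linear
  part is vertical.\<close>

lemma expansive:
  assumes d: "d \<ge> 1" and V: "V \<in> low d" and \<epsilon>: "\<epsilon> \<le> 1 / (4 * (real d + 1))"
    and near: "\<And>i::int. near d \<epsilon> (translate i V) 0"
  shows "\<exists>c. \<bar>c\<bar> < \<epsilon> \<and> V - [:c:] \<in> integral_polys d"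
proof -
  obtain u where u: "u \<in> integral_polys d" "\<And>k. k < d \<Longrightarrow> \<bar>coeff (V - u) k\<bar> < \<epsilon>"
    using near [of 0] unfolding near_def by auto
  define W where "W = V - u"
  have W: "W \<in> low d" using V u(1) integral_polys_low by (simp add: W_def)
  have near': "near d \<epsilon> (translate i W) 0" for i
  proof -
    have "translate i V - translate i W \<in> integral_polys d" using u(1) by (simp add: W_def translate_diff)
    then show ?thesis using near near_cong [of _ _ d 0 0] by (metis diff_self integral_polys_0)
  qed
  have "degree W = 0"
  proof (rule ccontr)
    define e where "e = degree W"
    assume "degree W \<noteq> 0"
    then have e: "e \<ge> 1" "e < d" using degree_low [OF W d] by (auto simp: e_def)
    define v where "v = coeff W e"
    define b where "b = coeff W (e - 1)"
    have v0: "v \<noteq> 0" using e unfolding v_def e_def by (metis degree_0 leading_coeff_0_iff not_one_le_zero)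
    have b: "\<bar>b\<bar> < \<epsilon>" and v: "\<bar>v\<bar> < \<epsilon>" using u(2) e by (auto simp: b_def v_def W_def)
    have ec: "e choose (e - 1) = e" using binomial_symmetric [of "e - 1" e] e by simp
    have "{e-1..e} = {e-1, e}" using e by auto
    then have tr: "coeff (translate i W) (e - 1) = b + real e * of_int i * v" for i
      using e ec by (subst coeff_translate [of e]) (auto simp: e_def b_def v_def coeff_eq_0)
    \<comment> \<open>The hypothesis gives smallness only modulo integers. Consecutive values differ
      by at most d * \<epsilon>, so the bound on \<epsilon> excludes a nonzero integer z. Linear
      growth in i with bounded values then contradicts v \<noteq> 0.\<close>
    have "\<bar>b + real e * real i * v\<bar> < \<epsilon>" for i :: nat
    proof (induction i)
      case 0 then show ?case using b by simp
    next
      case (Suc i)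
      obtain z :: int where "\<bar>coeff (translate (int (Suc i)) W - 0) (e - 1) - of_int z\<bar> < \<epsilon>"
        using near' [of "int (Suc i)"] e unfolding near_from_0 [symmetric] near_from_def by (metis le0 less_imp_diff_less)
      then have z: "\<bar>b + real e * real (Suc i) * v - of_int z\<bar> < \<epsilon>" using tr [of "int (Suc i)"] by simp
      have "\<bar>real e * v\<bar> \<le> real d * \<epsilon>" unfolding abs_mult using e v by (intro mult_mono) auto
      moreover have "b + real e * real (Suc i) * v = (b + real e * real i * v) + real e * v" by (simp add: algebra_simps)
      ultimately have "\<bar>of_int z\<bar> < 2 * \<epsilon> + real d * \<epsilon>" using z Suc.IH by linarith
      also have "\<dots> = (real d + 2) * \<epsilon>" by (simp add: algebra_simps)
      also have "\<dots> \<le> (real d + 2) * (1 / (4 * (real d + 1)))" using \<epsilon> by (intro mult_left_mono) auto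
      also have "\<dots> < 1" by (simp add: divide_simps)
      finally have "z = 0" by (rule int_near_0)
      then show ?case using z by simp
    qed
    then have bound: "real i * \<bar>v\<bar> < 2 * \<epsilon>" for i :: nat
    proof -
      have "real i * \<bar>v\<bar> \<le> real e * (real i * \<bar>v\<bar>)" using e mult_right_mono [of 1 "real e" "real i * \<bar>v\<bar>"] by simp
      also have "\<dots> = \<bar>real e * real i * v\<bar>" by (simp add: abs_mult)
      also have "\<dots> < 2 * \<epsilon>" using \<open>\<And>i. \<bar>b + real e * real i * v\<bar> < \<epsilon>\<close> [of i] b by linarith
      finally show ?thesis .
    qed
    obtain i :: nat where "2 * \<epsilon> < real i * \<bar>v\<bar>" using v0 reals_Archimedean3 [of "\<bar>v\<bar>"] by auto
    then show False using bound [of i] by simp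
  qed
  then obtain c where c: "W = [:c:]" by (metis degree_eq_zeroE)
  have "\<bar>c\<bar> < \<epsilon>" using u(2) [of 0] d c by (simp add: W_def [symmetric])
  moreover have "V - [:c:] = u" using c by (simp add: W_def algebra_simps)
  ultimately show ?thesis using u(1) by auto
qed

text \<open>Boundedness replaces continuity: if M * \<rho> stays in the domain, then additivity
  bounds \<tau> \<rho> by 1/M. Hence the linear function with the right value at s = \<delta>/2
  approximates \<tau> arbitrarily well.\<close>

lemma locally_additive_linear:
  fixes \<tau> :: "real \<Rightarrow> real"
  assumes "\<delta> > 0" and bound: "\<And>t. \<bar>t\<bar> < \<delta> \<Longrightarrow> \<bar>\<tau> t\<bar> \<le> 1"
    and add: "\<And>s t. \<bar>s\<bar> < \<delta> \<Longrightarrow> \<bar>t\<bar> < \<delta> \<Longrightarrow> \<bar>s + t\<bar> < \<delta> \<Longrightarrow> \<tau> (s + t) = \<tau> s + \<tau> t"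
  shows "\<exists>a. \<forall>t. \<bar>t\<bar> < \<delta> / 2 \<longrightarrow> \<tau> t = a * t"
proof -
  have mult: "\<tau> (real k * t) = real k * \<tau> t" if kt: "real k * \<bar>t\<bar> < \<delta>" for k t
    using kt
  proof (induction k)
    case 0
    then show ?case using add [of 0 0] assms(1) by simp
  next
    case (Suc k)
    have le: "real k * \<bar>t\<bar> \<le> real (Suc k) * \<bar>t\<bar>" "\<bar>t\<bar> \<le> real (Suc k) * \<bar>t\<bar>" by (auto simp: mult_right_mono mult_le_cancel_right1)
    have "real k * t + t = real (Suc k) * t" by (simp add: algebra_simps)
    then have "\<bar>real k * t + t\<bar> = real (Suc k) * \<bar>t\<bar>" by (simp add: abs_mult)
    then have "\<tau> (real k * t + t) = \<tau> (real k * t) + \<tau> t" using Suc.prems le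
      by (intro add) (simp_all add: abs_mult)
    then show ?case using Suc le by (simp add: algebra_simps)
  qed
  define s where "s = \<delta> / 2"
  have s: "0 < s" "s < \<delta>" using assms(1) by (auto simp: s_def)
  define a where "a = \<tau> s / s"
  have pos: "\<tau> t = a * t" if t: "0 \<le> t" "t < s" for t
  proof -
    have "\<bar>\<tau> t - a * t\<bar> \<le> 2 / real (Suc n)" for n
    proof -
      define M where "M = real (Suc n)"
      have M: "M > 0" by (simp add: M_def)
      \<comment> \<open>On multiples of the mesh h the function agrees with t \<mapsto> a * t; the
        remainder \<rho> of t below h contributes at most 2/M.\<close>
      define h where "h = s / M"
      have h: "h > 0" "M * h = s" using s M by (auto simp: h_def)
      define k where "k = nat \<lfloor>t / h\<rfloor>"
      have kf: "real k = of_int \<lfloor>t / h\<rfloor>" using t h by (simp add: k_def)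
      define \<rho> where "\<rho> = t - real k * h"
      have "real k \<le> t / h" "t / h < real k + 1" unfolding kf by linarith+
      then have \<rho>: "0 \<le> \<rho>" "\<rho> < h" and kh: "real k * h \<le> t" using h by (auto simp: \<rho>_def field_simps)
      have Mh: "\<tau> s = M * \<tau> h" using mult [of "Suc n" h] h s unfolding M_def by simp
      have "M * \<rho> < s" using \<rho> h M by (metis mult_strict_left_mono)
      then have M\<rho>: "\<tau> (M * \<rho>) = M * \<tau> \<rho>" "\<bar>\<tau> (M * \<rho>)\<bar> \<le> 1"
        using mult [of "Suc n" \<rho>] bound [of "M * \<rho>"] \<rho> s M unfolding M_def by auto
      have hM: "h \<le> s" using s M unfolding h_def M_def by (simp add: field_simps)
      have k\<rho>: "real k * h + \<rho> = t" by (simp add: \<rho>_def)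
      then have "\<tau> t = \<tau> (real k * h + \<rho>)" by simp
      also have "\<dots> = \<tau> (real k * h) + \<tau> \<rho>"
      proof (rule add)
        show "\<bar>real k * h + \<rho>\<bar> < \<delta>" unfolding k\<rho> using t s by simp
        show "\<bar>real k * h\<bar> < \<delta>" "\<bar>\<rho>\<bar> < \<delta>" using \<rho> kh t s hM h by auto
      qed
      also have "\<tau> (real k * h) = real k * \<tau> h" using kh t s h by (intro mult) auto
      finally have "\<tau> t - a * t = real k * \<tau> h + \<tau> \<rho> - a * (real k * h + \<rho>)" by (simp add: \<rho>_def)
      also have "a * h = \<tau> h" using Mh h s M by (simp add: a_def h_def)
      then have "real k * \<tau> h + \<tau> \<rho> - a * (real k * h + \<rho>) = \<tau> \<rho> - a * \<rho>" by (simp add: algebra_simps)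
      finally have eq: "\<tau> t - a * t = \<tau> \<rho> - a * \<rho>" .
      have "\<bar>\<tau> \<rho>\<bar> \<le> 1 / M" using M\<rho> M by (simp add: abs_mult field_simps)
      moreover have "\<bar>a * \<rho>\<bar> \<le> 1 / M"
      proof -
        have "\<bar>a * \<rho>\<bar> = \<bar>\<tau> s\<bar> * (\<rho> / s)" using \<rho> s by (simp add: a_def abs_mult)
        also have "\<dots> \<le> 1 * (h / s)" using bound [of s] s \<rho> h by (intro mult_mono divide_right_mono) auto
        also have "h / s = 1 / M" using s by (simp add: h_def)
        finally show ?thesis by simp
      qed
      ultimately show ?thesis unfolding eq M_def by linarith
    qed
    then have "\<bar>\<tau> t - a * t\<bar> \<le> 0"
      by (intro LIMSEQ_le_const [of "\<lambda>n. 2 / real (Suc n)"] exI [of _ 0] tendsto_eq_intros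
           LIMSEQ_Suc [OF tendsto_divide_0 [OF tendsto_const filterlim_at_top_imp_at_infinity [OF filterlim_real_sequentially]]]) auto
    then show ?thesis by simp
  qed
  have "\<tau> t = a * t" if t: "\<bar>t\<bar> < s" for t
  proof (cases "t \<ge> 0")
    case False
    have "\<tau> 0 = 0" using add [of 0 0] assms(1) by simp
    then have "\<tau> t = - \<tau> (- t)" using add [of t "- t"] t s by simp
    then show ?thesis using pos [of "- t"] False t by simp
  qed (use pos t in auto)
  then show ?thesis unfolding s_def by blast
qed

context coded_nilsystem
begin

text \<open>Fractional parts come within c/4 of c/2, which is impossible above a positive bound
  c.\<close>

lemma frac_lower_bound:
  assumes "Q \<in> lifts d \<alpha>" "\<And>n::int. n \<ge> i \<Longrightarrow> c \<le> frac (poly Q (of_int n))"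
  shows "c \<le> 0"
proof (rule ccontr)
  assume "\<not> c \<le> 0"
  moreover then obtain n z where n: "n \<ge> nat i" "\<bar>poly Q (real n) - c / 2 - of_int (z::int)\<bar> < c / 4"
    using values_dense [OF d_pos irr assms(1), of "c / 4" "nat i" "c / 2"] by auto
  moreover have c: "c \<le> frac (poly Q (real n))" using assms(2) [of "int n"] n by simp
  moreover have "c < 1" using c frac_lt_1 le_less_trans by blast
  ultimately have "of_int z \<le> poly Q (real n)" "poly Q (real n) < of_int z + 1" by linarith+
  then have "\<lfloor>poly Q (real n)\<rfloor> = z" by (simp add: floor_eq_iff)
  then have "frac (poly Q (real n)) = poly Q (real n) - of_int z" by (simp add: frac_def)
  then show False using n(2) c \<open>\<not> c \<le> 0\<close> by linarith
qed

text \<open>Equal letters at i make the difference of the integer parts of P and P' agree with an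
  integral polynomial on i, ..., i + d. Consecutive windows share d points, so these polynomials
  coincide. Subtracting the common one from P - P' leaves the difference of the fractional parts,
  which is bounded and hence a constant; \<open>frac_lower_bound\<close>, applied from both sides,
  makes it 0.\<close>

lemma separation:
  assumes "w \<in> words" "w' \<in> words" "over w P" "over w' P'" "\<And>i. i \<ge> i0 \<Longrightarrow> w i = w' i"
  shows "P - P' \<in> integral_polys d"
proof -
  have PL: "P \<in> lifts d \<alpha>" "P' \<in> lifts d \<alpha>" using assms by (auto simp: over_def)
  obtain i1 where i1: "i1 \<ge> i0" "\<And>n::int. n \<ge> i1 \<Longrightarrow> poly P (of_int n) \<notin> \<int>"
    using nonintegral_eventually [OF PL(1)] by blast
  obtain i2 where i2: "i2 \<ge> i1" "\<And>n::int. n \<ge> i2 \<Longrightarrow> poly P' (of_int n) \<notin> \<int>"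
    using nonintegral_eventually [OF PL(2)] by blast
  define s where "s n = \<lfloor>poly P (of_int n)\<rfloor> - \<lfloor>poly P' (of_int n)\<rfloor>" for n :: int
  have "\<exists>v\<in>integral_polys d. \<forall>j\<le>d. of_int (s (i + int j)) = poly v (real j)" if i: "i \<ge> i2" for i
  proof -
    obtain u where u: "u \<in> integral_polys d" "\<And>j. j \<le> d \<Longrightarrow> of_int (N (w i) j) \<le> poly (translate i P + u) (real j) \<and>
        poly (translate i P + u) (real j) \<le> of_int (N (w i) j) + 1"
      using assms(3) unfolding over_def in_cell_def by blast
    have "in_cell (w i) (translate i P')" using assms(4,5) i i1 i2 unfolding over_def by (metis order_trans)
    then obtain u' where u': "u' \<in> integral_polys d" "\<And>j. j \<le> d \<Longrightarrow> of_int (N (w i) j) \<le> poly (translate i P' + u') (real j) \<and>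
        poly (translate i P' + u') (real j) \<le> of_int (N (w i) j) + 1"
      unfolding in_cell_def by blast
    have "of_int (s (i + int j)) = poly (u' - u) (real j)" if j: "j \<le> d" for j
    proof -
      have "poly u (real j) \<in> \<int>" "poly u' (real j) \<in> \<int>" using u(1) u'(1) by (auto intro: poly_integral_polys)
      then obtain a a' :: int where a: "poly u (real j) = of_int a" "poly u' (real j) = of_int a'" unfolding Ints_def by blast
      have "\<lfloor>poly P (of_int (i + int j))\<rfloor> = N (w i) j - a"
        using u(2) [OF j] a i1(2) [of "i + int j"] i i2(1) by (intro floor_eq_of_not_Ints) (auto simp: add.commute)
      moreover have "\<lfloor>poly P' (of_int (i + int j))\<rfloor> = N (w i) j - a'"
        using u'(2) [OF j] a i2(2) [of "i + int j"] i by (intro floor_eq_of_not_Ints) (auto simp: add.commute)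
      ultimately show ?thesis by (simp add: s_def a)
    qed
    then show ?thesis using u(1) u'(1) by (intro bexI [of _ "u' - u"]) auto
  qed
  then obtain v where v: "\<And>i. i \<ge> i2 \<Longrightarrow> v i \<in> integral_polys d"
    "\<And>i j. i \<ge> i2 \<Longrightarrow> j \<le> d \<Longrightarrow> of_int (s (i + int j)) = poly (v i) (real j)" by metis
  \<comment> \<open>Translating back expresses all windows in the same variable, so that
    neighbouring polynomials can be compared.\<close>
  define r where "r i = translate (- i) (v i)" for i
  have r: "r i \<in> integral_polys d" if "i \<ge> i2" for i using v(1) that by (simp add: r_def)
  have rv: "poly (r i) (of_int n) = of_int (s n)" if "i \<ge> i2" "i \<le> n" "n \<le> i + int d" for i n
    using v(2) [of i "nat (n - i)"] that by (auto simp: r_def)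
  have r_step: "r (i + 1) = r i" if i: "i \<ge> i2" for i
  proof (rule low_eqI)
    show "r (i + 1) \<in> low d" "r i \<in> low d" using r i by (auto intro: integral_polys_low)
    show "card ((\<lambda>j. of_int (i + 1 + int j) :: real) ` {..<d}) \<ge> d"
      by (subst card_image) (auto intro: inj_onI)
    show "poly (r (i + 1)) x = poly (r i) x" if x: "x \<in> (\<lambda>j. of_int (i + 1 + int j)) ` {..<d}" for x
    proof -
      obtain j where "j < d" "x = of_int (i + 1 + int j)" using x by auto
      then show ?thesis using i rv [of "i + 1" "i + 1 + int j"] rv [of i "i + 1 + int j"] by simp
    qed
  qed auto
  have r_const: "r n = r i2" if "n \<ge> i2" for n
    using that by (induction rule: int_ge_induct) (auto simp: r_step)
  define D where "D = P - P' - r i2"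
  have D: "poly D (of_int n) = frac (poly P (of_int n)) - frac (poly P' (of_int n))" if "n \<ge> i2" for n
    using rv [of n n] r_const [OF that] that by (simp add: D_def s_def frac_def)
  have "\<bar>poly D (of_int n)\<bar> \<le> 1" if "n \<ge> i2" for n
    using D [OF that] frac_lt_1 [of "poly P (of_int n)"] frac_lt_1 [of "poly P' (of_int n)"]
      frac_ge_0 [of "poly P (of_int n)"] frac_ge_0 [of "poly P' (of_int n)"] by linarith
  then obtain c where c: "D = [:c:]" using bounded_poly_const by blast
  have fr: "frac (poly P (of_int n)) = frac (poly P' (of_int n)) + c" if "n \<ge> i2" for n
    using D [OF that] c by simp
  have "c \<le> frac (poly P (of_int n))" if "n \<ge> i2" for n
    using fr [OF that] frac_ge_0 [of "poly P' (of_int n)"] by linarith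
  then have "c \<le> 0" by (rule frac_lower_bound [OF PL(1)])
  have "- c \<le> frac (poly P' (of_int n))" if "n \<ge> i2" for n
    using fr [OF that] frac_ge_0 [of "poly P (of_int n)"] by linarith
  then have "- c \<le> 0" by (rule frac_lower_bound [OF PL(2)])
  with \<open>c \<le> 0\<close> have "D = 0" using c by simp
  then have "P - P' = r i2" by (simp add: D_def)
  then show ?thesis using r by simp
qed

text \<open>Automorphisms in the form of the Curtis-Hedlund-Lyndon theorem: the two windows belong
  to the block codes of \<phi> and of its inverse, the latter stated without naming the
  inverse.\<close>

definition aut :: "((int \<Rightarrow> nat) \<Rightarrow> int \<Rightarrow> nat) \<Rightarrow> bool"
  where "aut \<phi> \<longleftrightarrow> bij_betw \<phi> words words \<and> (\<forall>w\<in>words. \<phi> (shift w) = shift (\<phi> w)) \<and>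
    (\<exists>R. \<forall>w\<in>words. \<forall>w'\<in>words. (\<forall>i. \<bar>i\<bar> \<le> R \<longrightarrow> w i = w' i) \<longrightarrow> \<phi> w 0 = \<phi> w' 0) \<and>
    (\<exists>R. \<forall>w\<in>words. \<forall>w'\<in>words. (\<forall>i. \<bar>i\<bar> \<le> R \<longrightarrow> \<phi> w i = \<phi> w' i) \<longrightarrow> w 0 = w' 0)"

lemma aut_words: "aut \<phi> \<Longrightarrow> w \<in> words \<Longrightarrow> \<phi> w \<in> words"
  by (auto simp: aut_def bij_betw_def)

lemma aut_shift_nat:
  assumes "aut \<phi>" "w \<in> words" shows "\<phi> (\<lambda>i. w (i + int k)) = (\<lambda>i. \<phi> w (i + int k))"
proof (induction k)
  case (Suc k)
  have "\<phi> (shift (\<lambda>i. w (i + int k))) = shift (\<phi> (\<lambda>i. w (i + int k)))"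
    using assms words_shift by (simp add: aut_def)
  moreover have "shift (\<lambda>i. w (i + int k)) = (\<lambda>i. w (i + int (Suc k)))" for w :: "int \<Rightarrow> nat"
    by (auto simp: shift_def fun_eq_iff algebra_simps)
  ultimately show ?case using Suc by simp
qed simp

lemma aut_shift_int:
  assumes "aut \<phi>" "w \<in> words" shows "\<phi> (\<lambda>i. w (i + n)) = (\<lambda>i. \<phi> w (i + n))"
proof (cases "n \<ge> 0")
  case True
  then show ?thesis using aut_shift_nat [OF assms, of "nat n"] by simp
next
  case False
  define w' where "w' = (\<lambda>i. w (i + n))"
  have "w' \<in> words" using assms words_shift by (simp add: w'_def)
  then have "\<phi> (\<lambda>i. w' (i + int (nat (- n)))) = (\<lambda>i. \<phi> w' (i + int (nat (- n))))" by (rule aut_shift_nat [OF assms(1)])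
  then have *: "\<phi> w = (\<lambda>i. \<phi> w' (i - n))" using False by (simp add: w'_def)
  show ?thesis by (auto simp: * w'_def)
qed

lemma aut_block:
  assumes "aut \<phi>"
  obtains R where "\<And>w w' i. w \<in> words \<Longrightarrow> w' \<in> words \<Longrightarrow> (\<And>j. \<bar>j\<bar> \<le> R \<Longrightarrow> w (i + j) = w' (i + j)) \<Longrightarrow> \<phi> w i = \<phi> w' i"
proof -
  obtain R where R: "\<And>w w'. w \<in> words \<Longrightarrow> w' \<in> words \<Longrightarrow> (\<And>j. \<bar>j\<bar> \<le> R \<Longrightarrow> w j = w' j) \<Longrightarrow> \<phi> w 0 = \<phi> w' 0"
    using assms unfolding aut_def by blast
  have "\<phi> w i = \<phi> w' i" if w: "w \<in> words" "w' \<in> words" "\<And>j. \<bar>j\<bar> \<le> R \<Longrightarrow> w (i + j) = w' (i + j)" for w w' i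
  proof -
    have "\<phi> (\<lambda>j. w (j + i)) 0 = \<phi> (\<lambda>j. w' (j + i)) 0"
      by (rule R [OF words_shift words_shift]) (use w in \<open>simp_all add: add.commute [of _ i]\<close>)
    then show ?thesis using aut_shift_int [OF assms] w(1,2) by simp
  qed
  then show ?thesis using that by blast
qed

lemma aut_block_inv:
  assumes "aut \<phi>"
  obtains R where "\<And>w w'. w \<in> words \<Longrightarrow> w' \<in> words \<Longrightarrow> (\<And>j. \<bar>j\<bar> \<le> R \<Longrightarrow> \<phi> w j = \<phi> w' j) \<Longrightarrow> w 0 = w' 0"
  using assms unfolding aut_def by blast

text \<open>The graph of the map induced on base points.\<close>

definition rel :: "((int \<Rightarrow> nat) \<Rightarrow> int \<Rightarrow> nat) \<Rightarrow> real poly \<Rightarrow> real poly \<Rightarrow> bool"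
  where "rel \<phi> P Q \<longleftrightarrow> (\<exists>w\<in>words. over w P \<and> over (\<phi> w) Q)"

lemma rel_lifts: "rel \<phi> P Q \<Longrightarrow> P \<in> lifts d \<alpha>" "rel \<phi> P Q \<Longrightarrow> Q \<in> lifts d \<alpha>"
  by (auto simp: rel_def over_def)

lemma rel_total: assumes "aut \<phi>" "P \<in> lifts d \<alpha>" obtains Q where "rel \<phi> P Q"
proof -
  obtain Q where "over (\<phi> (word P)) Q" using over_exists aut_words [OF assms(1)] word_words [OF assms(2)] by blast
  then show ?thesis using that word_words over_word assms(2) unfolding rel_def by blast
qed

lemma rel_cong: "rel \<phi> P Q \<Longrightarrow> P - P' \<in> integral_polys d \<Longrightarrow> Q - Q' \<in> integral_polys d \<Longrightarrow> rel \<phi> P' Q'"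
  unfolding rel_def using over_cong by blast

lemma rel_translate:
  assumes "aut \<phi>" "rel \<phi> P Q" shows "rel \<phi> (translate n P) (translate n Q)"
proof -
  obtain w where w: "w \<in> words" "over w P" "over (\<phi> w) Q" using assms(2) unfolding rel_def by blast
  then have "over (\<phi> (\<lambda>i. w (i + n))) (translate n Q)" using aut_shift_int [OF assms(1)] over_shift by simp
  then show ?thesis unfolding rel_def using w over_shift words_shift by blast
qed

lemma over_eventually_eq:
  assumes "w \<in> words" "w' \<in> words" "over w P" "over w' P"
  obtains i1 where "\<And>i. i \<ge> i1 \<Longrightarrow> w i = w' i"
proof -
  have "P \<in> lifts d \<alpha>" using assms by (simp add: over_def)
  then obtain i1 where i1: "\<And>n::int. n \<ge> i1 \<Longrightarrow> poly P (of_int n) \<notin> \<int>"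
    using nonintegral_eventually [of P 0] by blast
  have "poly P (of_int (i + int j)) \<notin> \<int>" if "i \<ge> i1" for i j
    by (rule i1) (use that in simp)
  then have "w i = word P i" "w' i = word P i" if "i \<ge> i1" for i
    using that by (blast intro: over_eq_word assms)+
  then show ?thesis using that by metis
qed

text \<open>A block code preserves equality from some place on, so two words over one point have
  images to which \<open>separation\<close> applies.\<close>

lemma rel_unique:
  assumes \<phi>: "aut \<phi>" and "rel \<phi> P Q" "rel \<phi> P' Q'" "P - P' \<in> integral_polys d"
  shows "Q - Q' \<in> integral_polys d"
proof -
  obtain w where w: "w \<in> words" "over w P" "over (\<phi> w) Q" using assms(2) unfolding rel_def by blast
  obtain w' where w': "w' \<in> words" "over w' P'" "over (\<phi> w') Q'" using assms(3) unfolding rel_def by blast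
  have "over w' P" using w'(2) assms(4) over_cong integral_polys_minus_iff by blast
  then obtain i1 where i1: "\<And>i. i \<ge> i1 \<Longrightarrow> w i = w' i" using over_eventually_eq w w'(1) by blast
  obtain R where R: "\<And>w w' i. w \<in> words \<Longrightarrow> w' \<in> words \<Longrightarrow> (\<And>j. \<bar>j\<bar> \<le> R \<Longrightarrow> w (i + j) = w' (i + j)) \<Longrightarrow> \<phi> w i = \<phi> w' i"
    using aut_block [OF \<phi>] by blast
  have "\<phi> w i = \<phi> w' i" if "i \<ge> i1 + R" for i
    using that i1 by (intro R w(1) w'(1)) auto
  then show ?thesis using separation [of "\<phi> w" "\<phi> w'" Q Q' "i1 + R"] w w' aut_words [OF \<phi>] by blast
qed

section \<open>Uniform continuity of base points and of the induced map\<close>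

lemma near_limit:
  assumes near: "\<And>\<epsilon>. \<epsilon> > 0 \<Longrightarrow> \<forall>\<^sub>F n in sequentially. near d \<epsilon> (P n) P'" "\<And>\<epsilon>. \<epsilon> > 0 \<Longrightarrow> \<forall>\<^sub>F n in sequentially. near d \<epsilon> (Q n) Q'"
    and PQ: "\<And>\<epsilon>. \<epsilon> > 0 \<Longrightarrow> \<forall>\<^sub>F n in sequentially. near d \<epsilon> (P n) (Q n)" and "P' \<in> lifts d \<alpha>" "Q' \<in> lifts d \<alpha>"
  shows "P' - Q' \<in> integral_polys d"
proof (rule near_all_imp_integral)
  fix \<epsilon> :: real assume "\<epsilon> > 0"
  then have "\<epsilon> / 3 > 0" by simp
  have "\<forall>\<^sub>F n in sequentially. near d \<epsilon> P' Q'"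
    using near(1) [OF \<open>\<epsilon> / 3 > 0\<close>] near(2) [OF \<open>\<epsilon> / 3 > 0\<close>] PQ [OF \<open>\<epsilon> / 3 > 0\<close>]
  proof eventually_elim
    case (elim n)
    then have "near d (\<epsilon> / 3 + \<epsilon> / 3 + \<epsilon> / 3) P' Q'" by (blast intro: near_triangle near_sym)
    then show ?case by simp
  qed
  then show "near d \<epsilon> P' Q'" by simp
qed (use assms(4,5) lifts_diff in auto)



text \<open>Compactness: counterexamples on growing windows converge to one word with two different
  base points, contrary to \<open>separation\<close>.\<close>

lemma base_point_uniform:
  assumes "\<epsilon> > 0"
  obtains L where "\<And>w w' P P'. w \<in> words \<Longrightarrow> w' \<in> words \<Longrightarrow> over w P \<Longrightarrow> over w' P' \<Longrightarrow> (\<And>i. \<bar>i\<bar> \<le> L \<Longrightarrow> w i = w' i) \<Longrightarrow> near d \<epsilon> P P'"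
proof -
  have "\<exists>L. \<forall>w w' P P'. w \<in> words \<longrightarrow> w' \<in> words \<longrightarrow> over w P \<longrightarrow> over w' P' \<longrightarrow> (\<forall>i. \<bar>i\<bar> \<le> L \<longrightarrow> w i = w' i) \<longrightarrow> near d \<epsilon> P P'"
  proof (rule ccontr)
    assume "\<not> ?thesis"
    then have "\<forall>n::nat. \<exists>w w' P P'. w \<in> words \<and> w' \<in> words \<and> over w P \<and> over w' P' \<and> (\<forall>i. \<bar>i\<bar> \<le> int n \<longrightarrow> w i = w' i) \<and> \<not> near d \<epsilon> P P'"
      by blast
    then obtain w w' P P' where w: "\<And>n. w n \<in> words" "\<And>n. w' n \<in> words" "\<And>n. over (w n) (P n)" "\<And>n. over (w' n) (P' n)"
      "\<And>n i. \<bar>i\<bar> \<le> int n \<Longrightarrow> w n i = w' n i" "\<And>n. \<not> near d \<epsilon> (P n) (P' n)" by metis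
    obtain r v Q where r: "strict_mono r" "v \<in> words" "over v Q" "\<And>\<epsilon>. \<epsilon> > 0 \<Longrightarrow> \<forall>\<^sub>F n in sequentially. near d \<epsilon> (P (r n)) Q"
      "\<And>L. \<forall>\<^sub>F n in sequentially. \<forall>i. \<bar>i\<bar> \<le> L \<longrightarrow> w (r n) i = v i"
      by (rule over_compact [of w P, OF w(1,3)]) (rule that)
    obtain r' v' Q' where r': "strict_mono r'" "v' \<in> words" "over v' Q'"
      "\<And>\<epsilon>. \<epsilon> > 0 \<Longrightarrow> \<forall>\<^sub>F n in sequentially. near d \<epsilon> (P' (r (r' n))) Q'"
      "\<And>L. \<forall>\<^sub>F n in sequentially. \<forall>i. \<bar>i\<bar> \<le> L \<longrightarrow> w' (r (r' n)) i = v' i"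
      by (rule over_compact [of "\<lambda>n. w' (r n)" "\<lambda>n. P' (r n)", OF w(2,4)]) (rule that)
    have "v i = v' i" for i
    proof -
      have "\<forall>\<^sub>F n in sequentially. nat \<bar>i\<bar> \<le> n" by (rule eventually_ge_at_top)
      with r'(5) [of "\<bar>i\<bar>"] eventually_subseq [OF r'(1) r(5) [of "\<bar>i\<bar>"]]
      have "\<forall>\<^sub>F n in sequentially. v i = v' i"
      proof eventually_elim
        case (elim n)
        have "n \<le> r (r' n)" using seq_suble [OF r(1), of "r' n"] seq_suble [OF r'(1), of n] by linarith
        then have "\<bar>i\<bar> \<le> int (r (r' n))" using elim(3) by linarith
        then show ?case using w(5) [of i "r (r' n)"] elim(1,2) by simp
      qed
      then show ?thesis by simp
    qed
    then have "v = v'" by blast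
    then have QQ: "Q - Q' \<in> integral_polys d" using separation [OF r(2) r(2) r(3)] r'(3) by blast
    have \<epsilon>2: "\<epsilon> / 2 > 0" using assms by simp
    have "\<forall>\<^sub>F n in sequentially. False"
      using eventually_subseq [OF r'(1) r(4) [OF \<epsilon>2]] r'(4) [OF \<epsilon>2]
    proof eventually_elim
      case (elim n)
      then have 1: "near d (\<epsilon> / 2) (P (r (r' n))) Q" and 2: "near d (\<epsilon> / 2) (P' (r (r' n))) Q'" by auto
      have "near d (\<epsilon> / 2) Q (P' (r (r' n)))"
        using near_sym [OF 2] near_cong [OF QQ, of "P' (r (r' n))" "P' (r (r' n))"] by simp
      then have "near d (\<epsilon> / 2 + \<epsilon> / 2) (P (r (r' n))) (P' (r (r' n)))" using 1 near_triangle by blast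
      then show ?case using w(6) by simp
    qed
    then show False by simp
  qed
  then show ?thesis using that by blast
qed

text \<open>A function with closed graph on a compact space is uniformly continuous. The four
  successive subsequences belong to the two sequences of words and to their two image sequences;
  \<open>rel_unique\<close> compares the limits.\<close>

lemma rel_uniform:
  assumes \<phi>: "aut \<phi>" and "\<epsilon> > 0"
  obtains \<delta> where "\<delta> > 0" "\<And>P P' Q Q'. rel \<phi> P Q \<Longrightarrow> rel \<phi> P' Q' \<Longrightarrow> near d \<delta> P P' \<Longrightarrow> near d \<epsilon> Q Q'"
proof -
  have "\<exists>\<delta>>0. \<forall>P P' Q Q'. rel \<phi> P Q \<longrightarrow> rel \<phi> P' Q' \<longrightarrow> near d \<delta> P P' \<longrightarrow> near d \<epsilon> Q Q'"
  proof (rule ccontr)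
    assume "\<not> ?thesis"
    then have "\<exists>P P' Q Q'. rel \<phi> P Q \<and> rel \<phi> P' Q' \<and> near d (1 / real (Suc n)) P P' \<and> \<not> near d \<epsilon> Q Q'" for n
      by (metis divide_pos_pos of_nat_0_less_iff zero_less_Suc zero_less_one)
    then obtain P P' Q Q' where *: "\<And>n. rel \<phi> (P n) (Q n)" "\<And>n. rel \<phi> (P' n) (Q' n)"
      "\<And>n. near d (1 / real (Suc n)) (P n) (P' n)" "\<And>n. \<not> near d \<epsilon> (Q n) (Q' n)" by metis
    from *(1) obtain w where w: "\<And>n. w n \<in> words" "\<And>n. over (w n) (P n)" "\<And>n. over (\<phi> (w n)) (Q n)"
      unfolding rel_def by metis
    from *(2) obtain w' where w': "\<And>n. w' n \<in> words" "\<And>n. over (w' n) (P' n)" "\<And>n. over (\<phi> (w' n)) (Q' n)"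
      unfolding rel_def by metis
    obtain R where R: "\<And>w w' i. w \<in> words \<Longrightarrow> w' \<in> words \<Longrightarrow> (\<And>j. \<bar>j\<bar> \<le> R \<Longrightarrow> w (i + j) = w' (i + j)) \<Longrightarrow> \<phi> w i = \<phi> w' i"
      using aut_block [OF \<phi>] by blast
    \<comment> \<open>A block code respects convergence on windows, at the cost of enlarging the
      window by R.\<close>
    have \<phi>lim: "\<forall>\<^sub>F n in sequentially. \<forall>i. \<bar>i\<bar> \<le> L \<longrightarrow> \<phi> (x n) i = \<phi> v i"
      if x: "\<And>n. x n \<in> words" "v \<in> words" "\<And>L. \<forall>\<^sub>F n in sequentially. \<forall>i. \<bar>i\<bar> \<le> L \<longrightarrow> x n i = v i" for x v L
      using x(3) [of "L + R"]
    proof eventually_elim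
      case (elim n)
      then show ?case by (intro allI impI R x) (auto simp: abs_le_iff)
    qed
    obtain r1 v1 P1 where r1: "strict_mono r1" "v1 \<in> words" "over v1 P1" "\<And>\<epsilon>. \<epsilon> > 0 \<Longrightarrow> \<forall>\<^sub>F n in sequentially. near d \<epsilon> (P (r1 n)) P1"
      "\<And>L. \<forall>\<^sub>F n in sequentially. \<forall>i. \<bar>i\<bar> \<le> L \<longrightarrow> w (r1 n) i = v1 i"
      by (rule over_compact [of w P, OF w(1,2)]) (rule that)
    obtain r2 v2 P2 where r2: "strict_mono r2" "v2 \<in> words" "over v2 P2" "\<And>\<epsilon>. \<epsilon> > 0 \<Longrightarrow> \<forall>\<^sub>F n in sequentially. near d \<epsilon> (P' (r1 (r2 n))) P2"
      "\<And>L. \<forall>\<^sub>F n in sequentially. \<forall>i. \<bar>i\<bar> \<le> L \<longrightarrow> w' (r1 (r2 n)) i = v2 i"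
      by (rule over_compact [of "\<lambda>n. w' (r1 n)" "\<lambda>n. P' (r1 n)", OF w'(1,2)]) (rule that)
    obtain r3 v3 Q1 where r3: "strict_mono r3" "v3 \<in> words" "over v3 Q1" "\<And>\<epsilon>. \<epsilon> > 0 \<Longrightarrow> \<forall>\<^sub>F n in sequentially. near d \<epsilon> (Q (r1 (r2 (r3 n)))) Q1"
      "\<And>L. \<forall>\<^sub>F n in sequentially. \<forall>i. \<bar>i\<bar> \<le> L \<longrightarrow> \<phi> (w (r1 (r2 (r3 n)))) i = v3 i"
      by (rule over_compact [of "\<lambda>n. \<phi> (w (r1 (r2 n)))" "\<lambda>n. Q (r1 (r2 n))", OF aut_words [OF \<phi> w(1)] w(3)]) (rule that)
    obtain r4 v4 Q2 where r4: "strict_mono r4" "v4 \<in> words" "over v4 Q2" "\<And>\<epsilon>. \<epsilon> > 0 \<Longrightarrow> \<forall>\<^sub>F n in sequentially. near d \<epsilon> (Q' (r1 (r2 (r3 (r4 n))))) Q2"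
      "\<And>L. \<forall>\<^sub>F n in sequentially. \<forall>i. \<bar>i\<bar> \<le> L \<longrightarrow> \<phi> (w' (r1 (r2 (r3 (r4 n))))) i = v4 i"
      by (rule over_compact [of "\<lambda>n. \<phi> (w' (r1 (r2 (r3 n))))" "\<lambda>n. Q' (r1 (r2 (r3 n)))", OF aut_words [OF \<phi> w'(1)] w'(3)]) (rule that)
    define r where "r n = r1 (r2 (r3 (r4 n)))" for n
    have s34: "strict_mono (\<lambda>n. r3 (r4 n))" and s234: "strict_mono (\<lambda>n. r2 (r3 (r4 n)))"
      using r2(1) r3(1) r4(1) by (auto simp: strict_mono_def)
    have r: "strict_mono r" using r1(1) s234 by (auto simp: r_def strict_mono_def)
    have v3: "v3 = \<phi> v1"
    proof
      fix i
      have "\<forall>\<^sub>F n in sequentially. v3 i = \<phi> v1 i"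
        using eventually_subseq [OF r4(1) r3(5) [of "\<bar>i\<bar>"]] eventually_subseq [OF s234 \<phi>lim [OF w(1) r1(2) r1(5), of "\<bar>i\<bar>"]]
        by eventually_elim simp
      then show "v3 i = \<phi> v1 i" by simp
    qed
    have v4: "v4 = \<phi> v2"
    proof
      fix i
      have "\<forall>\<^sub>F n in sequentially. v4 i = \<phi> v2 i"
        using r4(5) [of "\<bar>i\<bar>"] eventually_subseq [OF s34 \<phi>lim [OF w'(1) r2(2) r2(5), of "\<bar>i\<bar>"]]
        by eventually_elim simp
      then show "v4 i = \<phi> v2 i" by simp
    qed
    have "\<forall>\<^sub>F n in sequentially. near d \<epsilon> (P (r n)) (P' (r n))" if "\<epsilon> > 0" for \<epsilon>
    proof -
      have "\<forall>\<^sub>F n in sequentially. 1 / real (Suc n) < \<epsilon>"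
        using order_tendstoD(2) [OF LIMSEQ_inverse_real_of_nat that] by (simp add: inverse_eq_divide)
      then have "\<forall>\<^sub>F n in sequentially. near d \<epsilon> (P n) (P' n)"
        by eventually_elim (use *(3) near_mono less_imp_le in blast)
      then show ?thesis by (rule eventually_subseq [OF r])
    qed
    then have "P1 - P2 \<in> integral_polys d"
      using eventually_subseq [OF s234 r1(4)] eventually_subseq [OF s34 r2(4)] r1(3) r2(3)
      by (intro near_limit [of "\<lambda>n. P (r n)" P1 "\<lambda>n. P' (r n)" P2]) (auto simp: r_def over_def)
    moreover have "rel \<phi> P1 Q1" "rel \<phi> P2 Q2" using r1 r2 r3 r4 v3 v4 unfolding rel_def by blast+
    ultimately have QQ: "Q1 - Q2 \<in> integral_polys d" by (metis rel_unique [OF \<phi>])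
    have "\<forall>\<^sub>F n in sequentially. near d (\<epsilon> / 2) (Q (r n)) Q1 \<and> near d (\<epsilon> / 2) (Q' (r n)) Q2"
      using eventually_subseq [OF r4(1) r3(4) [of "\<epsilon> / 2"]] r4(4) [of "\<epsilon> / 2"] \<open>\<epsilon> > 0\<close>
      by (simp add: r_def eventually_conj)
    then obtain n where 1: "near d (\<epsilon> / 2) (Q (r n)) Q1" and 2: "near d (\<epsilon> / 2) (Q' (r n)) Q2"
      using eventually_happens [of _ sequentially] by auto
    have "near d (\<epsilon> / 2) Q1 (Q' (r n))"
      using near_sym [OF 2] near_cong [OF QQ, of "Q' (r n)" "Q' (r n)"] by simp
    then have "near d (\<epsilon> / 2 + \<epsilon> / 2) (Q (r n)) (Q' (r n))" using 1 near_triangle by blast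
    then show False using *(4) by simp
  qed
  then show ?thesis using that by blast
qed

end

section \<open>Rigidity\<close>

lemma near_diff_mono:
  assumes "near d \<epsilon> A B" "near d \<eta> C D" shows "near d (\<epsilon> + \<eta>) (A - C) (B - D)"
proof (rule near_triangle)
  show "near d \<epsilon> (A - C) (B - C)" using assms(1) by (simp add: near_def)
  show "near d \<eta> (B - C) (B - D)" using near_sym [OF assms(2)] by (simp add: near_def)
qed

text \<open>The product u of the factors x - j, for j in J, vanishes on J and at no other integer.
  Adding a small multiple s * u to P keeps the values on J, and only countably many s create a
  further integral value. If J has d elements, u has degree d and cannot be added, but then P has no
  integral value outside J already.\<close>

lemma generic_point:
  fixes J :: "int set"
  assumes d: "d \<ge> 1" and \<alpha>: "\<alpha> \<notin> \<rat>" and P: "P \<in> lifts d \<alpha>" and J: "finite J" "card J \<le> d" "\<And>j. j \<in> J \<Longrightarrow> poly P (of_int j) \<in> \<int>"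
    and "\<epsilon> > 0"
  shows "\<exists>Q\<in>lifts d \<alpha>. (\<forall>k<d. \<bar>coeff (Q - P) k\<bar> < \<epsilon>) \<and> (\<forall>n. poly Q (of_int n) \<in> \<int> \<longleftrightarrow> n \<in> J) \<and>
    (\<forall>j\<in>J. poly Q (of_int j) = poly P (of_int j))"
proof (cases "card J = d")
  case True
  have "J = {n. poly P (of_int n) \<in> \<int>}"
    using integral_points [OF P \<alpha>] J True by (intro card_seteq) auto
  then show ?thesis using P \<open>\<epsilon> > 0\<close> by (intro bexI [of _ P]) auto
next
  case False
  define u :: "real poly" where "u = (\<Prod>j\<in>J. [:- of_int j, 1:])"
  have "degree u = card J" unfolding u_def by (subst degree_prod_eq_sum_degree) auto
  then have u_low: "u \<in> low d" using J(2) False by (auto simp: low_def intro!: coeff_eq_0)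
  have u0: "poly u (of_int n) = 0 \<longleftrightarrow> n \<in> J" for n using J(1) by (auto simp: u_def poly_prod)
  define M where "M = (\<Sum>k<d. \<bar>coeff u k\<bar>) + 1"
  have M: "M > 0" "\<And>k. k < d \<Longrightarrow> \<bar>coeff u k\<bar> < M"
  proof -
    show "M > 0" unfolding M_def by (intro add_nonneg_pos sum_nonneg) auto
    show "\<bar>coeff u k\<bar> < M" if "k < d" for k
      using member_le_sum [of k "{..<d}" "\<lambda>k. \<bar>coeff u k\<bar>"] that by (auto simp: M_def)
  qed
  define bad where "bad = (\<Union>n. \<Union>z::int. {s. n \<notin> J \<and> poly P (of_int n) + s * poly u (of_int n) = of_int z})"
  have "countable {s. n \<notin> J \<and> poly P (of_int n) + s * poly u (of_int n) = of_int z}" for n z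
  proof (cases "n \<in> J")
    case False
    then have "poly u (of_int n) \<noteq> 0" using u0 by simp
    then have "{s. n \<notin> J \<and> poly P (of_int n) + s * poly u (of_int n) = of_int z} \<subseteq> {(of_int z - poly P (of_int n)) / poly u (of_int n)}"
      by (auto simp: eq_divide_eq)
    then show ?thesis by (rule countable_subset) simp
  qed auto
  then have "countable bad" unfolding bad_def by (intro countable_UN) auto
  moreover have "uncountable {0<..<\<epsilon> / M}" using M \<open>\<epsilon> > 0\<close> by (intro uncountable_open_interval [THEN iffD2]) auto
  ultimately have "\<not> {0<..<\<epsilon> / M} \<subseteq> bad" using countable_subset by blast
  then obtain s where s: "s \<notin> bad" "0 < s" "s < \<epsilon> / M" by (meson greaterThanLessThan_iff subsetI)
  define Q where "Q = P + smult s u"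
  have "\<bar>coeff (Q - P) k\<bar> < \<epsilon>" if "k < d" for k
  proof -
    have "\<bar>coeff (Q - P) k\<bar> = s * \<bar>coeff u k\<bar>" using s by (simp add: Q_def abs_mult)
    also have "\<dots> \<le> s * M" using s M(2) [OF that] by (intro mult_left_mono) auto
    also have "\<dots> < \<epsilon>" using s M by (simp add: field_simps)
    finally show ?thesis .
  qed
  moreover have "poly Q (of_int n) \<in> \<int> \<longleftrightarrow> n \<in> J" for n
  proof
    assume "poly Q (of_int n) \<in> \<int>"
    then obtain z where "poly Q (of_int n) = of_int z" unfolding Ints_def by blast
    then show "n \<in> J" using s(1) by (auto simp: bad_def Q_def)
  next
    assume "n \<in> J" then show "poly Q (of_int n) \<in> \<int>" using J(3) [of n] u0 [of n] by (simp add: Q_def)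
  qed
  moreover have "Q \<in> lifts d \<alpha>" using P u_low by (simp add: Q_def)
  moreover have "\<forall>j\<in>J. poly Q (of_int j) = poly P (of_int j)" using u0 by (simp add: Q_def)
  ultimately show ?thesis by blast
qed

text \<open>On a bounded window the nonintegral values keep a positive distance from the integers.
  At integral values the bound 1 is kept, which later identifies two integral values with each
  other.\<close>

lemma floors_stable:
  assumes "P \<in> lifts d \<alpha>"
  obtains \<delta> where "\<delta> > 0"
    "\<And>Q n. Q \<in> lifts d \<alpha> \<Longrightarrow> (\<And>k. k < d \<Longrightarrow> \<bar>coeff (Q - P) k\<bar> < \<delta>) \<Longrightarrow> \<bar>n\<bar> \<le> L \<Longrightarrow> \<bar>poly Q (of_int n) - poly P (of_int n)\<bar> < 1"
    "\<And>Q n. Q \<in> lifts d \<alpha> \<Longrightarrow> (\<And>k. k < d \<Longrightarrow> \<bar>coeff (Q - P) k\<bar> < \<delta>) \<Longrightarrow> \<bar>n\<bar> \<le> L \<Longrightarrow> poly P (of_int n) \<notin> \<int> \<Longrightarrow>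
      poly Q (of_int n) \<notin> \<int> \<and> \<lfloor>poly Q (of_int n)\<rfloor> = \<lfloor>poly P (of_int n)\<rfloor>"
proof -
  define g where "g n = (if poly P (of_int n) \<in> \<int> then 1 else min (frac (poly P (of_int n))) (1 - frac (poly P (of_int n))))" for n :: int
  define \<gamma> where "\<gamma> = Min (insert 1 (g ` {-L..L}))"
  have g: "g n > 0" for n by (simp add: g_def frac_lt_1 frac_gt_0_iff)
  have \<gamma>: "\<gamma> > 0" "\<gamma> \<le> 1" unfolding \<gamma>_def using g by (auto simp: Min_le_iff)
  have \<gamma>g: "\<gamma> \<le> g n" if "\<bar>n\<bar> \<le> L" for n
  proof -
    have "g n \<in> g ` {-L..L}" using that by (intro imageI) auto
    then show ?thesis unfolding \<gamma>_def by (intro Min_le) auto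
  qed
  define M where "M = (\<Sum>k\<le>d. \<bar>of_int L\<bar> ^ k) + (1::real)"
  have M: "M > 0" unfolding M_def by (intro add_nonneg_pos sum_nonneg) auto
  define \<delta> where "\<delta> = \<gamma> / M"
  have \<delta>: "\<delta> > 0" using \<gamma> M by (simp add: \<delta>_def)
  have close: "\<bar>poly Q (of_int n) - poly P (of_int n)\<bar> < \<gamma>"
    if Q: "Q \<in> lifts d \<alpha>" "\<And>k. k < d \<Longrightarrow> \<bar>coeff (Q - P) k\<bar> < \<delta>" "\<bar>n\<bar> \<le> L" for Q n
  proof -
    have D: "Q - P \<in> low d" using Q(1) assms lifts_diff by blast
    have c: "\<bar>coeff (Q - P) k\<bar> \<le> \<delta>" for k
    proof (cases "k < d")
      case True then show ?thesis using Q(2) less_imp_le by blast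
    next
      case False then show ?thesis using D \<delta> by (simp add: low_def)
    qed
    have "poly (Q - P) (of_int n) = (\<Sum>k\<le>d. coeff (Q - P) k * of_int n ^ k)"
      using D by (intro poly_eq_sum) (auto simp: low_def)
    also have "\<bar>\<dots>\<bar> \<le> (\<Sum>k\<le>d. \<bar>coeff (Q - P) k * of_int n ^ k\<bar>)" by (rule sum_abs)
    also have "\<dots> \<le> (\<Sum>k\<le>d. \<delta> * \<bar>of_int L\<bar> ^ k)"
      unfolding abs_mult power_abs using c Q(3) \<delta> by (intro sum_mono mult_mono power_mono) auto
    also have "\<dots> = \<delta> * (M - 1)" by (simp add: M_def sum_distrib_left)
    also have "\<dots> < \<delta> * M" using \<delta> by simp
    also have "\<dots> = \<gamma>" using M by (simp add: \<delta>_def)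
    finally show ?thesis by simp
  qed
  have fl: "poly Q (of_int n) \<notin> \<int> \<and> \<lfloor>poly Q (of_int n)\<rfloor> = \<lfloor>poly P (of_int n)\<rfloor>"
    if Q: "Q \<in> lifts d \<alpha>" "\<And>k. k < d \<Longrightarrow> \<bar>coeff (Q - P) k\<bar> < \<delta>" "\<bar>n\<bar> \<le> L" "poly P (of_int n) \<notin> \<int>" for Q n
  proof -
    have "\<bar>poly Q (of_int n) - poly P (of_int n)\<bar> < g n" using close [OF Q(1-3)] \<gamma>g [OF Q(3)] by linarith
    then have "\<bar>poly Q (of_int n) - poly P (of_int n)\<bar> < frac (poly P (of_int n))"
      "\<bar>poly Q (of_int n) - poly P (of_int n)\<bar> < 1 - frac (poly P (of_int n))" using Q(4) by (auto simp: g_def)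
    then have lt: "of_int \<lfloor>poly P (of_int n)\<rfloor> < poly Q (of_int n)" "poly Q (of_int n) < of_int \<lfloor>poly P (of_int n)\<rfloor> + 1"
      unfolding frac_def by linarith+
    then have fl: "\<lfloor>poly Q (of_int n)\<rfloor> = \<lfloor>poly P (of_int n)\<rfloor>" by (simp add: floor_eq_iff)
    moreover have "poly Q (of_int n) \<notin> \<int>"
    proof
      assume "poly Q (of_int n) \<in> \<int>"
      then have "poly Q (of_int n) = of_int \<lfloor>poly Q (of_int n)\<rfloor>" by simp
      then show False using lt fl by simp
    qed
    ultimately show ?thesis by blast
  qed
  have close1: "\<bar>poly Q (of_int n) - poly P (of_int n)\<bar> < 1"
    if "Q \<in> lifts d \<alpha>" "\<And>k. k < d \<Longrightarrow> \<bar>coeff (Q - P) k\<bar> < \<delta>" "\<bar>n\<bar> \<le> L" for Q n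
    using close [OF that] \<gamma>(2) by linarith
  show ?thesis by (rule that [OF \<delta> close1 fl])
qed

section \<open>Polynomials with rational coefficients\<close>

lemma common_denominator:
  fixes P :: "real poly"
  assumes "\<And>k. coeff P k \<in> \<rat>"
  obtains K :: nat where "K > 0" "\<And>k. coeff (smult (real K) P) k \<in> \<int>"
proof -
  have "\<exists>K::nat. K > 0 \<and> (\<forall>k. coeff (smult (real K) P) k \<in> \<int>)"
    using assms
  proof (induction P)
    case 0
    then show ?case by (intro exI [of _ 1]) auto
  next
    case (pCons a P)
    have "coeff P k \<in> \<rat>" for k using pCons.prems [of "Suc k"] by simp
    then obtain K :: nat where K: "K > 0" "\<And>k. coeff (smult (real K) P) k \<in> \<int>" using pCons.IH by blast
    have "a \<in> \<rat>" using pCons.prems [of 0] by simp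
    then obtain m n where a: "n \<noteq> 0" "a = of_int m / real n"
      by (metis Rats_cases' of_int_of_nat_eq pos_int_cases less_irrefl nat_neq_iff of_nat_0)
    have "coeff (smult (real (n * K)) (pCons a P)) k \<in> \<int>" for k
    proof (cases k)
      case 0
      have "real (n * K) * a = of_int (int K * m)" using a by simp
      then show ?thesis using 0 by (metis Ints_of_int coeff_pCons_0 coeff_smult)
    next
      case (Suc k')
      have "coeff (smult (real (n * K)) (pCons a P)) k = real n * coeff (smult (real K) P) k'" using Suc by simp
      then show ?thesis using K(2) by (metis Ints_mult Ints_of_nat)
    qed
    then show ?case using K(1) a(1) by (intro exI [of _ "n * K"]) auto
  qed
  then show ?thesis using that by blast
qed

lemma infinite_rational_values:
  fixes P :: "real poly"
  assumes "\<And>i. \<exists>n\<ge>i. poly P (real n) \<in> \<int>"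
  shows "coeff P k \<in> \<rat>"
proof -
  have "infinite {n. poly P (real n) \<in> \<int>}" using assms by (auto simp: infinite_nat_iff_unbounded_le)
  then obtain S where S: "S \<subseteq> {n. poly P (real n) \<in> \<int>}" "finite S" "card S = Suc (degree P)"
    using infinite_arbitrarily_large by blast
  show ?thesis
  proof (rule rational_coeffs)
    show "finite (real ` S)" "card (real ` S) > degree P" using S by (auto simp: card_image)
    show "real ` S \<subseteq> \<rat>" by auto
    show "poly P x \<in> \<rat>" if "x \<in> real ` S" for x using S(1) that Ints_subset_Rats by blast
  qed
qed

section \<open>Action of the induced map on vertical circles\<close>

context coded_nilsystem
begin

lemma rel_diff_low: "rel \<phi> P Q \<Longrightarrow> rel \<phi> P' Q' \<Longrightarrow> Q - Q' \<in> low d"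
  using rel_lifts lifts_diff by blast

text \<open>Constants are invariant under translation, so P and P + [:t:] stay close at all times,
  and so do their images. By \<open>expansive\<close> the images differ by a constant c. It is the
  same along an orbit, hence for all P by minimality and continuity.\<close>

lemma rel_vertical_small:
  assumes \<phi>: "aut \<phi>"
  obtains \<delta> where "\<delta> > 0" "\<And>t. \<bar>t\<bar> < \<delta> \<Longrightarrow> \<exists>c. \<bar>c\<bar> \<le> 1 / 4 \<and>
    (\<forall>P Q Q'. rel \<phi> P Q \<longrightarrow> rel \<phi> (P + [:t:]) Q' \<longrightarrow> Q' - Q - [:c:] \<in> integral_polys d)"
proof -
  \<comment> \<open>The constant of \<open>expansive\<close>. Being at most 1/8, it keeps c0 - c
    within 1/4, so that closeness modulo 1 is closeness.\<close>
  define \<epsilon> where "\<epsilon> = 1 / (4 * (real d + 1))"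
  have \<epsilon>: "\<epsilon> > 0" "\<epsilon> \<le> 1 / 8" using d_pos by (auto simp: \<epsilon>_def field_simps)
  obtain \<delta> where \<delta>: "\<delta> > 0" "\<And>P P' Q Q'. rel \<phi> P Q \<Longrightarrow> rel \<phi> P' Q' \<Longrightarrow> near d \<delta> P P' \<Longrightarrow> near d \<epsilon> Q Q'"
    by (rule rel_uniform [OF \<phi> \<epsilon>(1)]) (rule that)
  have "\<exists>c. \<bar>c\<bar> \<le> 1 / 4 \<and> (\<forall>P Q Q'. rel \<phi> P Q \<longrightarrow> rel \<phi> (P + [:t:]) Q' \<longrightarrow> Q' - Q - [:c:] \<in> integral_polys d)"
    if t: "\<bar>t\<bar> < \<delta>" for t
  proof -
    have loc: "\<exists>c. \<bar>c\<bar> < \<epsilon> \<and> Q' - Q - [:c:] \<in> integral_polys d" if r: "rel \<phi> P Q" "rel \<phi> (P + [:t:]) Q'" for P Q Q'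
    proof (rule expansive [OF d_pos])
      show "Q' - Q \<in> low d" using r rel_diff_low by blast
      show "near d \<epsilon> (translate i (Q' - Q)) 0" for i
      proof -
        have "near d \<delta> (translate i (P + [:t:])) (translate i P)"
          unfolding near_diff [of _ _ "translate i (P + [:t:])"]
          using near_const_iff [OF d_pos \<delta>(1), of t] t by (auto simp: translate_add intro: exI [of _ 0])
        then have "near d \<epsilon> (translate i Q') (translate i Q)" using \<delta>(2) rel_translate [OF \<phi>] r by blast
        then show ?thesis by (simp add: near_diff [of _ _ "translate i Q'"] translate_diff)
      qed
    qed (simp add: \<epsilon>_def)
    define P0 where "P0 = monom \<alpha> d"
    have P0: "P0 \<in> lifts d \<alpha>" by (simp add: P0_def)
    obtain Q0 where Q0: "rel \<phi> P0 Q0" using rel_total [OF \<phi> P0] .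
    obtain Q0' where Q0': "rel \<phi> (P0 + [:t:]) Q0'" using rel_total [OF \<phi> lifts_add_low [OF P0 low_const [OF d_pos]]] .
    obtain c0 where c0: "\<bar>c0\<bar> < \<epsilon>" "Q0' - Q0 - [:c0:] \<in> integral_polys d" using loc [OF Q0 Q0'] by blast
    have "Q' - Q - [:c0:] \<in> integral_polys d" if r: "rel \<phi> P Q" "rel \<phi> (P + [:t:]) Q'" for P Q Q'
    proof -
      obtain c where c: "\<bar>c\<bar> < \<epsilon>" "Q' - Q - [:c:] \<in> integral_polys d" using loc [OF r] by blast
      \<comment> \<open>Some iterate of P0 is close to P. It has displacement c0, and uniform
        continuity compares this with the displacement c at P.\<close>
      have small: "\<bar>c0 - c\<bar> < \<eta>" if "\<eta> > 0" "\<eta> \<le> 1 / 2" for \<eta>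
      proof -
        have "\<eta> / 2 > 0" using that by simp
        then obtain \<delta>' where \<delta>': "\<delta>' > 0" "\<And>P P' Q Q'. rel \<phi> P Q \<Longrightarrow> rel \<phi> P' Q' \<Longrightarrow> near d \<delta>' P P' \<Longrightarrow> near d (\<eta> / 2) Q Q'"
          using rel_uniform [OF \<phi>] by blast
        obtain n where n: "near d \<delta>' (translate (int n) P0) P"
          using minimal [OF d_pos irr P0 rel_lifts(1) [OF r(1)] \<delta>'(1)] by blast
        then have n': "near d \<delta>' (translate (int n) (P0 + [:t:])) (P + [:t:])"
          by (simp add: translate_add near_def)
        have "near d (\<eta> / 2) (translate (int n) Q0) Q" using \<delta>'(2) [OF rel_translate [OF \<phi> Q0] r(1) n] .
        moreover have "near d (\<eta> / 2) (translate (int n) Q0') Q'" using \<delta>'(2) [OF rel_translate [OF \<phi> Q0'] r(2) n'] .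
        ultimately have "near d (\<eta> / 2 + \<eta> / 2) (translate (int n) Q0' - translate (int n) Q0) (Q' - Q)"
          by (intro near_diff_mono)
        moreover have "translate (int n) Q0' - translate (int n) Q0 - [:c0:] \<in> integral_polys d"
          using integral_polys_translate [OF c0(2), of "int n"] by (simp add: translate_diff)
        ultimately have "near d \<eta> [:c0:] [:c:]"
          using near_cong c(2) by (metis field_sum_of_halves)
        then obtain z :: int where z: "\<bar>c0 - c - of_int z\<bar> < \<eta>"
          unfolding near_diff [of d \<eta> "[:c0:]"] using near_const_iff [OF d_pos \<open>\<eta> > 0\<close>, of "c0 - c"] by auto
        have "\<bar>of_int z :: real\<bar> < 1" using z c(1) c0(1) \<epsilon>(2) that(2) by linarith
        then have "z = 0" by (rule int_near_0)
        then show ?thesis using z by simp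
      qed
      have "c0 = c"
      proof (rule ccontr)
        assume "c0 \<noteq> c"
        then have "\<bar>c0 - c\<bar> < min (1 / 2) \<bar>c0 - c\<bar>" by (intro small min.cobounded1) auto
        then show False by simp
      qed
      then show ?thesis using c(2) by simp
    qed
    then show ?thesis using c0(1) \<epsilon>(2) by (intro exI [of _ c0]) auto
  qed
  then show ?thesis using that \<delta>(1) by blast
qed

text \<open>Small rotations give a bounded additive \<tau>, which is linear. Chains of small
  rotations extend the formula to all t, and since rotation by 1 is trivial on the torus, the slope
  is an integer.\<close>

lemma rel_vertical:
  assumes \<phi>: "aut \<phi>"
  obtains a :: int where "\<And>P Q Q' t. rel \<phi> P Q \<Longrightarrow> rel \<phi> (P + [:t:]) Q' \<Longrightarrow> Q' - Q - [:of_int a * t:] \<in> integral_polys d"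
proof -
  obtain \<delta> where \<delta>: "\<delta> > 0" "\<And>t. \<bar>t\<bar> < \<delta> \<Longrightarrow> \<exists>c. \<bar>c\<bar> \<le> 1 / 4 \<and>
    (\<forall>P Q Q'. rel \<phi> P Q \<longrightarrow> rel \<phi> (P + [:t:]) Q' \<longrightarrow> Q' - Q - [:c:] \<in> integral_polys d)"
    by (rule rel_vertical_small [OF \<phi>]) (rule that)
  then obtain \<tau> where \<tau>: "\<And>t. \<bar>t\<bar> < \<delta> \<Longrightarrow> \<bar>\<tau> t\<bar> \<le> 1 / 4"
    "\<And>t P Q Q'. \<bar>t\<bar> < \<delta> \<Longrightarrow> rel \<phi> P Q \<Longrightarrow> rel \<phi> (P + [:t:]) Q' \<Longrightarrow> Q' - Q - [:\<tau> t:] \<in> integral_polys d" by metis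
  define P0 where "P0 = monom \<alpha> d"
  have P0: "P0 + [:t:] \<in> lifts d \<alpha>" for t using low_const [OF d_pos] by (simp add: P0_def)
  have "\<exists>Q. rel \<phi> (P0 + [:t:]) Q" for t using rel_total [OF \<phi> P0] by blast
  then obtain q where q: "\<And>t. rel \<phi> (P0 + [:t:]) (q t)" by metis
  have q0: "rel \<phi> P0 (q 0)" using q [of 0] by simp
  have "\<tau> (s + t) = \<tau> s + \<tau> t" if "\<bar>s\<bar> < \<delta>" "\<bar>t\<bar> < \<delta>" "\<bar>s + t\<bar> < \<delta>" for s t
  proof -
    have 1: "q s - q 0 - [:\<tau> s:] \<in> integral_polys d" using \<tau>(2) [OF that(1) q0 q] .
    have 2: "q (s + t) - q s - [:\<tau> t:] \<in> integral_polys d" using \<tau>(2) [OF that(2) q [of s]] q [of "s + t"] by (simp add: add.assoc)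
    have 3: "q (s + t) - q 0 - [:\<tau> (s + t):] \<in> integral_polys d" using \<tau>(2) [OF that(3) q0 q] .
    have "[:\<tau> (s + t) - \<tau> s - \<tau> t:] = (q s - q 0 - [:\<tau> s:]) + (q (s + t) - q s - [:\<tau> t:]) - (q (s + t) - q 0 - [:\<tau> (s + t):])"
      by simp
    then have "[:\<tau> (s + t) - \<tau> s - \<tau> t:] \<in> integral_polys d" using integral_polys_diff [OF integral_polys_add [OF 1 2] 3] by (simp only:)
    then have "\<tau> (s + t) - \<tau> s - \<tau> t \<in> \<int>" using integral_const_iff d_pos by blast
    then obtain z where z: "\<tau> (s + t) - \<tau> s - \<tau> t = of_int z" unfolding Ints_def by blast
    \<comment> \<open>Three values of size at most 1/4 add up to at most 3/4, so additivity modulo 1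
      is additivity.\<close>
    have "\<bar>of_int z :: real\<bar> < 1" using z \<tau>(1) [OF that(1)] \<tau>(1) [OF that(2)] \<tau>(1) [OF that(3)] by linarith
    then have "z = 0" by (rule int_near_0)
    then show ?thesis using z by simp
  qed
  moreover have "\<bar>\<tau> t\<bar> \<le> 1" if "\<bar>t\<bar> < \<delta>" for t using \<tau>(1) [OF that] by linarith
  ultimately obtain a where a: "\<And>t. \<bar>t\<bar> < \<delta> / 2 \<Longrightarrow> \<tau> t = a * t"
    using locally_additive_linear [OF \<delta>(1), of \<tau>] by blast
  have lin: "Q' - Q - [:a * t:] \<in> integral_polys d" if r: "rel \<phi> P Q" "rel \<phi> (P + [:t:]) Q'" for P Q Q' t
  proof -
    obtain K :: nat where K: "2 * \<bar>t\<bar> / \<delta> < real K" using reals_Archimedean2 by blast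
    have K0: "real K > 0" using K \<delta>(1) by (smt (verit) divide_nonneg_pos)
    define h where "h = t / real K"
    have h: "\<bar>h\<bar> < \<delta> / 2" using K K0 \<delta>(1) by (simp add: h_def field_simps)
    have "Q' - Q - [:a * (real k * h):] \<in> integral_polys d" if "rel \<phi> (P + [:real k * h:]) Q'" for k Q'
      using that
    proof (induction k arbitrary: Q')
      case 0
      then have "rel \<phi> P Q'" by simp
      then show ?case using rel_unique [OF \<phi> _ r(1), of P Q'] by simp
    next
      case (Suc k)
      have "P + [:real k * h:] \<in> lifts d \<alpha>" using rel_lifts(1) [OF r(1)] low_const [OF d_pos] by simp
      then obtain S where S: "rel \<phi> (P + [:real k * h:]) S" using rel_total [OF \<phi>] by blast
      have e: "P + [:real k * h:] + [:h:] = P + [:real (Suc k) * h:]" by (simp add: algebra_simps)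
      have "rel \<phi> (P + [:real k * h:] + [:h:]) Q'" unfolding e by (rule Suc.prems)
      moreover have "\<bar>h\<bar> < \<delta>" using h \<delta>(1) by simp
      ultimately have "Q' - S - [:\<tau> h:] \<in> integral_polys d" using \<tau>(2) S by blast
      then have "(Q' - S - [:\<tau> h:]) + (S - Q - [:a * (real k * h):]) \<in> integral_polys d"
        using Suc.IH [OF S] integral_polys_add by blast
      moreover have "(Q' - S - [:\<tau> h:]) + (S - Q - [:a * (real k * h):]) = Q' - Q - [:a * (real (Suc k) * h):]"
        using a [OF h] by (simp add: algebra_simps)
      ultimately show ?case by simp
    qed
    from this [of K Q'] show ?thesis using r(2) K0 by (simp add: h_def)
  qed
  have "P0 + [:1:] - (P0 + [:0:]) \<in> integral_polys d" using integral_polys_const [OF d_pos] by simp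
  then have "q 1 - q 0 \<in> integral_polys d" using rel_unique [OF \<phi> q q] by blast
  moreover have "q 1 - q 0 - [:a * 1:] \<in> integral_polys d" using lin [OF q0 q] .
  ultimately have "(q 1 - q 0) - (q 1 - q 0 - [:a * 1:]) \<in> integral_polys d" by (rule integral_polys_diff)
  then have "a \<in> \<int>" using integral_const_iff [OF d_pos] by simp
  then obtain b where "a = of_int b" unfolding Ints_def by blast
  then show ?thesis using that lin by blast
qed

section \<open>Points on a hyperplane and their images\<close>

lemma same_word:
  assumes "P \<in> lifts d \<alpha>" "Q \<in> lifts d \<alpha>" "\<bar>i\<bar> \<le> L"
    "\<And>n. \<bar>n\<bar> \<le> L + int d \<Longrightarrow> \<lfloor>poly P (of_int n)\<rfloor> = \<lfloor>poly Q (of_int n)\<rfloor> \<and> (poly P (of_int n) \<in> \<int> \<longleftrightarrow> poly Q (of_int n) \<in> \<int>)"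
  shows "word P i = word Q i"
  unfolding word_def
proof (rule code_stratum)
  fix j assume "j \<le> d"
  then have "\<bar>int j + i\<bar> \<le> L + int d" using assms(3) by linarith
  from assms(4) [OF this] show "\<lfloor>poly (translate i P) (real j)\<rfloor> = \<lfloor>poly (translate i Q) (real j)\<rfloor> \<and>
      (poly (translate i P) (real j) \<in> \<int> \<longleftrightarrow> poly (translate i Q) (real j) \<in> \<int>)" by simp
qed (use assms in auto)

text \<open>The two sides of a hyperplane lie in different cells: the lifts to \<open>\<real>\<^sup>d\<close> of a single cell differ by integral
  polynomials of degree less than \<open>d\<close>, and such a polynomial cannot take the value 1 at 0 and vanish at \<open>1, \<dots>, d\<close>.\<close>

lemma code_sides_differ:
  assumes y: "y \<in> lifts d \<alpha>" "poly y 0 \<in> \<int>" "\<And>j. 1 \<le> j \<Longrightarrow> j \<le> d \<Longrightarrow> poly y (real j) \<notin> \<int>"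
  obtains \<delta> where "\<delta> > 0" "\<And>t. 0 < t \<Longrightarrow> t < \<delta> \<Longrightarrow> code (y + [:t:]) \<noteq> code (y - [:t:])"
proof -
  obtain \<delta> where \<delta>: "\<delta> > 0" and fl: "\<And>Q n. Q \<in> lifts d \<alpha> \<Longrightarrow> (\<And>k. k < d \<Longrightarrow> \<bar>coeff (Q - y) k\<bar> < \<delta>) \<Longrightarrow> \<bar>n\<bar> \<le> int d \<Longrightarrow> poly y (of_int n) \<notin> \<int> \<Longrightarrow>
      poly Q (of_int n) \<notin> \<int> \<and> \<lfloor>poly Q (of_int n)\<rfloor> = \<lfloor>poly y (of_int n)\<rfloor>"
    using floors_stable [OF y(1), of "int d"] by metis
  have "code (y + [:t:]) \<noteq> code (y - [:t:])" if t: "0 < t" "t < min \<delta> 1" for t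
  proof
    assume eq: "code (y + [:t:]) = code (y - [:t:])"
    define N' where "N' = N (code (y + [:t:]))"
    have yt: "y + [:t:] \<in> lifts d \<alpha>" "y - [:t:] \<in> lifts d \<alpha>" using y(1) low_const [OF d_pos] by auto
    obtain u where u: "u \<in> integral_polys d" "\<And>j. j \<le> d \<Longrightarrow> of_int (N' j) \<le> poly (y + [:t:] + u) (real j) \<and> poly (y + [:t:] + u) (real j) \<le> of_int (N' j) + 1"
      using code_cell [OF yt(1)] unfolding N'_def by blast
    obtain v where v: "v \<in> integral_polys d" "\<And>j. j \<le> d \<Longrightarrow> of_int (N' j) \<le> poly (y - [:t:] + v) (real j) \<and> poly (y - [:t:] + v) (real j) \<le> of_int (N' j) + 1"
      using code_cell [OF yt(2)] unfolding N'_def eq by blast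
    have c: "\<bar>coeff (y + [:t:] - y) k\<bar> < \<delta>" "\<bar>coeff (y - [:t:] - y) k\<bar> < \<delta>" for k
      using t by (auto simp: coeff_pCons split: nat.splits)
    have "poly u x = poly v x" if x: "x \<in> real ` {1..d}" for x
    proof -
      obtain j where j: "x = real j" "1 \<le> j" "j \<le> d" using x by auto
      have nz: "poly y (of_int (int j)) \<notin> \<int>" using y(3) [OF j(2,3)] by simp
      have jd: "\<bar>int j\<bar> \<le> int d" using j by simp
      have f1: "poly (y + [:t:]) (real j) \<notin> \<int>" "\<lfloor>poly (y + [:t:]) (real j)\<rfloor> = \<lfloor>poly y (real j)\<rfloor>"
        using fl [OF yt(1) c(1) jd nz] by auto
      have f2: "poly (y - [:t:]) (real j) \<notin> \<int>" "\<lfloor>poly (y - [:t:]) (real j)\<rfloor> = \<lfloor>poly y (real j)\<rfloor>"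
        using fl [OF yt(2) c(2) jd nz] by auto
      have "poly u (real j) \<in> \<int>" "poly v (real j) \<in> \<int>" using u(1) v(1) by (auto intro: poly_integral_polys)
      then obtain a b :: int where ab: "poly u (real j) = of_int a" "poly v (real j) = of_int b" unfolding Ints_def by blast
      have "\<lfloor>poly (y + [:t:]) (real j)\<rfloor> = N' j - a"
        using u(2) [OF j(3)] ab by (intro floor_eq_of_not_Ints f1) auto
      moreover have "\<lfloor>poly (y - [:t:]) (real j)\<rfloor> = N' j - b"
        using v(2) [OF j(3)] ab by (intro floor_eq_of_not_Ints f2) auto
      ultimately show ?thesis using f1(2) f2(2) ab j(1) by simp
    qed
    then have "u = v"
      by (intro low_eqI [of _ d _ "real ` {1..d}"]) (use u v in \<open>auto simp: integral_polys_low card_image\<close>)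
    have "poly u 0 \<in> \<int>" using u(1) by (auto intro: poly_integral_polys)
    then obtain a b :: int where ab: "poly u 0 = of_int a" "poly y 0 = of_int b" using y(2) unfolding Ints_def by blast
    \<comment> \<open>The integer b + a is the value of y + u at 0. The side y + t forces b + a
      \<le> N' 0, and the side y - t forces b + a > N' 0.\<close>
    have "of_int (b + a) + t \<le> of_int (N' 0) + 1" using u(2) [of 0] ab by simp
    then have "of_int (b + a) < (of_int (N' 0 + 1) :: real)" using t by simp
    then have "b + a \<le> N' 0" by (simp only: of_int_less_iff)
    then have "of_int (b + a) \<le> (of_int (N' 0) :: real)" by (simp only: of_int_le_iff)
    moreover have "of_int (N' 0) \<le> of_int (b + a) - t" using v(2) [of 0] ab \<open>u = v\<close> by simp
    ultimately show False using t by linarith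
  qed
  then show ?thesis using that [of "min \<delta> 1"] \<delta> by auto
qed

text \<open>Limits of words from the two sides of y are two words over y with different letters at
  0. The inverse block code yields a place j with \<bar>j\<bar> \<le> R at which their images
  differ. Both images lie over Q, so by \<open>over_eq_word\<close> Q lies on a hyperplane with
  index in j, ..., j + d.\<close>

lemma rel_singular:
  assumes \<phi>: "aut \<phi>"
  obtains R where "\<And>y Q. y \<in> lifts d \<alpha> \<Longrightarrow> poly y 0 \<in> \<int> \<Longrightarrow> (\<And>j. 1 \<le> j \<Longrightarrow> j \<le> d \<Longrightarrow> poly y (real j) \<notin> \<int>) \<Longrightarrow> rel \<phi> y Q \<Longrightarrow>
    \<exists>n::int. \<bar>n\<bar> \<le> R \<and> poly Q (of_int n) \<in> \<int>"
proof -
  obtain R where R: "\<And>w w'. w \<in> words \<Longrightarrow> w' \<in> words \<Longrightarrow> (\<And>j. \<bar>j\<bar> \<le> R \<Longrightarrow> \<phi> w j = \<phi> w' j) \<Longrightarrow> w 0 = w' 0"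
    using aut_block_inv [OF \<phi>] by blast
  have "\<exists>n::int. \<bar>n\<bar> \<le> R + int d \<and> poly Q (of_int n) \<in> \<int>"
    if y: "y \<in> lifts d \<alpha>" "poly y 0 \<in> \<int>" "\<And>j. 1 \<le> j \<Longrightarrow> j \<le> d \<Longrightarrow> poly y (real j) \<notin> \<int>" and Q: "rel \<phi> y Q" for y Q
  proof -
    obtain \<delta> where \<delta>: "\<delta> > 0" "\<And>t. 0 < t \<Longrightarrow> t < \<delta> \<Longrightarrow> code (y + [:t:]) \<noteq> code (y - [:t:])"
      using code_sides_differ [OF y] by blast
    \<comment> \<open>The shift by 2 keeps every t n strictly below \<delta>, including the first
      one.\<close>
    define t where "t n = \<delta> / real (n + 2)" for n
    have t: "0 < t n" "t n < \<delta>" for n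
    proof -
      show "0 < t n" using \<delta>(1) by (simp add: t_def)
      have "\<delta> / real (n + 2) < \<delta> / 1" using \<delta>(1) by (intro divide_strict_left_mono) auto
      then show "t n < \<delta>" by (simp add: t_def)
    qed
    have "t \<longlonglongrightarrow> 0" unfolding t_def
      using LIMSEQ_ignore_initial_segment [OF lim_const_over_n [of \<delta>], of 2] by simp
    define p where "p n = y + [:t n:]" for n
    define q where "q n = y - [:t n:]" for n
    have pq: "p n \<in> lifts d \<alpha>" "q n \<in> lifts d \<alpha>" for n using y(1) low_const [OF d_pos] by (auto simp: p_def q_def)
    have near: "\<forall>\<^sub>F n in sequentially. near d \<epsilon> (p n) y \<and> near d \<epsilon> (q n) y" if "\<epsilon> > 0" for \<epsilon>
      using order_tendstoD(2) [OF \<open>t \<longlonglongrightarrow> 0\<close> that]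
    proof eventually_elim
      case (elim n)
      have "near d \<epsilon> [:t n:] 0" "near d \<epsilon> [:- t n:] 0"
        unfolding near_const_iff [OF d_pos that] using elim t(1) [of n] by (auto intro: exI [of _ 0])
      then show ?case unfolding near_diff [of d \<epsilon> "p n"] near_diff [of d \<epsilon> "q n"] by (simp add: p_def q_def)
    qed
    obtain r v P1 where r: "strict_mono r" "v \<in> words" "over v P1" "\<And>\<epsilon>. \<epsilon> > 0 \<Longrightarrow> \<forall>\<^sub>F n in sequentially. near d \<epsilon> (p (r n)) P1"
      "\<And>L. \<forall>\<^sub>F n in sequentially. \<forall>i. \<bar>i\<bar> \<le> L \<longrightarrow> word (p (r n)) i = v i"
      by (rule over_compact [of "\<lambda>n. word (p n)" p, OF word_words [OF pq(1)] over_word [OF pq(1)]]) (rule that)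
    obtain r' v' P2 where r': "strict_mono r'" "v' \<in> words" "over v' P2"
      "\<And>\<epsilon>. \<epsilon> > 0 \<Longrightarrow> \<forall>\<^sub>F n in sequentially. near d \<epsilon> (q (r (r' n))) P2"
      "\<And>L. \<forall>\<^sub>F n in sequentially. \<forall>i. \<bar>i\<bar> \<le> L \<longrightarrow> word (q (r (r' n))) i = v' i"
      by (rule over_compact [of "\<lambda>n. word (q (r n))" "\<lambda>n. q (r n)", OF word_words [OF pq(2)] over_word [OF pq(2)]]) (rule that)
    have s: "strict_mono (\<lambda>n. r (r' n))" using r(1) r'(1) by (auto simp: strict_mono_def)
    have "P1 - y \<in> integral_polys d"
    proof (rule near_limit [of "\<lambda>n. p (r n)" P1 "\<lambda>_. y" y])
      show "\<forall>\<^sub>F n in sequentially. near d \<epsilon> y y" if "\<epsilon> > 0" for \<epsilon> using near_refl [OF that] by simp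
      show "\<forall>\<^sub>F n in sequentially. near d \<epsilon> (p (r n)) y" if "\<epsilon> > 0" for \<epsilon>
        using eventually_subseq [OF r(1) near [OF that]] by (rule eventually_mono) blast
    qed (use r y(1) in \<open>auto simp: over_def\<close>)
    then have v: "over v y" using r(3) over_cong by blast
    have "P2 - y \<in> integral_polys d"
    proof (rule near_limit [of "\<lambda>n. q (r (r' n))" P2 "\<lambda>_. y" y])
      show "\<forall>\<^sub>F n in sequentially. near d \<epsilon> y y" if "\<epsilon> > 0" for \<epsilon> using near_refl [OF that] by simp
      show "\<forall>\<^sub>F n in sequentially. near d \<epsilon> (q (r (r' n))) y" if "\<epsilon> > 0" for \<epsilon>
        using eventually_subseq [OF s near [OF that]] by (rule eventually_mono) blast
    qed (use r' y(1) in \<open>auto simp: over_def\<close>)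
    then have v': "over v' y" using r'(3) over_cong by blast
    have "\<forall>\<^sub>F n in sequentially. v 0 \<noteq> v' 0"
      using eventually_subseq [OF r'(1) r(5) [of 0]] r'(5) [of 0]
    proof eventually_elim
      case (elim n)
      have "code (p (r (r' n))) = v 0" "code (q (r (r' n))) = v' 0" using elim by (auto simp: word_def)
      then show ?case using \<delta>(2) [OF t] by (metis p_def q_def)
    qed
    then have "v 0 \<noteq> v' 0" by simp
    then obtain j where j: "\<bar>j\<bar> \<le> R" "\<phi> v j \<noteq> \<phi> v' j" using R [OF r(2) r'(2)] by blast
    have over: "over (\<phi> x) Q" if x: "x \<in> words" "over x y" for x
    proof -
      obtain S where S: "over (\<phi> x) S" using over_exists aut_words [OF \<phi> x(1)] by blast
      then have "rel \<phi> y S" using x unfolding rel_def by blast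
      then have "S - Q \<in> integral_polys d" using rel_unique [OF \<phi> _ Q] by simp
      then show ?thesis using S over_cong by blast
    qed
    have "\<exists>l\<le>d. poly Q (of_int (j + int l)) \<in> \<int>"
    proof (rule ccontr)
      assume "\<not> ?thesis"
      then have "\<phi> v j = word Q j" "\<phi> v' j = word Q j"
        using over_eq_word [OF aut_words [OF \<phi> r(2)] over [OF r(2) v], of j]
          over_eq_word [OF aut_words [OF \<phi> r'(2)] over [OF r'(2) v'], of j] by blast+
      then show False using j(2) by simp
    qed
    then obtain l where "l \<le> d" "poly Q (of_int (j + int l)) \<in> \<int>" by blast
    then show ?thesis using j(1) by (intro exI [of _ "j + int l"]) auto
  qed
  then show ?thesis using that by blast
qed

end

section \<open>A single index on an open piece of the hyperplane\<close>

lemma finite_closed_cover_interior: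
  assumes "finite I" "\<And>i. i \<in> I \<Longrightarrow> closed (F i)" "open S" "S \<noteq> {}" "S \<subseteq> (\<Union>i\<in>I. F i)"
  shows "\<exists>i\<in>I. interior (F i) \<noteq> {}"
proof (rule ccontr)
  assume no: "\<not> ?thesis"
  have "interior (\<Union>i\<in>I. F i) = {}"
    using assms(1,2) no
  proof (induction I)
    case (insert i I)
    then show ?case using interior_closed_Un_empty_interior [of "\<Union>i\<in>I. F i" "F i"]
      by (simp add: Un_commute closed_UN)
  qed simp
  then show False using interior_maximal [OF assms(5,3)] assms(4) by blast
qed

lemma open_contains_box:
  fixes O' :: "(nat \<Rightarrow> real) set"
  assumes "open O'" "x0 \<in> O'"
  obtains \<epsilon> where "\<epsilon> > 0" "\<And>x. (\<And>k. k < d \<Longrightarrow> \<bar>x k - x0 k\<bar> < \<epsilon>) \<Longrightarrow> (\<And>k. k \<ge> d \<Longrightarrow> x k = x0 k) \<Longrightarrow> x \<in> O'"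
proof -
  have "\<exists>\<epsilon>>0. \<forall>x. (\<forall>k<d. \<bar>x k - x0 k\<bar> < \<epsilon>) \<longrightarrow> (\<forall>k\<ge>d. x k = x0 k) \<longrightarrow> x \<in> O'"
  proof (rule ccontr)
    assume "\<not> ?thesis"
    then have "\<forall>i. \<exists>x. (\<forall>k<d. \<bar>x k - x0 k\<bar> < inverse (real (Suc i))) \<and> (\<forall>k\<ge>d. x k = x0 k) \<and> x \<notin> O'"
      by (meson inverse_positive_iff_positive of_nat_0_less_iff zero_less_Suc)
    then obtain x where x: "\<And>i k. k < d \<Longrightarrow> \<bar>x i k - x0 k\<bar> < inverse (real (Suc i))" "\<And>i k. k \<ge> d \<Longrightarrow> x i k = x0 k" "\<And>i. x i \<notin> O'"
      by metis
    have "x \<longlonglongrightarrow> x0" unfolding tendsto_fun_iff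
    proof
      fix k
      show "(\<lambda>i. x i k) \<longlonglongrightarrow> x0 k"
      proof (cases "k < d")
        case True
        have "(\<lambda>i. \<bar>x i k - x0 k\<bar>) \<longlonglongrightarrow> 0"
          using x(1) [OF True] by (intro tendsto_sandwich [OF _ _ tendsto_const LIMSEQ_inverse_real_of_nat]) (auto intro: less_imp_le always_eventually)
        then show ?thesis by (simp add: LIM_zero_iff tendsto_rabs_zero_iff)
      qed (simp add: x(2))
    qed
    from topological_tendstoD [OF this assms] have "\<forall>\<^sub>F i in sequentially. x i \<in> O'" .
    then show False using x(3) by simp
  qed
  then show ?thesis using that by blast
qed

context coded_nilsystem
begin

text \<open>The index given by \<open>rel_singular\<close> depends on the point but is bounded. The
  points for which a fixed index n works form a closed set, because the induced map is continuous.
  Finitely many such sets cover a nonempty open set, so one of them contains a box.\<close>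

lemma rel_singular_open:
  assumes \<phi>: "aut \<phi>"
  obtains n0 :: int and x0 :: "nat \<Rightarrow> real" and \<epsilon> :: real where "\<epsilon> > 0"
    "\<And>P Q. rel \<phi> P Q \<Longrightarrow> poly P 0 = 0 \<Longrightarrow> \<forall>k. 0 < k \<and> k < d \<longrightarrow> \<bar>coeff P k - x0 k\<bar> < \<epsilon> \<Longrightarrow> poly Q (of_int n0) \<in> \<int>"
proof -
  obtain R where R: "\<And>y Q. y \<in> lifts d \<alpha> \<Longrightarrow> poly y 0 \<in> \<int> \<Longrightarrow> (\<And>j. 1 \<le> j \<Longrightarrow> j \<le> d \<Longrightarrow> poly y (real j) \<notin> \<int>) \<Longrightarrow> rel \<phi> y Q \<Longrightarrow>
    \<exists>n::int. \<bar>n\<bar> \<le> R \<and> poly Q (of_int n) \<in> \<int>" using rel_singular [OF \<phi>] by blast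
  \<comment> \<open>Overwriting entry 0 parametrises the hyperplane of index 0 by sequences, so that
    interiors may be taken in the full sequence space.\<close>
  define p where "p x = lift_of d \<alpha> (x(0 := 0))" for x
  have p: "p x \<in> lifts d \<alpha>" "poly (p x) 0 = 0" for x using d_pos by (auto simp: p_def poly_0_coeff_0)
  have cp: "coeff (p x) k = (if k < d then (if k = 0 then 0 else x k) else if k = d then \<alpha> else 0)" for x k
    by (simp add: p_def)
  define F where "F n = {x. \<forall>Q. rel \<phi> (p x) Q \<longrightarrow> poly Q (of_int n) \<in> \<int>}" for n :: int
  have "closed (F n)" for n
    unfolding closed_sequential_limits
  proof (intro allI impI, elim conjE)
    fix f l assume f: "\<forall>i. f i \<in> F n" "f \<longlonglongrightarrow> l"
    have lim: "(\<lambda>i. coeff (p (f i)) k) \<longlonglongrightarrow> coeff (p l) k" for k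
      using f(2) unfolding tendsto_fun_iff by (simp add: cp)
    have "poly Q (of_int n) \<in> \<int>" if Q: "rel \<phi> (p l) Q" for Q
    proof -
      have "\<exists>y\<in>\<int>. dist y (poly Q (of_int n)) < \<eta>" if \<eta>: "\<eta> > 0" for \<eta>
      proof -
        obtain \<eta>1 where \<eta>1: "\<eta>1 > 0" "\<And>A B. A - B \<in> low d \<Longrightarrow> near d \<eta>1 A B \<Longrightarrow> near d \<eta> (translate n A) (translate n B)"
          using near_translate [OF \<eta>] by metis
        obtain \<delta> where \<delta>: "\<delta> > 0" "\<And>P P' Q Q'. rel \<phi> P Q \<Longrightarrow> rel \<phi> P' Q' \<Longrightarrow> near d \<delta> P P' \<Longrightarrow> near d \<eta>1 Q Q'"
          by (rule rel_uniform [OF \<phi> \<eta>1(1)]) (rule that)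
        obtain i where i: "near d \<delta> (p (f i)) (p l)"
          using eventually_happens [OF eventually_near [OF lim \<delta>(1), of d]] by auto
        obtain Qi where Qi: "rel \<phi> (p (f i)) Qi" using rel_total [OF \<phi> p(1)] by blast
        have "near d \<eta> (translate n Qi) (translate n Q)"
          using \<eta>1(2) rel_diff_low [OF Qi Q] \<delta>(2) [OF Qi Q i] by blast
        from near_0_coeff [OF this d_pos] obtain z :: int where z: "\<bar>poly Qi (of_int n) - poly Q (of_int n) - of_int z\<bar> < \<eta>" by auto
        have "poly Qi (of_int n) \<in> \<int>" using f(1) Qi by (auto simp: F_def)
        then show ?thesis using z by (intro bexI [of _ "poly Qi (of_int n) - of_int z"]) (auto simp: dist_real_def algebra_simps)
      qed
      then have "poly Q (of_int n) \<in> closure \<int>" unfolding closure_approachable by blast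
      then show ?thesis by (simp add: closed_Ints closure_closed)
    qed
    then show "l \<in> F n" by (simp add: F_def)
  qed
  moreover define S where "S = (\<Inter>j\<in>{1..d}. (\<lambda>x. poly (p x) (real j)) -` (- \<int>))"
  have "continuous_on UNIV (\<lambda>x. poly (p x) (real j))" for j
  proof -
    have "continuous_on UNIV (\<lambda>x::nat\<Rightarrow>real. coeff (p x) k)" for k
      unfolding cp by (cases "k = 0"; cases "k < d") auto
    moreover have "poly (p x) (real j) = (\<Sum>k\<le>d. coeff (p x) k * real j ^ k)" for x
      by (intro poly_eq_sum) (auto simp: cp)
    ultimately show ?thesis by (auto intro!: continuous_on_sum continuous_on_mult)
  qed
  then have "open S" unfolding S_def by (intro open_INT ballI open_vimage) (auto simp: closed_Ints open_Compl)
  moreover have "S \<noteq> {}"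
  proof -
    have "\<exists>Q\<in>lifts d \<alpha>. (\<forall>k<d. \<bar>coeff (Q - monom \<alpha> d) k\<bar> < 1) \<and> (\<forall>n. poly Q (of_int n) \<in> \<int> \<longleftrightarrow> n \<in> {0::int}) \<and>
       (\<forall>j\<in>{0::int}. poly Q (of_int j) = poly (monom \<alpha> d) (of_int j))"
      using d_pos by (intro generic_point irr) (auto simp: poly_monom power_0_left)
    then obtain Q where Q: "Q \<in> lifts d \<alpha>" "\<And>n::int. poly Q (of_int n) \<in> \<int> \<longleftrightarrow> n = 0" "poly Q 0 = 0"
      using d_pos by (auto simp: poly_monom)
    have "(coeff Q)(0 := 0) = coeff Q" using Q(3) by (simp add: poly_0_coeff_0 fun_upd_idem)
    then have "p (coeff Q) = Q" using Q(1) by (simp add: p_def lift_of_coeff)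
    then have "coeff Q \<in> S" using Q(2) [of "int j" for j] by (auto simp: S_def)
    then show ?thesis by blast
  qed
  moreover have "S \<subseteq> (\<Union>n\<in>{-R..R}. F n)"
  proof
    fix x assume x: "x \<in> S"
    obtain Q where Q: "rel \<phi> (p x) Q" using rel_total [OF \<phi> p(1)] by blast
    have "\<exists>n::int. \<bar>n\<bar> \<le> R \<and> poly Q (of_int n) \<in> \<int>"
      by (rule R [OF p(1) _ _ Q]) (use x p in \<open>auto simp: S_def\<close>)
    then obtain n :: int where n: "\<bar>n\<bar> \<le> R" "poly Q (of_int n) \<in> \<int>" by blast
    have "poly Q' (of_int n) \<in> \<int>" if Q': "rel \<phi> (p x) Q'" for Q'
    proof -
      have "Q' - Q \<in> integral_polys d" using rel_unique [OF \<phi> Q' Q] by simp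
      then have "poly (Q' - Q) (of_int n) \<in> \<int>" by (rule poly_integral_polys) simp
      then have "poly (Q' - Q) (of_int n) + poly Q (of_int n) \<in> \<int>" using n(2) by (rule Ints_add)
      then show ?thesis by simp
    qed
    then show "x \<in> (\<Union>n\<in>{-R..R}. F n)" using n(1) by (intro UN_I [of n]) (auto simp: F_def)
  qed
  ultimately have "\<exists>n\<in>{-R..R}. interior (F n) \<noteq> {}" by (intro finite_closed_cover_interior) auto
  then obtain n0 x0 where x0: "x0 \<in> interior (F n0)" by blast
  obtain \<epsilon> where \<epsilon>: "\<epsilon> > 0" "\<And>x. (\<And>k. k < d \<Longrightarrow> \<bar>x k - x0 k\<bar> < \<epsilon>) \<Longrightarrow> (\<And>k. k \<ge> d \<Longrightarrow> x k = x0 k) \<Longrightarrow> x \<in> interior (F n0)"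
    using open_contains_box [OF open_interior x0, of d] by metis
  show ?thesis
  proof (rule that [OF \<epsilon>(1)])
    fix P Q assume PQ: "rel \<phi> P Q" "poly P 0 = 0" "\<forall>k. 0 < k \<and> k < d \<longrightarrow> \<bar>coeff P k - x0 k\<bar> < \<epsilon>"
    define x where "x k = (if 0 < k \<and> k < d then coeff P k else x0 k)" for k
    have "x \<in> interior (F n0)" using PQ(3) \<epsilon>(1) by (intro \<epsilon>(2)) (auto simp: x_def)
    then have xF: "x \<in> F n0" using interior_subset by blast
    have "p x = lift_of d \<alpha> (coeff P)" by (rule poly_eqI) (use PQ(2) in \<open>auto simp: cp x_def poly_0_coeff_0\<close>)
    then have "p x = P" using lift_of_coeff rel_lifts(1) [OF PQ(1)] by simp
    then show "poly Q (of_int n0) \<in> \<int>" using xF PQ(1) by (simp add: F_def)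
  qed
qed

text \<open>The map induced on the torus is an iterate of \<open>T\<close> followed by a translation by one of the finitely many
  points that are fixed by the unipotent linear part and have first coordinate 0.\<close>

lemma rel_form:
  assumes \<phi>: "aut \<phi>"
  obtains n0 :: int and E where "E \<in> low d" "\<And>n::int. poly E (of_int n) \<in> \<int>"
    "\<And>P Q. rel \<phi> P Q \<Longrightarrow> translate n0 Q - P - E \<in> integral_polys d"
proof -
  obtain \<epsilon> x0 n0 where \<epsilon>: "\<epsilon> > 0" and sing:
    "\<And>P Q. rel \<phi> P Q \<Longrightarrow> poly P 0 = 0 \<Longrightarrow> \<forall>k. 0 < k \<and> k < d \<longrightarrow> \<bar>coeff P k - x0 k\<bar> < \<epsilon> \<Longrightarrow> poly Q (of_int n0) \<in> \<int>"
    by (rule rel_singular_open [OF \<phi>]) (rule that)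
  obtain a :: int where a: "\<And>P Q Q' t. rel \<phi> P Q \<Longrightarrow> rel \<phi> (P + [:t:]) Q' \<Longrightarrow> Q' - Q - [:of_int a * t:] \<in> integral_polys d"
    by (rule rel_vertical [OF \<phi>]) (rule that)
  define B where "B = lift_of d \<alpha> x0"
  have B: "B \<in> lifts d \<alpha>" by (simp add: B_def)
  \<comment> \<open>An integral polynomial and a vertical rotation by t move P onto the open piece
    of the hyperplane. By \<open>rel_vertical\<close> the rotation changes the image by a *
    t.\<close>
  have step1: "poly Q (of_int n0) - of_int a * poly P 0 \<in> \<int>" if PQ: "rel \<phi> P Q" "near d \<epsilon> P B" for P Q
  proof -
    obtain u where u: "u \<in> integral_polys d" "\<And>k. k < d \<Longrightarrow> \<bar>coeff (P - B - u) k\<bar> < \<epsilon>"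
      using PQ(2) unfolding near_def by blast
    define t where "t = poly (P - u) 0"
    define P1 where "P1 = P - u - [:t:]"
    have PL: "P \<in> lifts d \<alpha>" using rel_lifts(1) [OF PQ(1)] .
    have P1: "P1 \<in> lifts d \<alpha>" using PL u(1) integral_polys_low low_const [OF d_pos] by (simp add: P1_def)
    have "poly P1 0 = 0" by (simp add: P1_def t_def)
    obtain Q1 where Q1: "rel \<phi> P1 Q1" using rel_total [OF \<phi> P1] .
    have "poly Q1 (of_int n0) \<in> \<int>"
    proof (rule sing [OF Q1 \<open>poly P1 0 = 0\<close>], intro allI impI)
      fix k assume k: "0 < k \<and> k < d"
      then have "coeff P1 k - x0 k = coeff (P - B - u) k"
        by (auto simp: P1_def B_def coeff_pCons split: nat.splits)
      then show "\<bar>coeff P1 k - x0 k\<bar> < \<epsilon>" using u(2) [of k] k by simp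
    qed
    have "P1 + [:t:] = P - u" by (simp add: P1_def)
    moreover have "rel \<phi> (P - u) Q" using rel_cong [OF PQ(1), of "P - u" Q] u(1) by simp
    ultimately have "Q - Q1 - [:of_int a * t:] \<in> integral_polys d" using a [OF Q1, of t Q] by simp
    then have "poly (Q - Q1 - [:of_int a * t:]) (of_int n0) \<in> \<int>" by (rule poly_integral_polys) simp
    moreover have "poly u 0 \<in> \<int>" using u(1) by (rule poly_integral_polys) simp
    then have "of_int a * poly u 0 \<in> \<int>" by (intro Ints_mult) auto
    ultimately have "poly (Q - Q1 - [:of_int a * t:]) (of_int n0) + poly Q1 (of_int n0) - of_int a * poly u 0 \<in> \<int>"
      using \<open>poly Q1 (of_int n0) \<in> \<int>\<close> by (intro Ints_add Ints_diff)
    moreover have "poly (Q - Q1 - [:of_int a * t:]) (of_int n0) + poly Q1 (of_int n0) - of_int a * poly u 0 =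
      poly Q (of_int n0) - of_int a * poly P 0" by (simp add: t_def algebra_simps)
    ultimately show ?thesis by (simp only:)
  qed
  \<comment> \<open>By minimality the orbit of P returns to the box at arbitrarily late times n, and
    each return gives one integral value.\<close>
  have step2: "\<exists>n\<ge>i. poly (translate n0 Q - smult (of_int a) P) (real n) \<in> \<int>" if PQ: "rel \<phi> P Q" for P Q i
  proof -
    obtain n where n: "n \<ge> i" "near d \<epsilon> (translate (int n) P) B"
      using minimal [OF d_pos irr rel_lifts(1) [OF PQ] B \<epsilon>] by blast
    have "poly (translate (int n) Q) (of_int n0) - of_int a * poly (translate (int n) P) 0 \<in> \<int>"
      using step1 [OF rel_translate [OF \<phi> PQ] n(2)] .
    then show ?thesis using n(1) by (intro exI [of _ n]) (simp add: add.commute)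
  qed
  \<comment> \<open>The coefficient of index d of the polynomial in \<open>step2\<close> is (1 - a)
    * \<alpha>, which has to be rational.\<close>
  have a1: "a = 1"
  proof -
    obtain Q where Q: "rel \<phi> (monom \<alpha> d) Q" using rel_total [OF \<phi>] by (metis monom_lifts)
    have "coeff (translate n0 Q - smult (of_int a) (monom \<alpha> d)) d \<in> \<rat>"
      by (rule infinite_rational_values) (rule step2 [OF Q])
    moreover have "translate n0 Q \<in> lifts d \<alpha>" using rel_lifts(2) [OF Q] by simp
    ultimately have "(1 - of_int a) * \<alpha> \<in> \<rat>" by (simp add: lifts_def algebra_simps)
    moreover have "\<alpha> = ((1 - of_int a) * \<alpha>) / (1 - of_int a)" if "a \<noteq> 1" using that by simp
    ultimately show ?thesis using irr by (metis Rats_1 Rats_diff Rats_divide Rats_of_int)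
  qed
  \<comment> \<open>With a = 1 this is the polynomial of \<open>step2\<close>. It remains to see
    that its class modulo integral polynomials does not depend on P.\<close>
  define D where "D P Q = translate n0 Q - P" for P Q
  have D_low: "D P Q \<in> low d" if "rel \<phi> P Q" for P Q
    unfolding D_def using rel_lifts [OF that] by (intro lifts_diff [of _ d \<alpha>]) auto
  have D_cont: "\<exists>\<delta>>0. \<forall>P Q P' Q'. rel \<phi> P Q \<longrightarrow> rel \<phi> P' Q' \<longrightarrow> near d \<delta> P P' \<longrightarrow> near d \<eta> (D P Q) (D P' Q')" if \<eta>: "\<eta> > 0" for \<eta>
  proof -
    have "\<eta> / 2 > 0" using \<eta> by simp
    then obtain \<eta>1 where \<eta>1: "\<eta>1 > 0" "\<And>A B. A - B \<in> low d \<Longrightarrow> near d \<eta>1 A B \<Longrightarrow> near d (\<eta> / 2) (translate n0 A) (translate n0 B)"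
      using near_translate by metis
    obtain \<delta> where \<delta>: "\<delta> > 0" "\<And>P P' Q Q'. rel \<phi> P Q \<Longrightarrow> rel \<phi> P' Q' \<Longrightarrow> near d \<delta> P P' \<Longrightarrow> near d \<eta>1 Q Q'"
      by (rule rel_uniform [OF \<phi> \<eta>1(1)]) (rule that)
    have "near d \<eta> (D P Q) (D P' Q')" if *: "rel \<phi> P Q" "rel \<phi> P' Q'" "near d (min \<delta> (\<eta> / 2)) P P'" for P Q P' Q'
    proof -
      have "near d \<delta> P P'" "near d (\<eta> / 2) P P'" using *(3) near_mono by (metis min.cobounded1, metis min.cobounded2)
      moreover then have "near d (\<eta> / 2) (translate n0 Q) (translate n0 Q')"
        using \<eta>1(2) [OF rel_diff_low [OF *(1,2)]] \<delta>(2) *(1,2) by blast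
      ultimately have "near d (\<eta> / 2 + \<eta> / 2) (D P Q) (D P' Q')" unfolding D_def by (intro near_diff_mono)
      then show ?thesis by simp
    qed
    moreover have "min \<delta> (\<eta> / 2) > 0" using \<delta> \<eta> by simp
    ultimately show ?thesis by blast
  qed
  have D_translate: "D (translate n P) (translate n Q) = translate n (D P Q)" for n P Q
    by (simp add: D_def translate_diff add.commute)
  define P0 where "P0 = monom \<alpha> d"
  obtain Q0 where Q0: "rel \<phi> P0 Q0" using rel_total [OF \<phi> monom_lifts] unfolding P0_def by blast
  define E where "E = D P0 Q0"
  have E_step: "\<exists>n\<ge>i. poly E (real n) \<in> \<int>" for i using step2 [OF Q0, of i] by (simp add: a1 E_def D_def)
  then have "coeff E k \<in> \<rat>" for k by (rule infinite_rational_values)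
  then obtain K :: nat where K: "K > 0" "\<And>k. coeff (smult (real K) E) k \<in> \<int>" using common_denominator by blast
  have KE: "smult (real K) E \<in> integral_polys d" using D_low [OF Q0] K(2) by (simp add: integral_polys_def E_def)
  \<comment> \<open>The points of the torus annihilated by K form a closed set invariant under
    translation. It contains E, hence the displacements along the orbit of P0, hence all
    displacements by density.\<close>
  have KD: "smult (real K) (D P Q) \<in> integral_polys d" if PQ: "rel \<phi> P Q" for P Q
  proof -
    have "near d \<eta> (smult (real K) (D P Q)) 0" if \<eta>: "\<eta> > 0" for \<eta>
    proof -
      have "\<eta> / real K > 0" using \<eta> K(1) by simp
      then obtain \<delta> where \<delta>: "\<delta> > 0" "\<And>P Q P' Q'. rel \<phi> P Q \<Longrightarrow> rel \<phi> P' Q' \<Longrightarrow> near d \<delta> P P' \<Longrightarrow> near d (\<eta> / real K) (D P Q) (D P' Q')"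
        using D_cont by blast
      obtain n where n: "near d \<delta> (translate (int n) P0) P"
        using minimal [OF d_pos irr rel_lifts(1) [OF Q0] rel_lifts(1) [OF PQ] \<delta>(1)] by blast
      have "near d (\<eta> / real K) (translate (int n) E) (D P Q)"
        using \<delta>(2) [OF rel_translate [OF \<phi> Q0] PQ n] by (simp add: D_translate E_def)
      then obtain u where u: "u \<in> integral_polys d" "\<And>k. k < d \<Longrightarrow> \<bar>coeff (translate (int n) E - D P Q - u) k\<bar> < \<eta> / real K"
        unfolding near_def by blast
      define v where "v = translate (int n) (smult (real K) E) - smult (real K) u"
      have "smult (real K) u \<in> integral_polys d" using u(1) by (auto simp: integral_polys_def)
      then have v: "v \<in> integral_polys d" using KE unfolding v_def by (intro integral_polys_diff integral_polys_translate)
      have "\<bar>coeff (smult (real K) (D P Q) - 0 - v) k\<bar> < \<eta>" if "k < d" for k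
      proof -
        have "smult (real K) (D P Q) - 0 - v = smult (- real K) (translate (int n) E - D P Q - u)"
          by (simp add: v_def translate_smult smult_diff_right)
        then have "\<bar>coeff (smult (real K) (D P Q) - 0 - v) k\<bar> = real K * \<bar>coeff (translate (int n) E - D P Q - u) k\<bar>"
          by (simp add: abs_mult)
        also have "\<dots> < real K * (\<eta> / real K)" using u(2) [OF that] K(1) by (intro mult_strict_left_mono) auto
        finally show ?thesis using K(1) by simp
      qed
      then show ?thesis using v unfolding near_def by blast
    qed
    then have "smult (real K) (D P Q) - 0 \<in> integral_polys d"
      using D_low [OF PQ] by (intro near_all_imp_integral) auto
    then show ?thesis by simp
  qed
  have "1 / real K > 0" using K(1) by simp
  then obtain \<delta> where \<delta>: "\<delta> > 0" "\<And>P Q P' Q'. rel \<phi> P Q \<Longrightarrow> rel \<phi> P' Q' \<Longrightarrow> near d \<delta> P P' \<Longrightarrow> near d (1 / real K) (D P Q) (D P' Q')"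
    using D_cont by blast
  \<comment> \<open>Distinct points annihilated by K are at least 1/K apart, so the continuous
    displacement is locally constant.\<close>
  have loc: "D P Q - D P' Q' \<in> integral_polys d" if *: "rel \<phi> P Q" "rel \<phi> P' Q'" "near d \<delta> P P'" for P Q P' Q'
  proof -
    obtain u where u: "u \<in> integral_polys d" "\<And>k. k < d \<Longrightarrow> \<bar>coeff (D P Q - D P' Q' - u) k\<bar> < 1 / real K"
      using \<delta>(2) [OF *] unfolding near_def by blast
    define V where "V = D P Q - D P' Q' - u"
    have V: "V \<in> low d" using D_low *(1,2) u(1) integral_polys_low by (simp add: V_def)
    have "smult (real K) u \<in> integral_polys d" using u(1) by (auto simp: integral_polys_def)
    moreover have "smult (real K) V = smult (real K) (D P Q) - smult (real K) (D P' Q') - smult (real K) u"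
      by (simp add: V_def smult_diff_right)
    ultimately have KV: "smult (real K) V \<in> integral_polys d"
      using KD [OF *(1)] KD [OF *(2)] by (simp add: integral_polys_diff)
    have "coeff V k = 0" for k
    proof (cases "k < d")
      case True
      obtain z where z: "real K * coeff V k = of_int z" using KV unfolding integral_polys_def Ints_def by auto
      have "\<bar>of_int z :: real\<bar> = real K * \<bar>coeff V k\<bar>" unfolding z [symmetric] by (simp add: abs_mult)
      also have "\<dots> < real K * (1 / real K)" using u(2) [OF True] K(1) unfolding V_def by (intro mult_strict_left_mono) auto
      finally have "z = 0" using K(1) by (intro int_near_0) simp
      then show ?thesis using z K(1) by simp
    qed (use V in \<open>simp add: low_def\<close>)
    then have "V = 0" by (simp add: poly_eq_iff)
    then have "D P Q - D P' Q' = u" by (simp add: V_def)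
    then show ?thesis using u(1) by simp
  qed
  \<comment> \<open>Connectedness of the torus, in the form of L steps below \<delta> along the
    segment from P0 to P.\<close>
  have DE: "D P Q - E \<in> integral_polys d" if PQ: "rel \<phi> P Q" for P Q
  proof -
    define W where "W = P - P0"
    have W: "W \<in> low d" unfolding W_def using rel_lifts(1) PQ Q0 by (intro lifts_diff) auto
    define M where "M = (\<Sum>k<d. \<bar>coeff W k\<bar>)"
    have M: "\<bar>coeff W k\<bar> \<le> M" if "k < d" for k unfolding M_def
      using that by (intro member_le_sum [of k "{..<d}" "\<lambda>k. \<bar>coeff W k\<bar>"]) auto
    obtain L :: nat where L: "M / \<delta> < real L" using reals_Archimedean2 by blast
    have M0: "M \<ge> 0" unfolding M_def by (intro sum_nonneg) auto
    have L0: "real L > 0" using L M0 \<delta>(1) by (smt (verit) divide_nonneg_pos)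
    define p where "p l = P0 + smult (real l / real L) W" for l
    have pl: "p l \<in> lifts d \<alpha>" for l using W by (simp add: p_def P0_def)
    have near: "near d \<delta> (p (Suc l)) (p l)" for l
    proof -
      have "p (Suc l) - p l = smult (real (Suc l) / real L - real l / real L) W"
        by (simp add: p_def smult_diff_left)
      also have "real (Suc l) / real L - real l / real L = 1 / real L" by (simp add: diff_divide_distrib [symmetric])
      finally have e: "p (Suc l) - p l = smult (1 / real L) W" .
      have "\<bar>coeff (p (Suc l) - p l - 0) k\<bar> < \<delta>" if "k < d" for k
      proof -
        have "\<bar>coeff (p (Suc l) - p l - 0) k\<bar> = \<bar>coeff W k\<bar> / real L" unfolding e by simp
        also have "\<dots> \<le> M / real L" using M [OF that] by (intro divide_right_mono) auto
        also have "\<dots> < \<delta>" using L L0 \<delta>(1) by (simp add: field_simps)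
        finally show ?thesis .
      qed
      then show ?thesis unfolding near_def by (intro bexI [of _ 0]) auto
    qed
    have "D (p l) Q - E \<in> integral_polys d" if "rel \<phi> (p l) Q" for l Q
      using that
    proof (induction l arbitrary: Q)
      case 0
      then have "rel \<phi> P0 Q" by (simp add: p_def)
      then have "Q - Q0 \<in> integral_polys d" using rel_unique [OF \<phi> _ Q0] by simp
      then have "translate n0 (Q - Q0) \<in> integral_polys d" by simp
      then show ?case by (simp add: D_def E_def p_def translate_diff)
    next
      case (Suc l)
      obtain S where S: "rel \<phi> (p l) S" using rel_total [OF \<phi> pl] by blast
      show ?case using integral_polys_trans [OF loc [OF Suc.prems S near] Suc.IH [OF S]] .
    qed
    moreover have "p L = P" using L0 by (simp add: p_def W_def)
    ultimately show ?thesis using PQ by metis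
  qed
  \<comment> \<open>P0 and its translate have the same displacement, so E is invariant modulo
    integral polynomials. Hence its values at the integers are congruent modulo 1, and
    \<open>E_step\<close> provides an integral one.\<close>
  have inv: "translate 1 E - E \<in> integral_polys d"
    using DE [OF rel_translate [OF \<phi> Q0, of 1]] by (simp add: D_translate E_def)
  have shift: "poly E (of_int n + 1) - poly E (of_int n) \<in> \<int>" for n :: int
    using poly_integral_polys [OF inv, of "of_int n"] by simp
  obtain n1 where n1: "poly E (real n1) \<in> \<int>" using E_step by blast
  have "poly E (of_int n) \<in> \<int>" for n :: int
  proof (induction n rule: int_induct [of _ "int n1"])
    case base then show ?case using n1 by simp
  next
    case (step1 n)
    then show ?case using Ints_add [OF shift [of n]] by simp
  next
    case (step2 n)
    then show ?case using Ints_diff [OF _ shift [of "n - 1"], of "poly E (of_int n)"] by simp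
  qed
  moreover have "E \<in> low d" unfolding E_def using D_low [OF Q0] .
  ultimately show ?thesis using that [of E n0] DE unfolding D_def by blast
qed

text \<open>An automorphism over the identity fixes the words of generic points; climbing the strata of the arrangement,
  the word of a point is the only element of its fibre that is not a limit of words from larger strata.\<close>

lemma aut_over_identity:
  assumes \<phi>: "aut \<phi>" and id: "\<And>P. P \<in> lifts d \<alpha> \<Longrightarrow> rel \<phi> P P" and "w \<in> words"
  shows "\<phi> w = w"
proof -
  obtain R where R: "\<And>w w' i. w \<in> words \<Longrightarrow> w' \<in> words \<Longrightarrow> (\<And>j. \<bar>j\<bar> \<le> R \<Longrightarrow> w (i + j) = w' (i + j)) \<Longrightarrow> \<phi> w i = \<phi> w' i"
    using aut_block [OF \<phi>] by blast
  have fixed: "\<phi> (word P) = word P" if "P \<in> lifts d \<alpha>" for P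
    using that
  \<comment> \<open>The cardinality counts the hyperplanes met along the whole orbit. For
    cardinality 0 the same argument applies, since \<open>J'\<close> is then equal to J.\<close>
  proof (induction "card {n::int. poly P (of_int n) \<in> \<int>}" arbitrary: P rule: less_induct)
    case less
    define J where "J = {n::int. poly P (of_int n) \<in> \<int>}"
    have J: "finite J" "card J \<le> d" using integral_points [OF less.prems irr] by (auto simp: J_def)
    define v where "v = \<phi> (word P)"
    have v: "v \<in> words" unfolding v_def using aut_words [OF \<phi>] word_words less.prems by blast
    obtain Q where "over v Q" using over_exists [OF v] .
    moreover then have "rel \<phi> P Q" using word_words over_word less.prems unfolding rel_def v_def by blast
    then have "Q - P \<in> integral_polys d" using rel_unique [OF \<phi> _ id [OF less.prems]] by simp
    ultimately have vP: "over v P" using over_cong by blast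
    show ?case
    proof (rule ccontr)
      assume "\<phi> (word P) \<noteq> word P"
      then obtain i1 where i1: "v i1 \<noteq> word P i1" by (auto simp: v_def fun_eq_iff)
      \<comment> \<open>As v differs from \<open>word P\<close>, it agrees on every large window
        with the word of some x on fewer hyperplanes. Such words are fixed by induction, hence so is
        v. But v = \<phi> (word P), so injectivity yields v = \<open>word P\<close>.\<close>
      have "\<phi> v i = v i" for i
      proof -
        \<comment> \<open>The window contains the block that determines the letter at i as well as
          the place i1 at which v and \<open>word P\<close> differ.\<close>
        define L where "L = \<bar>i\<bar> + \<bar>R\<bar> + \<bar>i1\<bar>"
        obtain \<delta> where \<delta>: "\<delta> > 0"
          "\<And>Q n. Q \<in> lifts d \<alpha> \<Longrightarrow> (\<And>k. k < d \<Longrightarrow> \<bar>coeff (Q - P) k\<bar> < \<delta>) \<Longrightarrow> \<bar>n\<bar> \<le> L + int d \<Longrightarrow> \<bar>poly Q (of_int n) - poly P (of_int n)\<bar> < 1"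
          "\<And>Q n. Q \<in> lifts d \<alpha> \<Longrightarrow> (\<And>k. k < d \<Longrightarrow> \<bar>coeff (Q - P) k\<bar> < \<delta>) \<Longrightarrow> \<bar>n\<bar> \<le> L + int d \<Longrightarrow> poly P (of_int n) \<notin> \<int> \<Longrightarrow>
            poly Q (of_int n) \<notin> \<int> \<and> \<lfloor>poly Q (of_int n)\<rfloor> = \<lfloor>poly P (of_int n)\<rfloor>"
          using floors_stable [OF less.prems, of "L + int d"] by metis
        obtain L' where L': "\<And>w w' P P'. w \<in> words \<Longrightarrow> w' \<in> words \<Longrightarrow> over w P \<Longrightarrow> over w' P' \<Longrightarrow> (\<And>i. \<bar>i\<bar> \<le> L' \<Longrightarrow> w i = w' i) \<Longrightarrow> near d \<delta> P P'"
          using base_point_uniform [OF \<delta>(1)] by metis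
        obtain y where y: "y \<in> lifts d \<alpha>" "\<And>i. \<bar>i\<bar> \<le> max L L' \<Longrightarrow> v i = word y i"
          using v unfolding words_def by blast
        have "near d \<delta> y P" using y by (intro L' [OF word_words v over_word vP]) auto
        then obtain u where u: "u \<in> integral_polys d" "\<And>k. k < d \<Longrightarrow> \<bar>coeff (y - P - u) k\<bar> < \<delta>"
          unfolding near_def by blast
        define z where "z = y - u"
        have z: "z \<in> lifts d \<alpha>" using y(1) u(1) integral_polys_low by (simp add: z_def)
        have "word y j = word z j" for j
        proof -
          have "translate j y = translate j z + translate j u" by (simp add: z_def translate_diff)
          then show ?thesis using code_cong [of "translate j z" "translate j u"] z u(1) by (simp add: word_def)
        qed
        then have zv: "v j = word z j" if "\<bar>j\<bar> \<le> L" for j using y(2) that by simp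
        have zc: "\<And>k. k < d \<Longrightarrow> \<bar>coeff (z - P) k\<bar> < \<delta>" using u(2) by (simp add: z_def algebra_simps)
        \<comment> \<open>Being close to P, z meets only hyperplanes of J in the window. If it met
          all of them, z and P would have the same letter at i1.\<close>
        define J' where "J' = {n. \<bar>n\<bar> \<le> L + int d \<and> poly z (of_int n) \<in> \<int>}"
        have sub: "J' \<subseteq> J" using \<delta>(3) [OF z zc] by (auto simp: J'_def J_def)
        have "J' \<noteq> J"
        proof
          assume eq: "J' = J"
          have "word z i1 = word P i1"
          proof (rule same_word [OF z less.prems])
            show "\<bar>i1\<bar> \<le> L" by (simp add: L_def)
            fix n :: int assume n: "\<bar>n\<bar> \<le> L + int d"
            show "\<lfloor>poly z (of_int n)\<rfloor> = \<lfloor>poly P (of_int n)\<rfloor> \<and> (poly z (of_int n) \<in> \<int> \<longleftrightarrow> poly P (of_int n) \<in> \<int>)"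
            proof (cases "n \<in> J")
              case True
              then have "poly z (of_int n) \<in> \<int>" "poly P (of_int n) \<in> \<int>" using eq by (auto simp: J_def J'_def)
              moreover then obtain a b :: int where "poly z (of_int n) = of_int a" "poly P (of_int n) = of_int b" unfolding Ints_def by blast
              moreover then have "\<bar>of_int (a - b) :: real\<bar> < 1" using \<delta>(2) [OF z zc n] by simp
              then have "a - b = 0" by (rule int_near_0)
              ultimately show ?thesis by simp
            next
              case False
              then have "poly P (of_int n) \<notin> \<int>" by (simp add: J_def)
              then show ?thesis using \<delta>(3) [OF z zc n] by blast
            qed
          qed
          moreover have "v i1 = word z i1" by (rule zv) (simp add: L_def)
          ultimately show False using i1 by simp
        qed
        then have card: "card J' < card J" using sub J(1) by (intro psubset_card_mono) auto
        obtain \<eta> where \<eta>: "\<eta> > 0"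
          "\<And>Q n. Q \<in> lifts d \<alpha> \<Longrightarrow> (\<And>k. k < d \<Longrightarrow> \<bar>coeff (Q - z) k\<bar> < \<eta>) \<Longrightarrow> \<bar>n\<bar> \<le> L + int d \<Longrightarrow> \<bar>poly Q (of_int n) - poly z (of_int n)\<bar> < 1"
          "\<And>Q n. Q \<in> lifts d \<alpha> \<Longrightarrow> (\<And>k. k < d \<Longrightarrow> \<bar>coeff (Q - z) k\<bar> < \<eta>) \<Longrightarrow> \<bar>n\<bar> \<le> L + int d \<Longrightarrow> poly z (of_int n) \<notin> \<int> \<Longrightarrow>
            poly Q (of_int n) \<notin> \<int> \<and> \<lfloor>poly Q (of_int n)\<rfloor> = \<lfloor>poly z (of_int n)\<rfloor>"
          using floors_stable [OF z, of "L + int d"] by metis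
        \<comment> \<open>Outside the window z may have further integral values. A perturbation
          inside the strata seen in the window removes them, so that the induction hypothesis
          applies to x.\<close>
        have "\<exists>Q\<in>lifts d \<alpha>. (\<forall>k<d. \<bar>coeff (Q - z) k\<bar> < \<eta>) \<and> (\<forall>n. poly Q (of_int n) \<in> \<int> \<longleftrightarrow> n \<in> J') \<and>
           (\<forall>j\<in>J'. poly Q (of_int j) = poly z (of_int j))"
          using card J finite_subset [OF sub J(1)] \<eta>(1) by (intro generic_point d_pos irr z) (auto simp: J'_def)
        then obtain x where x: "x \<in> lifts d \<alpha>" "\<And>k. k < d \<Longrightarrow> \<bar>coeff (x - z) k\<bar> < \<eta>"
          "\<And>n. poly x (of_int n) \<in> \<int> \<longleftrightarrow> n \<in> J'" "\<And>j. j \<in> J' \<Longrightarrow> poly x (of_int j) = poly z (of_int j)" by blast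
        have "{n::int. poly x (of_int n) \<in> \<int>} = J'" using x(3) by blast
        then have x_fixed: "\<phi> (word x) = word x" using less.hyps [of x] card x(1) by (simp add: J_def)
        have xz: "word x j = word z j" if "\<bar>j\<bar> \<le> L" for j
        proof (rule same_word [OF x(1) z that])
          fix n :: int assume n: "\<bar>n\<bar> \<le> L + int d"
          show "\<lfloor>poly x (of_int n)\<rfloor> = \<lfloor>poly z (of_int n)\<rfloor> \<and> (poly x (of_int n) \<in> \<int> \<longleftrightarrow> poly z (of_int n) \<in> \<int>)"
          proof (cases "n \<in> J'")
            case True then show ?thesis using x(4) by simp
          next
            case False
            then have "poly z (of_int n) \<notin> \<int>" using n by (simp add: J'_def)
            then show ?thesis using \<eta>(3) [OF x(1,2) n] by blast
          qed
        qed
        have "\<phi> v i = \<phi> (word x) i"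
        proof (rule R [OF v word_words [OF x(1)]])
          fix j assume "\<bar>j\<bar> \<le> R"
          then have "\<bar>i + j\<bar> \<le> L" by (simp add: L_def)
          then show "v (i + j) = word x (i + j)" using zv xz by simp
        qed
        also have "\<dots> = word x i" by (simp add: x_fixed)
        also have "\<dots> = v i" using zv [of i] xz [of i] by (simp add: L_def)
        finally show ?thesis .
      qed
      then have "\<phi> v = \<phi> (word P)" by (auto simp: v_def)
      then have "v = word P" using \<phi> v word_words [OF less.prems] unfolding aut_def bij_betw_def inj_on_def by blast
      then show False using i1 by simp
    qed
  qed
  show ?thesis
  proof
    fix i
    obtain P where P: "P \<in> lifts d \<alpha>" "\<And>j. \<bar>j\<bar> \<le> \<bar>i\<bar> + \<bar>R\<bar> \<Longrightarrow> w j = word P j"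
      using \<open>w \<in> words\<close> unfolding words_def by blast
    have "\<phi> w i = \<phi> (word P) i" by (rule R [OF \<open>w \<in> words\<close> word_words [OF P(1)]]) (use P(2) in auto)
    then show "\<phi> w i = w i" using fixed [OF P(1)] P(2) [of i] by simp
  qed
qed

end

section \<open>The torus, its faces and its cells\<close>

definition proj :: "nat \<Rightarrow> real poly \<Rightarrow> nat \<Rightarrow> circle"
  where "proj d P = torus_proj d (coeff P)"

lemma to_circle_rep [simp]: "to_circle (circle_rep c) = c"
  by (metis Quotient_abs_rep Quotient_circle)

lemma topspace_torus [simp]: "topspace (torus d) = ({..<d} \<rightarrow>\<^sub>E UNIV)"
  by (simp add: torus_def)

lemma proj_torus [simp]: "proj d P \<in> {..<d} \<rightarrow>\<^sub>E UNIV"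
  by (auto simp: proj_def torus_proj_def)

lemma torus_lift:
  assumes "z \<in> {..<d} \<rightarrow>\<^sub>E UNIV"
  obtains P where "P \<in> lifts d \<alpha>" "proj d P = z"
proof
  show "lift_of d \<alpha> (\<lambda>k. circle_rep (z k)) \<in> lifts d \<alpha>" by simp
  show "proj d (lift_of d \<alpha> (\<lambda>k. circle_rep (z k))) = z"
    using assms by (auto simp: proj_def torus_proj_def restrict_def PiE_def extensional_def fun_eq_iff)
qed

lemma proj_eq_iff:
  assumes "P \<in> lifts d \<alpha>" "Q \<in> lifts d \<alpha>"
  shows "proj d P = proj d Q \<longleftrightarrow> P - Q \<in> integral_polys d"
proof
  assume eq: "proj d P = proj d Q"
  have "coeff (P - Q) k \<in> \<int>" for k
  proof (cases "k < d")
    case True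
    then show ?thesis using fun_cong [OF eq, of k] by (simp add: proj_def torus_proj_def to_circle_eq_iff)
  next
    case False
    then show ?thesis using lifts_diff [OF assms] by (simp add: low_def)
  qed
  then show "P - Q \<in> integral_polys d" using lifts_diff [OF assms] by (simp add: integral_polys_def)
next
  assume "P - Q \<in> integral_polys d"
  then show "proj d P = proj d Q"
    by (auto simp: integral_polys_def proj_def torus_proj_def to_circle_eq_iff fun_eq_iff)
qed

lemma proj_translate_1:
  assumes "P \<in> lifts d \<alpha>" shows "nil_map d \<alpha> (proj d P) = proj d (translate 1 P)"
  unfolding proj_def nil_map_torus_proj
  unfolding torus_proj_def
proof (rule restrict_ext)
  fix i assume i: "i \<in> {..<d}"
  have "coeff (translate 1 P) i = (\<Sum>j=i..d. real (j choose i) * coeff P j)"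
    using assms by (subst coeff_translate [of d]) (auto simp: lifts_def)
  also have "\<dots> = (\<Sum>j\<le>d. real (j choose i) * coeff P j)"
    by (rule sum.mono_neutral_left) auto
  also have "\<dots> = (\<Sum>j<d. real (j choose i) * coeff P j) + real (d choose i) * \<alpha>"
    using assms by (simp add: lifts_def flip: lessThan_Suc_atMost)
  finally show "to_circle ((\<Sum>j<d. real (j choose i) * coeff P j) + real (d choose i) * \<alpha>) = to_circle (coeff (translate 1 P) i)"
    by simp
qed

lemma proj_translate_nat:
  assumes "P \<in> lifts d \<alpha>" shows "(nil_map d \<alpha> ^^ n) (proj d P) = proj d (translate (int n) P)"
proof (induction n)
  case (Suc n)
  then show ?case using proj_translate_1 [of "translate (int n) P" d \<alpha>] assms by (simp add: add.commute)
qed simp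

text \<open>For negative i the set is a forward image. On lifts T is translation by 1 and thus
  invertible, so both signs take the same form.\<close>

lemma proj_nil_preimage:
  assumes P: "P \<in> lifts d \<alpha>" and V: "V \<subseteq> topspace (torus d)"
  shows "proj d P \<in> nil_preimage d \<alpha> i V \<longleftrightarrow> proj d (translate i P) \<in> V"
proof (cases "0 \<le> i")
  case True
  then show ?thesis using proj_translate_nat [OF P, of "nat i"] by (simp add: nil_preimage_def)
next
  case False
  show ?thesis
  proof
    assume "proj d P \<in> nil_preimage d \<alpha> i V"
    then obtain z where z: "z \<in> V" "proj d P = (nil_map d \<alpha> ^^ nat (- i)) z"
      using False by (auto simp: nil_preimage_def)
    have "z \<in> {..<d} \<rightarrow>\<^sub>E UNIV" using z(1) V by auto
    then obtain R where R: "R \<in> lifts d \<alpha>" "proj d R = z" by (rule torus_lift)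
    have "proj d P = proj d (translate (- i) R)" using z(2) proj_translate_nat [OF R(1), of "nat (- i)"] R(2) False by simp
    then have "P - translate (- i) R \<in> integral_polys d" using proj_eq_iff [of P d \<alpha>] P R(1) by simp
    then have "translate i (P - translate (- i) R) \<in> integral_polys d" by simp
    then have "translate i P - R \<in> integral_polys d" by (simp add: translate_diff)
    then have "proj d (translate i P) = proj d R" using proj_eq_iff [of "translate i P" d \<alpha> R] P R(1) by simp
    then show "proj d (translate i P) \<in> V" using R(2) z(1) by simp
  next
    assume *: "proj d (translate i P) \<in> V"
    have "(nil_map d \<alpha> ^^ nat (- i)) (proj d (translate i P)) = proj d P"
      using proj_translate_nat [of "translate i P" d \<alpha> "nat (- i)"] P False by simp
    then show "proj d P \<in> nil_preimage d \<alpha> i V"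
      using * False by (auto simp: nil_preimage_def image_iff intro!: bexI [of _ "proj d (translate i P)"])
  qed
qed

lemma poly_lift_of: "poly (lift_of d \<alpha> x) c = (\<Sum>k<d. c ^ k * x k) + c ^ d * \<alpha>"
proof -
  have "poly (lift_of d \<alpha> x) c = (\<Sum>k\<le>d. coeff (lift_of d \<alpha> x) k * c ^ k)" by (rule poly_eq_sum) auto
  also have "\<dots> = (\<Sum>k<d. coeff (lift_of d \<alpha> x) k * c ^ k) + \<alpha> * c ^ d" by (simp flip: lessThan_Suc_atMost)
  also have "(\<Sum>k<d. coeff (lift_of d \<alpha> x) k * c ^ k) = (\<Sum>k<d. c ^ k * x k)" by (intro sum.cong) auto
  finally show ?thesis by simp
qed

lemma proj_hat_hyperplane:
  assumes P: "P \<in> lifts d \<alpha>"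
  shows "proj d P \<in> hat_hyperplane d \<alpha> i \<longleftrightarrow> poly P (of_int i) \<in> \<int>"
proof
  assume "proj d P \<in> hat_hyperplane d \<alpha> i"
  then obtain n x where x: "x \<in> hyperplane d \<alpha> i n" "proj d P = torus_proj d x" by (auto simp: hat_hyperplane_def)
  have "poly (lift_of d \<alpha> x) (of_int i) = of_int n" using x(1) by (simp add: hyperplane_def poly_lift_of)
  moreover have "proj d P = proj d (lift_of d \<alpha> x)" using x(2) by (auto simp: proj_def torus_proj_def)
  then have "P - lift_of d \<alpha> x \<in> integral_polys d" using proj_eq_iff [OF P] by simp
  then have "poly (P - lift_of d \<alpha> x) (of_int i) \<in> \<int>" by (rule poly_integral_polys) simp
  then have "poly (P - lift_of d \<alpha> x) (of_int i) + of_int n \<in> \<int>" by (intro Ints_add) auto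
  ultimately show "poly P (of_int i) \<in> \<int>" by simp
next
  assume "poly P (of_int i) \<in> \<int>"
  then obtain n where n: "poly P (of_int i) = of_int n" unfolding Ints_def by blast
  define x where "x = restrict (coeff P) {..<d}"
  have "lift_of d \<alpha> x = lift_of d \<alpha> (coeff P)" by (rule poly_eqI) (auto simp: x_def)
  then have "lift_of d \<alpha> x = P" using P by (simp add: lift_of_coeff)
  then have "x \<in> hyperplane d \<alpha> i n" using n poly_lift_of [of d \<alpha> x "of_int i"] by (auto simp: hyperplane_def x_def)
  moreover have "torus_proj d x = proj d P" by (auto simp: proj_def torus_proj_def x_def)
  ultimately show "proj d P \<in> hat_hyperplane d \<alpha> i" unfolding hat_hyperplane_def by (metis UN_I UNIV_I imageI)
qed

section \<open>The topology of the torus in terms of lifts\<close>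

lemma continuous_to_circle: "continuous_on S to_circle"
proof -
  have "continuous_on UNIV to_circle"
    unfolding continuous_on_open_vimage [OF open_UNIV] by (simp add: open_circle_def)
  then show ?thesis using continuous_on_subset by blast
qed

lemma open_to_circle_image:
  assumes "open S" shows "open (to_circle ` S)"
proof -
  have "to_circle -` to_circle ` S = (\<Union>n::int. (\<lambda>x. x + of_int n) ` S)"
  proof (intro Set.set_eqI iffI)
    fix y assume "y \<in> to_circle -` to_circle ` S"
    then obtain x where x: "x \<in> S" "y - x \<in> \<int>" by (auto simp: to_circle_eq_iff)
    then obtain n where "y - x = of_int n" unfolding Ints_def by blast
    then have "y = x + of_int n" by simp
    then show "y \<in> (\<Union>n::int. (\<lambda>x. x + of_int n) ` S)" using x(1) by blast
  next
    fix y assume "y \<in> (\<Union>n::int. (\<lambda>x. x + of_int n) ` S)"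
    then obtain n :: int and x where "x \<in> S" "y = x + of_int n" by blast
    then show "y \<in> to_circle -` to_circle ` S" by (auto simp: to_circle_eq_iff intro!: image_eqI [of _ _ x])
  qed
  moreover have "open (\<Union>n::int. (\<lambda>x. x + of_int n) ` S)"
  proof (intro open_UN ballI)
    fix n :: int
    have "(\<lambda>x. x + of_int n) ` S = (+) (of_int n) ` S" by (intro image_cong) auto
    then show "open ((\<lambda>x. x + of_int n) ` S)" using open_translation [OF assms] by simp
  qed
  ultimately show ?thesis by (simp add: open_circle_def)
qed

definition torus_box :: "nat \<Rightarrow> real poly \<Rightarrow> real \<Rightarrow> (nat \<Rightarrow> circle) set"
  where "torus_box d P \<delta> = (\<Pi>\<^sub>E k\<in>{..<d}. to_circle ` ball (coeff P k) \<delta>)"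

lemma openin_torus_box: "openin (torus d) (torus_box d P \<delta>)"
  unfolding torus_def torus_box_def
  by (subst openin_PiE_gen) (auto intro!: open_to_circle_image)

lemma proj_torus_box: "\<delta> > 0 \<Longrightarrow> proj d P \<in> torus_box d P \<delta>"
  by (auto simp: torus_box_def proj_def torus_proj_def)

lemma torus_box_lift:
  assumes "z \<in> torus_box d P \<delta>" "P \<in> lifts d \<alpha>"
  obtains Q where "Q \<in> lifts d \<alpha>" "proj d Q = z" "\<And>k. k < d \<Longrightarrow> \<bar>coeff (Q - P) k\<bar> < \<delta>"
proof -
  have "\<forall>k. \<exists>x. k < d \<longrightarrow> z k = to_circle x \<and> \<bar>x - coeff P k\<bar> < \<delta>"
    using assms(1) by (force simp: torus_box_def PiE_iff dist_real_def abs_minus_commute)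
  then obtain x where x: "\<And>k. k < d \<Longrightarrow> z k = to_circle (x k)" "\<And>k. k < d \<Longrightarrow> \<bar>x k - coeff P k\<bar> < \<delta>" by metis
  show ?thesis
  proof
    show "lift_of d \<alpha> x \<in> lifts d \<alpha>" by simp
    show "proj d (lift_of d \<alpha> x) = z"
      using x(1) assms(1) by (auto simp: proj_def torus_proj_def torus_box_def PiE_iff extensional_def fun_eq_iff)
    show "\<bar>coeff (lift_of d \<alpha> x - P) k\<bar> < \<delta>" if "k < d" for k using x(2) that by simp
  qed
qed

lemma openin_proj:
  assumes "\<And>P. P \<in> lifts d \<alpha> \<Longrightarrow> p P \<Longrightarrow> \<exists>\<delta>>0. \<forall>Q\<in>lifts d \<alpha>. (\<forall>k<d. \<bar>coeff (Q - P) k\<bar> < \<delta>) \<longrightarrow> p Q"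
  shows "openin (torus d) (proj d ` {P \<in> lifts d \<alpha>. p P})"
proof (subst openin_subopen, intro ballI)
  fix z assume "z \<in> proj d ` {P \<in> lifts d \<alpha>. p P}"
  then obtain P where P: "P \<in> lifts d \<alpha>" "p P" "z = proj d P" by blast
  obtain \<delta> where \<delta>: "\<delta> > 0" "\<And>Q. Q \<in> lifts d \<alpha> \<Longrightarrow> (\<forall>k<d. \<bar>coeff (Q - P) k\<bar> < \<delta>) \<Longrightarrow> p Q" using assms [OF P(1,2)] by blast
  have "torus_box d P \<delta> \<subseteq> proj d ` {P \<in> lifts d \<alpha>. p P}"
  proof
    fix y assume "y \<in> torus_box d P \<delta>"
    then obtain Q where "Q \<in> lifts d \<alpha>" "proj d Q = y" "\<And>k. k < d \<Longrightarrow> \<bar>coeff (Q - P) k\<bar> < \<delta>"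
      using torus_box_lift P(1) by blast
    then show "y \<in> proj d ` {P \<in> lifts d \<alpha>. p P}" using \<delta>(2) by blast
  qed
  then show "\<exists>T. openin (torus d) T \<and> z \<in> T \<and> T \<subseteq> proj d ` {P \<in> lifts d \<alpha>. p P}"
    using openin_torus_box proj_torus_box [OF \<delta>(1), of d P] P(3)
    by (intro exI [of _ "torus_box d P \<delta>"] conjI) simp_all
qed

lemma continuous_segment:
  "continuous_map (top_of_set {0..1}) (torus d) (\<lambda>s. proj d (P + smult s (Q - P)))"
  unfolding torus_def
proof (subst continuous_map_componentwise, intro conjI ballI)
  show "(\<lambda>s. proj d (P + smult s (Q - P))) ` topspace (top_of_set {0..1}) \<subseteq> extensional {..<d}"
    by (auto simp: proj_def torus_proj_def)
  fix k assume "k \<in> {..<d}"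
  then have e: "(\<lambda>s. proj d (P + smult s (Q - P)) k) = to_circle \<circ> (\<lambda>s. coeff P k + s * coeff (Q - P) k)"
    by (auto simp: proj_def torus_proj_def)
  have "continuous_on {0..1} (to_circle \<circ> (\<lambda>s. coeff P k + s * coeff (Q - P) k))"
    by (intro continuous_on_compose continuous_to_circle continuous_intros)
  then show "continuous_map (top_of_set {0..1}) euclidean (\<lambda>s. proj d (P + smult s (Q - P)) k)"
    unfolding e by simp
qed

section \<open>Faces and cells as projections of polytopes\<close>

lemma between_iff: "of_int n < x \<and> x < of_int n + 1 \<longleftrightarrow> x \<notin> \<int> \<and> \<lfloor>x\<rfloor> = n" for x :: real
proof
  assume *: "of_int n < x \<and> x < of_int n + 1"
  then have "\<lfloor>x\<rfloor> = n" by (simp add: floor_eq_iff)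
  moreover have "x \<notin> \<int>" using * \<open>\<lfloor>x\<rfloor> = n\<close> by (metis Ints_cases floor_of_int less_irrefl)
  ultimately show "x \<notin> \<int> \<and> \<lfloor>x\<rfloor> = n" by simp
next
  assume *: "x \<notin> \<int> \<and> \<lfloor>x\<rfloor> = n"
  then have "x \<noteq> of_int n" by (metis Ints_of_int)
  then show "of_int n < x \<and> x < of_int n + 1" using floor_correct [of x] * by auto
qed

definition stratum :: "nat \<Rightarrow> real \<Rightarrow> int set \<Rightarrow> (nat \<Rightarrow> circle) set"
  where "stratum d \<alpha> J = {x \<in> topspace (torus d). \<forall>i\<in>{0..int d}. x \<in> hat_hyperplane d \<alpha> i \<longleftrightarrow> i \<in> J}"

lemma proj_stratum:
  assumes "P \<in> lifts d \<alpha>"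
  shows "proj d P \<in> stratum d \<alpha> J \<longleftrightarrow> (\<forall>j\<le>d. poly P (real j) \<in> \<int> \<longleftrightarrow> int j \<in> J)"
proof -
  have "proj d P \<in> stratum d \<alpha> J \<longleftrightarrow> (\<forall>i\<in>{0..int d}. poly P (of_int i) \<in> \<int> \<longleftrightarrow> i \<in> J)"
    using proj_hat_hyperplane [OF assms] by (simp add: stratum_def)
  also have "\<dots> \<longleftrightarrow> (\<forall>j\<le>d. poly P (real j) \<in> \<int> \<longleftrightarrow> int j \<in> J)"
  proof safe
    fix i assume *: "\<forall>j\<le>d. poly P (real j) \<in> \<int> \<longleftrightarrow> int j \<in> J" "i \<in> {0..int d}"
    then have "nat i \<le> d" "of_int i = real (nat i)" "int (nat i) = i" by auto
    then show "poly P (of_int i) \<in> \<int> \<Longrightarrow> i \<in> J" "i \<in> J \<Longrightarrow> poly P (of_int i) \<in> \<int>" using *(1) by metis+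
  qed force+
  finally show ?thesis .
qed

text \<open>The segment between the lifts stays in the stratum: integral values agree and do not
  move, the others stay inside one open unit interval.\<close>

lemma same_face:
  assumes P: "P \<in> lifts d \<alpha>" and Q: "Q \<in> lifts d \<alpha>"
    and same: "\<And>j. j \<le> d \<Longrightarrow> \<lfloor>poly P (real j)\<rfloor> = \<lfloor>poly Q (real j)\<rfloor> \<and> (poly P (real j) \<in> \<int> \<longleftrightarrow> poly Q (real j) \<in> \<int>)"
    and J: "proj d P \<in> stratum d \<alpha> J"
  shows "connected_component_of (subtopology (torus d) (stratum d \<alpha> J)) (proj d P) (proj d Q)"
proof -
  define f where "f s = proj d (P + smult s (Q - P))" for s
  have f_stratum: "f s \<in> stratum d \<alpha> J" if s: "s \<in> {0..1}" for s
  proof -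
    have L: "P + smult s (Q - P) \<in> lifts d \<alpha>" using P lifts_diff [OF Q P] by simp
    have "poly (P + smult s (Q - P)) (real j) \<in> \<int> \<longleftrightarrow> int j \<in> J" if j: "j \<le> d" for j
    proof -
      define a b where "a = poly P (real j)" and "b = poly Q (real j)"
      have ab: "\<lfloor>a\<rfloor> = \<lfloor>b\<rfloor>" "a \<in> \<int> \<longleftrightarrow> b \<in> \<int>" using same [OF j] by (auto simp: a_def b_def)
      have aJ: "a \<in> \<int> \<longleftrightarrow> int j \<in> J" using J j unfolding proj_stratum [OF P] a_def by blast
      have e: "poly (P + smult s (Q - P)) (real j) = (1 - s) * a + s * b" by (simp add: a_def b_def algebra_simps)
      show ?thesis
      proof (cases "a \<in> \<int>")
        case True
        then have "a = of_int \<lfloor>a\<rfloor>" "b = of_int \<lfloor>b\<rfloor>" using ab(2) by auto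
        then have "a = b" using ab(1) by simp
        then have "poly (P + smult s (Q - P)) (real j) = a" unfolding e by (simp add: algebra_simps)
        then show ?thesis using aJ by simp
      next
        case False
        define n where "n = \<lfloor>a\<rfloor>"
        have h: "of_int n < a \<and> a < of_int n + 1" "of_int n < b \<and> b < of_int n + 1"
          using False ab unfolding between_iff n_def by auto
        have "of_int n < (1 - s) * a + s * b \<and> (1 - s) * a + s * b < of_int n + 1"
        proof -
          have "of_int n < min a b" "max a b < of_int n + 1" using h by auto
          moreover have "min a b \<le> (1 - s) * a + s * b"
          proof -
            have "(1 - s) * min a b + s * min a b \<le> (1 - s) * a + s * b" using s by (intro add_mono mult_left_mono) auto
            then show ?thesis by (simp add: algebra_simps)
          qed
          moreover have "(1 - s) * a + s * b \<le> max a b"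
          proof -
            have "(1 - s) * a + s * b \<le> (1 - s) * max a b + s * max a b" using s by (intro add_mono mult_left_mono) auto
            then show ?thesis by (simp add: algebra_simps)
          qed
          ultimately show ?thesis by linarith
        qed
        then have "poly (P + smult s (Q - P)) (real j) \<notin> \<int>"
          unfolding e between_iff by blast
        then show ?thesis using aJ False by simp
      qed
    qed
    then show ?thesis unfolding f_def proj_stratum [OF L] by blast
  qed
  have "connectedin (torus d) (f ` {0..1})"
    by (rule connectedin_continuous_map_image [OF continuous_segment [of d P Q, folded f_def]])
       (simp add: connectedin_subtopology)
  then have "connectedin (subtopology (torus d) (stratum d \<alpha> J)) (f ` {0..1})"
    using f_stratum by (auto simp: connectedin_subtopology)
  moreover have "f 0 = proj d P" "f 1 = proj d Q" by (auto simp: f_def)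
  ultimately show ?thesis unfolding connected_component_of_def
    by (intro exI [of _ "f ` {0..1}"]) (metis atLeastAtMost_iff image_eqI order_refl zero_le_one)
qed

lemma cells_eq: "cells d \<alpha> = connected_components_of (subtopology (torus d) (stratum d \<alpha> {}))"
proof -
  have "topspace (torus d) - (\<Union>i\<in>{0..int d}. hat_hyperplane d \<alpha> i) = stratum d \<alpha> {}"
    by (auto simp: stratum_def)
  then show ?thesis by (simp add: cells_def)
qed

lemma faces_eq: "faces d \<alpha> = (\<Union>J\<in>Pow {0..int d}. connected_components_of (subtopology (torus d) (stratum d \<alpha> J)))"
  by (simp add: faces_def stratum_def)

lemma stratum_subset: "stratum d \<alpha> J \<subseteq> topspace (torus d)"
  by (auto simp: stratum_def)

text \<open>The projection of one open polytope. Tuples c that differ on 0, ..., d by the values of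
  an integral polynomial give the same set.\<close>

definition open_cell :: "nat \<Rightarrow> real \<Rightarrow> (nat \<Rightarrow> int) \<Rightarrow> (nat \<Rightarrow> circle) set"
  where "open_cell d \<alpha> c = proj d ` {P \<in> lifts d \<alpha>. \<forall>j\<le>d. of_int (c j) < poly P (real j) \<and> poly P (real j) < of_int (c j) + 1}"

text \<open>The projected polytope and the rest \<open>E2\<close> of the complement of the
  hyperplanes are both open, and the connected set C meets the former.\<close>

lemma cell_subset_open_cell:
  assumes C: "C \<in> cells d \<alpha>" and P: "P \<in> lifts d \<alpha>" "proj d P \<in> C"
  shows "C \<subseteq> open_cell d \<alpha> (\<lambda>j. \<lfloor>poly P (real j)\<rfloor>)"
proof -
  define c where "c = (\<lambda>j. \<lfloor>poly P (real j)\<rfloor>)"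
  define E2 where "E2 = proj d ` {Q \<in> lifts d \<alpha>. (\<forall>j\<le>d. poly Q (real j) \<notin> \<int>) \<and> proj d Q \<notin> open_cell d \<alpha> c}"
  let ?Y = "subtopology (torus d) (stratum d \<alpha> {})"
  have CY: "connectedin ?Y C" using C unfolding cells_eq by (rule connectedin_connected_components_of)
  then have CT: "connectedin (torus d) C" and Cs: "C \<subseteq> stratum d \<alpha> {}" by (auto simp: connectedin_subtopology)
  have stable: "\<exists>\<delta>>0. \<forall>R\<in>lifts d \<alpha>. (\<forall>k<d. \<bar>coeff (R - Q) k\<bar> < \<delta>) \<longrightarrow>
      (\<forall>j\<le>d. poly R (real j) \<notin> \<int> \<and> \<lfloor>poly R (real j)\<rfloor> = \<lfloor>poly Q (real j)\<rfloor>)"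
    if Q: "Q \<in> lifts d \<alpha>" "\<forall>j\<le>d. poly Q (real j) \<notin> \<int>" for Q
  proof -
    obtain \<delta> where "\<delta> > 0" and \<delta>: "\<And>R n. R \<in> lifts d \<alpha> \<Longrightarrow> (\<And>k. k < d \<Longrightarrow> \<bar>coeff (R - Q) k\<bar> < \<delta>) \<Longrightarrow> \<bar>n\<bar> \<le> int d \<Longrightarrow> poly Q (of_int n) \<notin> \<int> \<Longrightarrow>
      poly R (of_int n) \<notin> \<int> \<and> \<lfloor>poly R (of_int n)\<rfloor> = \<lfloor>poly Q (of_int n)\<rfloor>"
      using floors_stable [OF Q(1), of "int d"] by metis
    have "poly R (real j) \<notin> \<int> \<and> \<lfloor>poly R (real j)\<rfloor> = \<lfloor>poly Q (real j)\<rfloor>"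
      if "R \<in> lifts d \<alpha>" "\<forall>k<d. \<bar>coeff (R - Q) k\<bar> < \<delta>" "j \<le> d" for R j
      using \<delta> [of R "int j"] that Q(2) by simp
    then show ?thesis using \<open>\<delta> > 0\<close> by blast
  qed
  have "openin (torus d) (open_cell d \<alpha> c)"
    unfolding open_cell_def between_iff
  proof (rule openin_proj)
    fix Q assume Q: "Q \<in> lifts d \<alpha>" "\<forall>j\<le>d. poly Q (real j) \<notin> \<int> \<and> \<lfloor>poly Q (real j)\<rfloor> = c j"
    obtain \<delta> where \<delta>: "\<delta> > 0" "\<And>R. R \<in> lifts d \<alpha> \<Longrightarrow> (\<forall>k<d. \<bar>coeff (R - Q) k\<bar> < \<delta>) \<Longrightarrow>
      (\<forall>j\<le>d. poly R (real j) \<notin> \<int> \<and> \<lfloor>poly R (real j)\<rfloor> = \<lfloor>poly Q (real j)\<rfloor>)" using stable [OF Q(1)] Q(2) by blast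
    have "\<forall>j\<le>d. poly R (real j) \<notin> \<int> \<and> \<lfloor>poly R (real j)\<rfloor> = c j"
      if "R \<in> lifts d \<alpha>" "\<forall>k<d. \<bar>coeff (R - Q) k\<bar> < \<delta>" for R using \<delta>(2) [OF that] Q(2) by auto
    then show "\<exists>\<delta>>0. \<forall>R\<in>lifts d \<alpha>. (\<forall>k<d. \<bar>coeff (R - Q) k\<bar> < \<delta>) \<longrightarrow> (\<forall>j\<le>d. poly R (real j) \<notin> \<int> \<and> \<lfloor>poly R (real j)\<rfloor> = c j)"
      using \<delta>(1) by blast
  qed
  moreover have "openin (torus d) E2"
    unfolding E2_def
  proof (rule openin_proj)
    fix Q assume Q: "Q \<in> lifts d \<alpha>" "(\<forall>j\<le>d. poly Q (real j) \<notin> \<int>) \<and> proj d Q \<notin> open_cell d \<alpha> c"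
    obtain \<delta> where \<delta>: "\<delta> > 0" "\<And>R. R \<in> lifts d \<alpha> \<Longrightarrow> (\<forall>k<d. \<bar>coeff (R - Q) k\<bar> < \<delta>) \<Longrightarrow>
      (\<forall>j\<le>d. poly R (real j) \<notin> \<int> \<and> \<lfloor>poly R (real j)\<rfloor> = \<lfloor>poly Q (real j)\<rfloor>)" using stable [OF Q(1)] Q(2) by blast
    have "proj d R \<notin> open_cell d \<alpha> c" if R: "R \<in> lifts d \<alpha>" "\<forall>k<d. \<bar>coeff (R - Q) k\<bar> < \<delta>" for R
    proof
      assume "proj d R \<in> open_cell d \<alpha> c"
      then obtain S where S: "S \<in> lifts d \<alpha>" "proj d R = proj d S" "\<forall>j\<le>d. poly S (real j) \<notin> \<int> \<and> \<lfloor>poly S (real j)\<rfloor> = c j"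
        unfolding open_cell_def between_iff by blast
      \<comment> \<open>The integral polynomial that carries R into the polytope carries Q there as
        well, since Q and R have the same integer parts.\<close>
      define u where "u = S - R"
      have u: "u \<in> integral_polys d" using S(2) proj_eq_iff [OF S(1) R(1)] by (simp add: u_def)
      have Qu: "Q + u \<in> lifts d \<alpha>" using Q(1) u integral_polys_low by simp
      have "poly (Q + u) (real j) \<notin> \<int> \<and> \<lfloor>poly (Q + u) (real j)\<rfloor> = c j" if j: "j \<le> d" for j
      proof -
        have "poly u (real j) \<in> \<int>" using u by (rule poly_integral_polys) simp
        then obtain a where a: "poly u (real j) = of_int a" unfolding Ints_def by blast
        have "\<lfloor>poly Q (real j)\<rfloor> = \<lfloor>poly R (real j)\<rfloor>" using \<delta>(2) [OF R] j by simp
        moreover have "poly S (real j) = poly R (real j) + of_int a" using a by (simp add: u_def)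
        moreover have "poly Q (real j) + of_int a \<notin> \<int>" using Q(2) j by (metis Ints_diff Ints_of_int add_diff_cancel_right')
        moreover have "\<lfloor>poly S (real j)\<rfloor> = c j" using S(3) j by blast
        ultimately show ?thesis using a by simp
      qed
      then have "proj d (Q + u) \<in> open_cell d \<alpha> c" unfolding open_cell_def between_iff using Qu by blast
      moreover have "proj d (Q + u) = proj d Q" using proj_eq_iff [OF Qu Q(1)] u by simp
      ultimately show False using Q(2) by simp
    qed
    then show "\<exists>\<delta>>0. \<forall>R\<in>lifts d \<alpha>. (\<forall>k<d. \<bar>coeff (R - Q) k\<bar> < \<delta>) \<longrightarrow> (\<forall>j\<le>d. poly R (real j) \<notin> \<int>) \<and> proj d R \<notin> open_cell d \<alpha> c"
      using \<delta> by blast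
  qed
  moreover have "C \<subseteq> open_cell d \<alpha> c \<union> E2"
  proof
    fix z assume z: "z \<in> C"
    then have "z \<in> {..<d} \<rightarrow>\<^sub>E UNIV" using Cs stratum_subset by fastforce
    then obtain Q where Q: "Q \<in> lifts d \<alpha>" "proj d Q = z" by (rule torus_lift)
    have "proj d Q \<in> stratum d \<alpha> {}" using z Q Cs by blast
    then have "\<forall>j\<le>d. poly Q (real j) \<notin> \<int>" using proj_stratum [OF Q(1)] by simp
    then show "z \<in> open_cell d \<alpha> c \<union> E2" using Q by (auto simp: E2_def)
  qed
  moreover have "open_cell d \<alpha> c \<inter> E2 \<inter> C = {}" by (auto simp: E2_def)
  moreover have "proj d P \<in> open_cell d \<alpha> c"
  proof -
    have "proj d P \<in> stratum d \<alpha> {}" using P Cs by blast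
    then have "\<forall>j\<le>d. poly P (real j) \<notin> \<int>" using proj_stratum [OF P(1)] by simp
    then show ?thesis unfolding open_cell_def between_iff c_def using P(1) by blast
  qed
  ultimately have "E2 \<inter> C = {}" using connectedinD [OF CT] P(2) by blast
  then show ?thesis using \<open>C \<subseteq> open_cell d \<alpha> c \<union> E2\<close> unfolding c_def by blast
qed

text \<open>P is a limit of lifts of points of C, which satisfy the inequalities after integral
  corrections; \<open>cell_closed\<close> handles the limit.\<close>

lemma closure_open_cell:
  assumes P: "P \<in> lifts d \<alpha>" and cl: "proj d P \<in> torus d closure_of C" and C: "C \<subseteq> open_cell d \<alpha> c"
  shows "\<exists>u\<in>integral_polys d. \<forall>j\<le>d. of_int (c j) \<le> poly (P + u) (real j) \<and> poly (P + u) (real j) \<le> of_int (c j) + 1"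
proof -
  have "\<exists>Q\<in>lifts d \<alpha>. (\<forall>k<d. \<bar>coeff (Q - P) k\<bar> < inverse (real (Suc n))) \<and> (\<exists>u\<in>integral_polys d. \<forall>j\<le>d.
      of_int (c j) \<le> poly (Q + u) (real j) \<and> poly (Q + u) (real j) \<le> of_int (c j) + 1)" for n
  proof -
    have "proj d P \<in> torus_box d P (inverse (real (Suc n)))" by (rule proj_torus_box) simp
    then obtain y where y: "y \<in> C" "y \<in> torus_box d P (inverse (real (Suc n)))"
      using cl openin_torus_box unfolding in_closure_of by blast
    obtain Q where Q: "Q \<in> lifts d \<alpha>" "proj d Q = y" "\<And>k. k < d \<Longrightarrow> \<bar>coeff (Q - P) k\<bar> < inverse (real (Suc n))"
      by (rule torus_box_lift [OF y(2) P]) (rule that)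
    obtain R where R: "R \<in> lifts d \<alpha>" "proj d R = y" "\<forall>j\<le>d. of_int (c j) < poly R (real j) \<and> poly R (real j) < of_int (c j) + 1"
      using y(1) C unfolding open_cell_def by blast
    have "R - Q \<in> integral_polys d" using proj_eq_iff [OF R(1) Q(1)] R(2) Q(2) by simp
    moreover have "\<forall>j\<le>d. of_int (c j) \<le> poly (Q + (R - Q)) (real j) \<and> poly (Q + (R - Q)) (real j) \<le> of_int (c j) + 1"
      using R(3) by (simp add: less_imp_le)
    ultimately show ?thesis using Q(1,3) by blast
  qed
  then obtain Q where Q: "\<And>n. Q n \<in> lifts d \<alpha>" "\<And>n k. k < d \<Longrightarrow> \<bar>coeff (Q n - P) k\<bar> < inverse (real (Suc n))"
    "\<And>n. \<exists>u\<in>integral_polys d. \<forall>j\<le>d. of_int (c j) \<le> poly (Q n + u) (real j) \<and> poly (Q n + u) (real j) \<le> of_int (c j) + 1"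
    by metis
  have "(\<lambda>n. coeff (Q n) k) \<longlonglongrightarrow> coeff P k" for k
  proof (cases "k < d")
    case True
    have "(\<lambda>n. \<bar>coeff (Q n) k - coeff P k\<bar>) \<longlonglongrightarrow> 0"
      using Q(2) [OF True] by (intro tendsto_sandwich [OF _ _ tendsto_const LIMSEQ_inverse_real_of_nat]) (auto intro: less_imp_le always_eventually)
    then show ?thesis by (simp add: LIM_zero_iff tendsto_rabs_zero_iff)
  next
    case False
    then have "coeff (Q n) k = coeff P k" for n using lifts_diff [OF Q(1) P] by (auto simp: low_def)
    then show ?thesis by simp
  qed
  then show ?thesis by (rule cell_closed [OF _ Q(1) P Q(3)])
qed

section \<open>The automorphism group\<close>

text \<open>Segments inside faces turn constancy on faces into \<open>code_stratum\<close>, the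
  closure condition becomes \<open>code_cell\<close>, and \<open>cell_code\<close> holds because
  cells are whole components.\<close>

lemma cell_partition_coded:
  assumes d: "d \<ge> 1" and irr: "\<alpha> \<notin> \<rat>" and part: "cell_partition d \<alpha> m U"
  obtains code N where "coded_nilsystem d \<alpha> m code N"
    "\<And>P k. P \<in> lifts d \<alpha> \<Longrightarrow> k \<in> {1..m} \<Longrightarrow> proj d P \<in> U k \<longleftrightarrow> code P = k"
proof -
  have "\<exists>C. bij_betw C {1..m} (cells d \<alpha>) \<and> (\<forall>k\<in>{1..m}. C k \<subseteq> U k \<and> U k \<subseteq> torus d closure_of (C k))"
    using part unfolding cell_partition_def by (rule conjunct1)
  then obtain C where C: "bij_betw C {1..m} (cells d \<alpha>)" "\<And>k. k \<in> {1..m} \<Longrightarrow> C k \<subseteq> U k"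
    "\<And>k. k \<in> {1..m} \<Longrightarrow> U k \<subseteq> torus d closure_of (C k)" by (elim exE conjE) simp
  have disj: "disjoint_family_on U {1..m}" and cover: "(\<Union>k\<in>{1..m}. U k) = topspace (torus d)"
    and face: "\<And>F. F \<in> faces d \<alpha> \<Longrightarrow> \<exists>k\<in>{1..m}. F \<subseteq> U k"
    using part unfolding cell_partition_def by simp_all
  define code where "code P = (THE k. k \<in> {1..m} \<and> proj d P \<in> U k)" for P
  have ex1: "\<exists>!k. k \<in> {1..m} \<and> proj d P \<in> U k" for P
  proof -
    have "proj d P \<in> (\<Union>k\<in>{1..m}. U k)" using cover by simp
    then obtain k where "k \<in> {1..m}" "proj d P \<in> U k" by blast
    then show ?thesis using disj unfolding disjoint_family_on_def by (intro ex1I [of _ k]) blast+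
  qed
  have code: "code P \<in> {1..m}" "proj d P \<in> U (code P)" for P
    using theI' [OF ex1 [of P]] by (auto simp: code_def)
  have code_eq: "code P = k" if "k \<in> {1..m}" "proj d P \<in> U k" for P k
    unfolding code_def using that by (intro the1_equality [OF ex1]) auto
  have "\<exists>P. P \<in> lifts d \<alpha> \<and> proj d P \<in> C k" if k: "k \<in> {1..m}" for k
  proof -
    have Ck: "C k \<in> connected_components_of (subtopology (torus d) (stratum d \<alpha> {}))"
      using C(1) k unfolding bij_betw_def cells_eq by blast
    then obtain z where z: "z \<in> C k" using nonempty_connected_components_of by blast
    then have "z \<in> {..<d} \<rightarrow>\<^sub>E UNIV" using connected_components_of_subset [OF Ck] by auto
    then obtain P where "P \<in> lifts d \<alpha>" "proj d P = z" by (rule torus_lift)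
    then show ?thesis using z by blast
  qed
  then obtain rep where rep: "\<And>k. k \<in> {1..m} \<Longrightarrow> rep k \<in> lifts d \<alpha>" "\<And>k. k \<in> {1..m} \<Longrightarrow> proj d (rep k) \<in> C k" by metis
  \<comment> \<open>Another lift, or another point of the cell, would change \<open>N k\<close> on
    0, ..., d by the values of an integral polynomial.\<close>
  define N where "N k j = \<lfloor>poly (rep k) (real j)\<rfloor>" for k j
  have Ccell: "C k \<in> cells d \<alpha>" if "k \<in> {1..m}" for k using C(1) that unfolding bij_betw_def by blast
  have "coded_nilsystem d \<alpha> m code N"
  proof
    show "d \<ge> 1" "\<alpha> \<notin> \<rat>" using d irr by auto
    show "code P \<in> {1..m}" for P by (rule code(1))
    show "code (P + u) = code P" if "P \<in> lifts d \<alpha>" "u \<in> integral_polys d" for P u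
    proof -
      have "proj d (P + u) = proj d P" using that proj_eq_iff [of "P + u" d \<alpha> P] integral_polys_low by simp
      then show ?thesis by (simp add: code_def)
    qed
    show "code P = code Q" if PQ: "P \<in> lifts d \<alpha>" "Q \<in> lifts d \<alpha>"
      "\<And>j. j \<le> d \<Longrightarrow> \<lfloor>poly P (real j)\<rfloor> = \<lfloor>poly Q (real j)\<rfloor> \<and> (poly P (real j) \<in> \<int> \<longleftrightarrow> poly Q (real j) \<in> \<int>)" for P Q
    proof -
      define J where "J = {i \<in> {0..int d}. poly P (of_int i) \<in> \<int>}"
      let ?Y = "subtopology (torus d) (stratum d \<alpha> J)"
      have J: "proj d P \<in> stratum d \<alpha> J" unfolding proj_stratum [OF PQ(1)] by (auto simp: J_def)
      have con: "connected_component_of ?Y (proj d P) (proj d Q)" by (rule same_face [OF PQ J])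
      let ?F = "connected_component_of_set ?Y (proj d P)"
      have "proj d P \<in> topspace ?Y" using J stratum_subset by auto
      then have "?F \<in> connected_components_of ?Y" and P: "proj d P \<in> ?F"
        by (auto simp: connected_components_of_def connected_component_of_refl)
      then have "?F \<in> faces d \<alpha>" unfolding faces_eq by (intro UN_I [of J]) (auto simp: J_def)
      then obtain k where k: "k \<in> {1..m}" "?F \<subseteq> U k" using face by blast
      then have "proj d P \<in> U k" "proj d Q \<in> U k" using P con by auto
      then show ?thesis using code_eq k(1) by metis
    qed
    show "\<exists>u\<in>integral_polys d. \<forall>j\<le>d. of_int (N (code P) j) \<le> poly (P + u) (real j) \<and>
        poly (P + u) (real j) \<le> of_int (N (code P) j) + 1" if P: "P \<in> lifts d \<alpha>" for P
    proof (rule closure_open_cell [OF P])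
      show "proj d P \<in> torus d closure_of C (code P)" using code C(3) by blast
      show "C (code P) \<subseteq> open_cell d \<alpha> (N (code P))"
        using cell_subset_open_cell [OF Ccell rep] code(1) unfolding N_def by blast
    qed
    show "code P = k" if k: "k \<in> {1..m}" and P: "P \<in> lifts d \<alpha>" and
      N: "\<And>j. j \<le> d \<Longrightarrow> of_int (N k j) < poly P (real j) \<and> poly P (real j) < of_int (N k j) + 1" for k P
    proof -
      let ?Y = "subtopology (torus d) (stratum d \<alpha> {})"
      have Ck: "C k \<in> connected_components_of ?Y" using Ccell [OF k] unfolding cells_eq .
      have "C k \<subseteq> topspace ?Y" by (rule connected_components_of_subset [OF Ck])
      then have st: "proj d (rep k) \<in> stratum d \<alpha> {}" using rep(2) [OF k] by auto
      then have nz: "poly (rep k) (real j) \<notin> \<int>" if "j \<le> d" for j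
        using proj_stratum [OF rep(1) [OF k]] that by simp
      have con: "connected_component_of ?Y (proj d (rep k)) (proj d P)"
      proof (rule same_face [OF rep(1) [OF k] P _ st])
        fix j assume j: "j \<le> d"
        show "\<lfloor>poly (rep k) (real j)\<rfloor> = \<lfloor>poly P (real j)\<rfloor> \<and> (poly (rep k) (real j) \<in> \<int> \<longleftrightarrow> poly P (real j) \<in> \<int>)"
          using N [OF j] nz [OF j] unfolding between_iff by (simp add: N_def)
      qed
      obtain x where x: "C k = connected_component_of_set ?Y x" using Ck unfolding connected_components_of_def by blast
      then have "connected_component_of ?Y x (proj d (rep k))" using rep(2) [OF k] by simp
      then have "connected_component_of ?Y x (proj d P)" using con by (rule connected_component_of_trans)
      then have "proj d P \<in> C k" using x by simp
      then show ?thesis using code_eq k C(2) by blast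
    qed
  qed
  moreover have "proj d P \<in> U k \<longleftrightarrow> code P = k" if "k \<in> {1..m}" for P k
    using code code_eq that by metis
  ultimately show ?thesis using that by blast
qed

section \<open>Cylinders of the full shift\<close>

lemma topspace_full_shift: "w \<in> topspace (full_shift m) \<longleftrightarrow> (\<forall>i. w i \<in> {1..m})"
  by (auto simp: full_shift_def PiE_iff)

lemma full_shift_cylinder:
  assumes "openin (full_shift m) T" "w \<in> T"
  obtains L where "\<And>v. v \<in> topspace (full_shift m) \<Longrightarrow> (\<And>i. \<bar>i\<bar> \<le> L \<Longrightarrow> v i = w i) \<Longrightarrow> v \<in> T"
proof -
  obtain V where V: "finite {i. V i \<noteq> {1..m}}" "w \<in> Pi\<^sub>E UNIV V" "Pi\<^sub>E UNIV V \<subseteq> T"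
    using assms unfolding full_shift_def openin_product_topology_alt by auto
  define L where "L = Max (insert 0 (abs ` {i. V i \<noteq> {1..m}}))"
  have L: "\<bar>i\<bar> \<le> L" if "V i \<noteq> {1..m}" for i
    unfolding L_def using that V(1) by (intro Max_ge) auto
  have "v \<in> T" if v: "v \<in> topspace (full_shift m)" "\<And>i. \<bar>i\<bar> \<le> L \<Longrightarrow> v i = w i" for v
  proof -
    have "v i \<in> V i" for i
    proof (cases "V i = {1..m}")
      case True then show ?thesis using v(1) by (simp add: topspace_full_shift)
    next
      case False then show ?thesis using v(2) [OF L] V(2) by (auto simp: PiE_iff)
    qed
    then show ?thesis using V(3) by (auto simp: PiE_iff)
  qed
  then show ?thesis using that by blast
qed

lemma openin_cylinder:
  "openin (full_shift m) {v \<in> topspace (full_shift m). \<forall>i. \<bar>i\<bar> \<le> L \<longrightarrow> v i = w i}"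
proof -
  have "{v \<in> topspace (full_shift m). \<forall>i. \<bar>i\<bar> \<le> L \<longrightarrow> v i = w i} =
      Pi\<^sub>E UNIV (\<lambda>i. if \<bar>i\<bar> \<le> L then {1..m} \<inter> {w i} else {1..m})"
  proof (rule Set.set_eqI)
    fix v
    have "v i \<in> (if \<bar>i\<bar> \<le> L then {1..m} \<inter> {w i} else {1..m}) \<longleftrightarrow> v i \<in> {1..m} \<and> (\<bar>i\<bar> \<le> L \<longrightarrow> v i = w i)" for i
      by auto
    then show "v \<in> {v \<in> topspace (full_shift m). \<forall>i. \<bar>i\<bar> \<le> L \<longrightarrow> v i = w i} \<longleftrightarrow>
      v \<in> Pi\<^sub>E UNIV (\<lambda>i. if \<bar>i\<bar> \<le> L then {1..m} \<inter> {w i} else {1..m})"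
      unfolding mem_Collect_eq topspace_full_shift PiE_iff by auto
  qed
  moreover have "{i. \<bar>i\<bar> \<le> L} \<subseteq> {-L..L}" by auto
  then have "finite {i. \<bar>i\<bar> \<le> L}" using finite_subset by blast
  then have "finite {i. (if \<bar>i\<bar> \<le> L then {1..m} \<inter> {w i} else {1..m}) \<noteq> {1..m}}"
    by (rule rev_finite_subset) auto
  ultimately show ?thesis unfolding full_shift_def
    by (simp only:) (subst openin_PiE_gen, auto)
qed

context coded_nilsystem
begin

lemma words_topspace: "words \<subseteq> topspace (full_shift m)"
  using words_range by (auto simp: topspace_full_shift)

lemma coding_eq:
  assumes "\<And>P k. P \<in> lifts d \<alpha> \<Longrightarrow> k \<in> {1..m} \<Longrightarrow> proj d P \<in> U k \<longleftrightarrow> code P = k"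
    and sub: "\<And>k. k \<in> {1..m} \<Longrightarrow> U k \<subseteq> topspace (torus d)"
  shows "coding d \<alpha> m U = word ` lifts d \<alpha>"
proof -
  have key: "proj d P \<in> nil_preimage d \<alpha> i (U (w i)) \<longleftrightarrow> w i = word P i"
    if "P \<in> lifts d \<alpha>" "w i \<in> {1..m}" for P i w
    using proj_nil_preimage [OF that(1) sub [OF that(2)]] assms(1) [of "translate i P"] that
    by (auto simp: word_def)
  show ?thesis
  proof (intro Set.set_eqI iffI)
    fix w assume "w \<in> coding d \<alpha> m U"
    then obtain z where w: "\<And>i. w i \<in> {1..m}" and z: "\<And>i. z \<in> nil_preimage d \<alpha> i (U (w i))"
      by (auto simp: coding_def topspace_full_shift)
    have "z \<in> {..<d} \<rightarrow>\<^sub>E UNIV" using z [of 0] by (simp add: nil_preimage_def)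
    then obtain P where P: "P \<in> lifts d \<alpha>" "proj d P = z" by (rule torus_lift)
    then have "w = word P" using key w z by blast
    then show "w \<in> word ` lifts d \<alpha>" using P by blast
  next
    fix w assume "w \<in> word ` lifts d \<alpha>"
    then obtain P where P: "P \<in> lifts d \<alpha>" "w = word P" by blast
    then have "w \<in> words" using word_words by blast
    then have "w i \<in> {1..m}" for i using words_range by blast
    then have "proj d P \<in> (\<Inter>i. nil_preimage d \<alpha> i (U (w i)))" "w \<in> topspace (full_shift m)"
      using key P by (auto simp: topspace_full_shift)
    then show "w \<in> coding d \<alpha> m U" unfolding coding_def by blast
  qed
qed

lemma closure_words: "full_shift m closure_of (word ` lifts d \<alpha>) = words"
proof (intro Set.set_eqI iffI)
  fix w assume w: "w \<in> full_shift m closure_of (word ` lifts d \<alpha>)"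
  then have top: "w \<in> topspace (full_shift m)" by (simp add: in_closure_of)
  show "w \<in> words" unfolding words_def
  proof (intro CollectI allI)
    fix L
    define Z where "Z = {v \<in> topspace (full_shift m). \<forall>i. \<bar>i\<bar> \<le> L \<longrightarrow> v i = w i}"
    have "\<forall>T. w \<in> T \<and> openin (full_shift m) T \<longrightarrow> (\<exists>y. y \<in> word ` lifts d \<alpha> \<and> y \<in> T)"
      using w unfolding in_closure_of by (rule conjunct2)
    moreover have "w \<in> Z" using top by (simp add: Z_def)
    moreover have "openin (full_shift m) Z" unfolding Z_def by (rule openin_cylinder)
    ultimately have "\<exists>y. y \<in> word ` lifts d \<alpha> \<and> y \<in> Z" by blast
    then obtain P where P: "P \<in> lifts d \<alpha>" "\<forall>i. \<bar>i\<bar> \<le> L \<longrightarrow> word P i = w i"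
      unfolding Z_def by blast
    show "\<exists>P\<in>lifts d \<alpha>. \<forall>i. \<bar>i\<bar> \<le> L \<longrightarrow> w i = word P i" by (rule bexI [OF _ P(1)]) (simp add: P(2))
  qed
next
  fix w assume w: "w \<in> words"
  show "w \<in> full_shift m closure_of (word ` lifts d \<alpha>)" unfolding in_closure_of
  proof (intro conjI allI impI)
    show "w \<in> topspace (full_shift m)" using w words_topspace by blast
    fix T assume "w \<in> T \<and> openin (full_shift m) T"
    then obtain L where L: "\<And>v. v \<in> topspace (full_shift m) \<Longrightarrow> (\<And>i. \<bar>i\<bar> \<le> L \<Longrightarrow> v i = w i) \<Longrightarrow> v \<in> T"
      using full_shift_cylinder by metis
    obtain P where P: "P \<in> lifts d \<alpha>" "\<And>i. \<bar>i\<bar> \<le> L \<Longrightarrow> w i = word P i" using w unfolding words_def by blast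
    have "word P \<in> T" using P words_topspace word_words by (intro L) auto
    then show "\<exists>y. y \<in> word ` lifts d \<alpha> \<and> y \<in> T" using P(1) by blast
  qed
qed

text \<open>A locally constant function on a compact space depends on a bounded window. The
  compactness of \<open>words\<close> comes from \<open>over_compact\<close>.\<close>

lemma uniform_block:
  assumes "\<And>w. w \<in> words \<Longrightarrow> \<exists>L. \<forall>v\<in>words. (\<forall>i. \<bar>i\<bar> \<le> L \<longrightarrow> v i = w i) \<longrightarrow> f v = f w"
  shows "\<exists>R. \<forall>w\<in>words. \<forall>w'\<in>words. (\<forall>i. \<bar>i\<bar> \<le> R \<longrightarrow> w i = w' i) \<longrightarrow> f w = f w'"
proof (rule ccontr)
  assume "\<not> ?thesis"
  then have "\<forall>n::nat. \<exists>w w'. w \<in> words \<and> w' \<in> words \<and> (\<forall>i. \<bar>i\<bar> \<le> int n \<longrightarrow> w i = w' i) \<and> f w \<noteq> f w'" by blast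
  then obtain w w' where w: "\<And>n. w n \<in> words" "\<And>n. w' n \<in> words" "\<And>n i. \<bar>i\<bar> \<le> int n \<Longrightarrow> w n i = w' n i" "\<And>n. f (w n) \<noteq> f (w' n)"
    by metis
  have "\<exists>P. over (w n) P" for n using over_exists [OF w(1)] by blast
  then obtain P where P: "\<And>n. over (w n) (P n)" by metis
  obtain r v Q where r: "strict_mono r" "v \<in> words" "over v Q"
    "\<And>\<epsilon>. \<epsilon> > 0 \<Longrightarrow> \<forall>\<^sub>F n in sequentially. near d \<epsilon> (P (r n)) Q"
    "\<And>L. \<forall>\<^sub>F n in sequentially. \<forall>i. \<bar>i\<bar> \<le> L \<longrightarrow> w (r n) i = v i"
    by (rule over_compact [of w P, OF w(1) P]) (rule that)
  obtain L where L: "\<And>x. x \<in> words \<Longrightarrow> \<forall>i. \<bar>i\<bar> \<le> L \<longrightarrow> x i = v i \<Longrightarrow> f x = f v" using assms [OF r(2)] by blast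
  have "\<forall>\<^sub>F n in sequentially. nat \<bar>L\<bar> \<le> n" by (rule eventually_ge_at_top)
  with r(5) [of L] have "\<forall>\<^sub>F n in sequentially. False"
  proof eventually_elim
    case (elim n)
    have "w' (r n) i = v i" if "\<bar>i\<bar> \<le> L" for i
    proof -
      have "\<bar>i\<bar> \<le> int (r n)" using that elim(2) seq_suble [OF r(1), of n] by linarith
      then show ?thesis using w(3) [of i "r n"] elim(1) that by simp
    qed
    then have "f (w' (r n)) = f v" "f (w (r n)) = f v" using L w(1,2) elim(1) by blast+
    then show ?case using w(4) by metis
  qed
  then show False by simp
qed

lemma continuous_block:
  assumes f: "continuous_map (subtopology (full_shift m) words) (subtopology (full_shift m) words) f"
  shows "\<exists>R. \<forall>w\<in>words. \<forall>w'\<in>words. (\<forall>i. \<bar>i\<bar> \<le> R \<longrightarrow> w i = w' i) \<longrightarrow> f w 0 = f w' 0"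
proof (rule uniform_block)
  fix w assume w: "w \<in> words"
  have top: "topspace (subtopology (full_shift m) words) = words" using words_topspace by auto
  have fw: "f v \<in> words" if "v \<in> words" for v using f that top by (auto simp: continuous_map_def)
  define Z where "Z = {v \<in> topspace (full_shift m). \<forall>i. \<bar>i\<bar> \<le> 0 \<longrightarrow> v i = f w i} \<inter> words"
  have "openin (subtopology (full_shift m) words) Z"
    unfolding Z_def by (rule openin_subtopology_Int [OF openin_cylinder])
  then have "openin (subtopology (full_shift m) words) {x \<in> words. f x \<in> Z}"
    using openin_continuous_map_preimage [OF f, of Z] unfolding top by blast
  then obtain T where T: "openin (full_shift m) T" "{x \<in> words. f x \<in> Z} = T \<inter> words"
    unfolding openin_subtopology by blast
  have "f w \<in> Z" unfolding Z_def using fw [OF w] words_topspace by auto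
  then have "w \<in> T" using T(2) w by blast
  then obtain L where L: "\<And>v. v \<in> topspace (full_shift m) \<Longrightarrow> (\<And>i. \<bar>i\<bar> \<le> L \<Longrightarrow> v i = w i) \<Longrightarrow> v \<in> T"
    using full_shift_cylinder [OF T(1)] by metis
  have "f v 0 = f w 0" if "v \<in> words" "\<forall>i. \<bar>i\<bar> \<le> L \<longrightarrow> v i = w i" for v
  proof -
    have "v \<in> T \<inter> words" using L that words_topspace by blast
    then have "f v \<in> Z" using T(2) by blast
    then show ?thesis by (simp add: Z_def)
  qed
  then show "\<exists>L. \<forall>v\<in>words. (\<forall>i. \<bar>i\<bar> \<le> L \<longrightarrow> v i = w i) \<longrightarrow> f v 0 = f w 0" by blast
qed

lemma aut_carrier:
  assumes "\<phi> \<in> carrier (aut_shift m words)" shows "aut \<phi>"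
proof -
  let ?Y = "subtopology (full_shift m) words"
  have top: "topspace ?Y = words" using words_topspace by auto
  have h: "homeomorphic_map ?Y ?Y \<phi>" and s: "\<forall>w\<in>words. \<phi> (shift w) = shift (\<phi> w)"
    using assms by (auto simp: aut_shift_def)
  obtain g where g: "homeomorphic_maps ?Y ?Y \<phi> g" using h homeomorphic_map_maps by blast
  have g\<phi>: "g (\<phi> w) = w" if "w \<in> words" for w using g that top by (simp add: homeomorphic_maps_def)
  have bij: "bij_betw \<phi> words words"
    using homeomorphic_imp_injective_map [OF h] homeomorphic_imp_surjective_map [OF h] top by (simp add: bij_betw_def)
  have cont: "continuous_map ?Y ?Y \<phi>" "continuous_map ?Y ?Y g" using g by (auto simp: homeomorphic_maps_def)
  obtain R where R: "\<forall>w\<in>words. \<forall>w'\<in>words. (\<forall>i. \<bar>i\<bar> \<le> R \<longrightarrow> w i = w' i) \<longrightarrow> g w 0 = g w' 0"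
    using continuous_block [OF cont(2)] by blast
  have "w 0 = w' 0" if w: "w \<in> words" "w' \<in> words" "\<forall>i. \<bar>i\<bar> \<le> R \<longrightarrow> \<phi> w i = \<phi> w' i" for w w'
  proof -
    have "\<phi> w \<in> words" "\<phi> w' \<in> words" using bij w by (auto simp: bij_betw_def)
    then have "g (\<phi> w) 0 = g (\<phi> w') 0" using R w(3) by blast
    then show ?thesis using g\<phi> w(1,2) by simp
  qed
  then show ?thesis unfolding aut_def using bij s continuous_block [OF cont(1)] by blast
qed

section \<open>Powers of the shift and the index of their group\<close>

definition power_shift :: "int \<Rightarrow> (int \<Rightarrow> nat) \<Rightarrow> int \<Rightarrow> nat"
  where "power_shift n = (\<lambda>w\<in>words. \<lambda>i. w (i + n))"

lemma continuous_power_shift: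
  "continuous_map (subtopology (full_shift m) words) (subtopology (full_shift m) words) (power_shift n)"
proof -
  let ?Y = "subtopology (full_shift m) words"
  have top: "topspace ?Y = words" using words_topspace by auto
  have "continuous_map ?Y (full_shift m) (power_shift n)"
    unfolding full_shift_def
  proof (subst continuous_map_componentwise_UNIV, intro allI)
    fix k
    have c: "continuous_map ?Y (discrete_topology {1..m}) (\<lambda>w. w (k + n))"
      unfolding full_shift_def
      by (intro continuous_map_from_subtopology continuous_map_product_projection) simp
    show "continuous_map (subtopology (product_topology (\<lambda>_. discrete_topology {1..m}) UNIV) words)
        (discrete_topology {1..m}) (\<lambda>w. power_shift n w k)"
      by (rule continuous_map_eq [OF c [unfolded full_shift_def]]) (auto simp: power_shift_def)
  qed
  then show ?thesis using words_shift top
    by (intro continuous_map_into_subtopology) (auto simp: power_shift_def)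
qed

lemma power_shift_carrier: "power_shift n \<in> carrier (aut_shift m words)"
proof -
  let ?Y = "subtopology (full_shift m) words"
  have top: "topspace ?Y = words" using words_topspace by auto
  have "homeomorphic_maps ?Y ?Y (power_shift n) (power_shift (- n))"
    unfolding homeomorphic_maps_def top
  proof (intro conjI ballI continuous_power_shift)
    fix w assume w: "w \<in> words"
    show "power_shift (- n) (power_shift n w) = w" "power_shift n (power_shift (- n) w) = w"
      using w words_shift [OF w, of n] words_shift [OF w, of "- n"] by (simp_all add: power_shift_def)
  qed
  then have "homeomorphic_map ?Y ?Y (power_shift n)" using homeomorphic_map_maps by blast
  moreover have "power_shift n (shift w) = shift (power_shift n w)" if "w \<in> words" for w
    using words_shift [of w 1] that by (auto simp: power_shift_def shift_def algebra_simps)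
  ultimately show ?thesis by (auto simp: aut_shift_def power_shift_def)
qed

lemma power_shift_hom:
  "power_shift (a + b) = power_shift a \<otimes>\<^bsub>aut_shift m words\<^esub> power_shift b"
proof
  fix w
  show "power_shift (a + b) w = (power_shift a \<otimes>\<^bsub>aut_shift m words\<^esub> power_shift b) w"
    by (cases "w \<in> words") (simp_all add: aut_shift_def compose_def power_shift_def words_shift add.assoc)
qed

lemma group_aut: "group (aut_shift m words)"
  using words_topspace words_shift [of _ 1] by (intro group_aut_shift) (auto simp: shift_def [abs_def])

lemma aut_mult: "w \<in> words \<Longrightarrow> (\<phi> \<otimes>\<^bsub>aut_shift m words\<^esub> \<psi>) w = \<phi> (\<psi> w)"
  by (simp add: aut_shift_def compose_def)

lemma rel_power_shift: "P \<in> lifts d \<alpha> \<Longrightarrow> rel (power_shift n) P (translate n P)"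
  unfolding rel_def using word_words over_word over_shift [OF over_word]
  by (intro bexI [of _ "word P"]) (auto simp: power_shift_def)

text \<open>The two relations may be witnessed by different words over Q, so the witnesses cannot
  simply be composed; \<open>rel_unique\<close> for \<psi> reconciles them.\<close>

lemma rel_mult:
  assumes \<psi>: "aut \<psi>" and "rel \<phi> P Q" "rel \<psi> Q S" and \<phi>: "aut \<phi>"
  shows "rel (\<psi> \<otimes>\<^bsub>aut_shift m words\<^esub> \<phi>) P S"
proof -
  obtain w where w: "w \<in> words" "over w P" "over (\<phi> w) Q" using assms(2) unfolding rel_def by blast
  have \<phi>w: "\<phi> w \<in> words" using aut_words [OF \<phi> w(1)] .
  obtain S' where S': "over (\<psi> (\<phi> w)) S'" using over_exists [OF aut_words [OF \<psi> \<phi>w]] .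
  then have "rel \<psi> Q S'" using \<phi>w w(3) unfolding rel_def by blast
  then have "S' - S \<in> integral_polys d" using rel_unique [OF \<psi> _ assms(3)] by simp
  then have "over (\<psi> (\<phi> w)) S" using S' over_cong by blast
  then show ?thesis unfolding rel_def using w aut_mult by metis
qed

text \<open>For P = \<alpha> x^d, translation by a gives the coefficient d * a * \<alpha> at index d
  - 1, so irrationality separates different powers.\<close>

lemma power_shift_inj: "inj power_shift"
proof (rule injI)
  fix a b assume eq: "power_shift a = power_shift b"
  define P where "P = monom \<alpha> d"
  have P: "P \<in> lifts d \<alpha>" by (simp add: P_def)
  have "translate a P - translate b P \<in> integral_polys d"
    using rel_unique [OF aut_carrier [OF power_shift_carrier] rel_power_shift [OF P, of a], of P "translate b P"]
      rel_power_shift [OF P, of b] eq by simp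
  then have "coeff (translate a P - translate b P) (d - 1) \<in> \<int>" by (simp add: integral_polys_def)
  moreover have "d choose (d - 1) = d" using binomial_symmetric [of "d - 1" d] d_pos by simp
  ultimately have "of_int (a - b) * (real d * \<alpha>) \<in> \<int>"
    using d_pos by (simp add: P_def coeff_translate_monom algebra_simps)
  then have q: "of_int (a - b) * (real d * \<alpha>) \<in> \<rat>" using Ints_subset_Rats by blast
  have "a - b = 0"
  proof (rule ccontr)
    assume "a - b \<noteq> 0"
    define c where "c = of_int (a - b) * real d"
    have "c \<noteq> 0" using \<open>a - b \<noteq> 0\<close> d_pos unfolding c_def by simp
    have "c \<in> \<rat>" unfolding c_def by (intro Rats_mult Rats_of_int Rats_of_nat)
    moreover have "c * \<alpha> \<in> \<rat>" using q by (simp only: c_def mult.assoc)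
    ultimately have "c * \<alpha> / c \<in> \<rat>" by (intro Rats_divide)
    then show False using irr \<open>c \<noteq> 0\<close> by simp
  qed
  then show "a = b" by simp
qed

lemma virtually_int_aut: "virtually_int (aut_shift m words)"
proof -
  let ?G = "aut_shift m words"
  interpret G: group ?G by (rule group_aut)
  define H where "H = range power_shift"
  have hom: "power_shift \<in> hom integer_group ?G"
    using power_shift_carrier power_shift_hom by (auto simp: hom_def)
  interpret h: group_hom integer_group ?G power_shift
    using hom by (simp add: group_hom_def group_hom_axioms_def group_aut)
  have H: "subgroup H ?G" using h.img_is_subgroup by (simp add: H_def)
  have "power_shift \<in> iso integer_group (?G\<lparr>carrier := H\<rparr>)"
    using hom power_shift_inj by (auto simp: iso_def hom_def bij_betw_def H_def)
  then have "integer_group \<cong> ?G\<lparr>carrier := H\<rparr>" by (auto simp: is_iso_def)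
  then have iso: "?G\<lparr>carrier := H\<rparr> \<cong> integer_group" by (rule group.iso_sym [OF group_integer_group])
  \<comment> \<open>The bound on the values at j < d is the one that coefficients in [0, 1)
    provide.\<close>
  define \<Gamma> where "\<Gamma> = {E \<in> low d. \<forall>j<d. poly E (real j) \<in> \<int> \<and> \<bar>poly E (real j)\<bar> \<le> (\<Sum>k\<le>d. real d ^ k)}"
  have "\<exists>n E. E \<in> \<Gamma> \<and> (\<forall>P Q. rel \<phi> P Q \<longrightarrow> translate n Q - P - E \<in> integral_polys d)"
    if \<phi>: "\<phi> \<in> carrier ?G" for \<phi>
  proof -
    obtain n E where E: "E \<in> low d" "\<And>n::int. poly E (of_int n) \<in> \<int>"
      "\<And>P Q. rel \<phi> P Q \<Longrightarrow> translate n Q - P - E \<in> integral_polys d"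
      using rel_form [OF aut_carrier [OF \<phi>]] by metis
    \<comment> \<open>The displacement is determined only modulo integral polynomials; this
      representative has bounded values.\<close>
    define E' where "E' = low_of d (\<lambda>k. frac (coeff E k))"
    have EE: "E - E' \<in> integral_polys d" using E(1) by (auto simp: E'_def integral_polys_def low_def frac_def)
    have "poly E' (real j) \<in> \<int>" for j
    proof -
      have "poly (E - E') (real j) \<in> \<int>" using EE by (rule poly_integral_polys) simp
      then have "poly E (of_int (int j)) - poly (E - E') (real j) \<in> \<int>" using E(2) by (intro Ints_diff)
      then show ?thesis by simp
    qed
    moreover have "\<bar>poly E' (real j)\<bar> \<le> (\<Sum>k\<le>d. real d ^ k)" if j: "j < d" for j
    proof -
      have "poly E' (real j) = (\<Sum>k\<le>d. coeff E' k * real j ^ k)" by (rule poly_eq_sum) (auto simp: E'_def)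
      also have "\<bar>\<dots>\<bar> \<le> (\<Sum>k\<le>d. \<bar>coeff E' k * real j ^ k\<bar>)" by (rule sum_abs)
      also have "\<dots> \<le> (\<Sum>k\<le>d. 1 * real d ^ k)" unfolding abs_mult
        using j by (intro sum_mono mult_mono) (auto simp: E'_def power_mono less_imp_le [OF frac_lt_1])
      finally show ?thesis by simp
    qed
    ultimately have "E' \<in> \<Gamma>" by (simp add: \<Gamma>_def E'_def)
    moreover have "translate n Q - P - E' \<in> integral_polys d" if "rel \<phi> P Q" for P Q
      using integral_polys_add [OF E(3) [OF that] EE] by (simp add: algebra_simps)
    ultimately show ?thesis by blast
  qed
  then obtain n E where nE: "\<And>\<phi>. \<phi> \<in> carrier ?G \<Longrightarrow> E \<phi> \<in> \<Gamma>"
    "\<And>\<phi> P Q. \<phi> \<in> carrier ?G \<Longrightarrow> rel \<phi> P Q \<Longrightarrow> translate (n \<phi>) Q - P - E \<phi> \<in> integral_polys d" by metis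
  have coset: "H #>\<^bsub>?G\<^esub> \<phi> = H #>\<^bsub>?G\<^esub> \<psi>" if \<phi>: "\<phi> \<in> carrier ?G" and \<psi>: "\<psi> \<in> carrier ?G" and eq: "E \<phi> = E \<psi>" for \<phi> \<psi>
  proof -
    \<comment> \<open>This power of the shift cancels the iterate of T, so \<open>s \<xi>\<close>
      lies over the translation P \<mapsto> P + E \<xi>.\<close>
    define s where "s \<xi> = power_shift (n \<xi>) \<otimes>\<^bsub>?G\<^esub> \<xi>" for \<xi>
    have s: "s \<xi> \<in> carrier ?G" if "\<xi> \<in> carrier ?G" for \<xi> using that power_shift_carrier by (simp add: s_def)
    have s_rel: "rel (s \<xi>) P (P + E \<xi>)" if \<xi>: "\<xi> \<in> carrier ?G" and P: "P \<in> lifts d \<alpha>" for \<xi> P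
    proof -
      obtain Q where Q: "rel \<xi> P Q" using rel_total [OF aut_carrier [OF \<xi>] P] .
      have "rel (power_shift (n \<xi>)) Q (translate (n \<xi>) Q)" using rel_power_shift rel_lifts(2) [OF Q] by blast
      then have "rel (s \<xi>) P (translate (n \<xi>) Q)"
        unfolding s_def using rel_mult [OF aut_carrier [OF power_shift_carrier] Q] aut_carrier [OF \<xi>] by blast
      then show ?thesis using rel_cong [of "s \<xi>" P _ P] nE(2) [OF \<xi> Q] by (simp add: algebra_simps)
    qed
    \<comment> \<open>The equal translations cancel, so \<theta> lies over the identity, and
      \<open>aut_over_identity\<close> gives s \<phi> = s \<psi>.\<close>
    define \<theta> where "\<theta> = inv\<^bsub>?G\<^esub> (s \<psi>) \<otimes>\<^bsub>?G\<^esub> s \<phi>"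
    have inv: "inv\<^bsub>?G\<^esub> (s \<psi>) \<in> carrier ?G" using s [OF \<psi>] by simp
    have \<theta>: "\<theta> \<in> carrier ?G" using s \<phi> inv by (simp add: \<theta>_def)
    have "rel \<theta> P P" if P: "P \<in> lifts d \<alpha>" for P
    proof -
      obtain w where w: "w \<in> words" "over w P" "over (s \<psi> w) (P + E \<psi>)" using s_rel [OF \<psi> P] unfolding rel_def by blast
      have "\<one>\<^bsub>?G\<^esub> w = w" using w(1) by (simp add: aut_shift_def)
      then have "(inv\<^bsub>?G\<^esub> (s \<psi>) \<otimes>\<^bsub>?G\<^esub> s \<psi>) w = w" by (simp only: G.l_inv [OF s [OF \<psi>]])
      then have "(inv\<^bsub>?G\<^esub> (s \<psi>)) (s \<psi> w) = w" using aut_mult w(1) by metis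
      then have "rel (inv\<^bsub>?G\<^esub> (s \<psi>)) (P + E \<psi>) P"
        unfolding rel_def using w aut_words [OF aut_carrier [OF s [OF \<psi>]] w(1)] by metis
      then show ?thesis unfolding \<theta>_def
        using rel_mult [OF aut_carrier [OF inv]] s_rel [OF \<phi> P] aut_carrier [OF s [OF \<phi>]] eq by metis
    qed
    then have "\<theta> w = w" if "w \<in> words" for w using aut_over_identity [OF aut_carrier [OF \<theta>]] that by blast
    then have "\<theta> = \<one>\<^bsub>?G\<^esub>" using \<theta> by (auto simp: aut_shift_def extensional_def fun_eq_iff)
    then have eq_s: "s \<phi> = s \<psi>" using s \<phi> \<psi> unfolding \<theta>_def by (metis G.inv_closed G.inv_equality G.inv_inv)
    have "power_shift (- n \<phi>) \<otimes>\<^bsub>?G\<^esub> s \<phi> = \<phi>"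
      using \<phi> power_shift_carrier h.hom_one
      by (simp add: s_def G.m_assoc [symmetric] power_shift_hom [symmetric])
    moreover have "power_shift (- n \<phi>) \<otimes>\<^bsub>?G\<^esub> s \<psi> = power_shift (- n \<phi> + n \<psi>) \<otimes>\<^bsub>?G\<^esub> \<psi>"
      using \<psi> power_shift_carrier by (simp add: s_def G.m_assoc [symmetric] power_shift_hom [symmetric])
    ultimately have "\<phi> = power_shift (- n \<phi> + n \<psi>) \<otimes>\<^bsub>?G\<^esub> \<psi>" using eq_s by simp
    then have "\<phi> \<in> H #>\<^bsub>?G\<^esub> \<psi>" unfolding r_coset_def H_def by blast
    then show ?thesis using G.repr_independence \<psi> H by metis
  qed
  have "finite \<Gamma>" unfolding \<Gamma>_def by (rule finite_bounded_integer_valued)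
  then have fin: "finite (E ` carrier ?G)" using nE(1) by (meson finite_subset image_subsetI)
  \<comment> \<open>By \<open>coset\<close> a coset depends only on the value of E, so one
    representative for each of the finitely many values covers all cosets.\<close>
  have "rcosets\<^bsub>?G\<^esub> H \<subseteq> (\<lambda>x. H #>\<^bsub>?G\<^esub> (SOME \<phi>. \<phi> \<in> carrier ?G \<and> E \<phi> = x)) ` (E ` carrier ?G)"
  proof
    fix K assume "K \<in> rcosets\<^bsub>?G\<^esub> H"
    then obtain \<phi> where \<phi>: "\<phi> \<in> carrier ?G" "K = H #>\<^bsub>?G\<^esub> \<phi>" by (auto simp: RCOSETS_def)
    define \<psi> where "\<psi> = (SOME \<psi>. \<psi> \<in> carrier ?G \<and> E \<psi> = E \<phi>)"
    have "\<psi> \<in> carrier ?G \<and> E \<psi> = E \<phi>" unfolding \<psi>_def by (rule someI [of _ \<phi>]) (use \<phi> in auto)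
    then have "K = H #>\<^bsub>?G\<^esub> \<psi>" using coset [OF \<phi>(1), of \<psi>] \<phi>(2) by simp
    then show "K \<in> (\<lambda>x. H #>\<^bsub>?G\<^esub> (SOME \<phi>. \<phi> \<in> carrier ?G \<and> E \<phi> = x)) ` (E ` carrier ?G)"
      using \<phi>(1) by (auto simp: \<psi>_def)
  qed
  then have "finite (rcosets\<^bsub>?G\<^esub> H)" using fin finite_surj by blast
  then show ?thesis unfolding virtually_int_def using group_aut H iso by blast
qed

end

theorem theorem5p12:
  fixes d m :: nat and \<alpha> :: real and U :: "nat \<Rightarrow> (nat \<Rightarrow> circle) set"
  assumes "d \<ge> 1" and "0 \<le> \<alpha>" and "\<alpha> < 1" and "\<alpha> \<notin> \<rat>"
    and "cell_partition d \<alpha> m U"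
  shows "virtually_int (aut_shift m (full_shift m closure_of coding d \<alpha> m U))"
proof -
  obtain code N where "coded_nilsystem d \<alpha> m code N"
    and code: "\<And>P k. P \<in> lifts d \<alpha> \<Longrightarrow> k \<in> {1..m} \<Longrightarrow> proj d P \<in> U k \<longleftrightarrow> code P = k"
    by (rule cell_partition_coded [OF assms(1,4,5)]) (rule that)
  then interpret coded_nilsystem d \<alpha> m code N by simp
  have "U k \<subseteq> topspace (torus d)" if "k \<in> {1..m}" for k
    using assms(5) that unfolding cell_partition_def by blast
  then have "coding d \<alpha> m U = word ` lifts d \<alpha>" using code by (intro coding_eq) auto
  then show ?thesis using closure_words virtually_int_aut by simp
qed

end
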